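(* Let $b\ge3$ be a prime, $m,s\in\mathbb{N}$, and $\boldsymbol u=(u_1,u_2,\dots)$ with $m_b/C_b\ge u_1\ge u_2\ge\cdots>0$; let $B=\mathcal{F}_{s,\infty,\boldsymbol u}$ and $a_j=-\log_b(C_bm_b^{-1}u_j)$ (so $a_j\ge0$). Let $p$ be drawn uniformly from $\mathbb{P}_m$ and, independently, $\boldsymbol g$ uniformly from $\mathbb{G}_m^s$, and let $P=P(p,\boldsymbol g)$. For $\lambda\in(0,1]$ let $\phi_\lambda:[0,\infty)\to[0,\infty)$ be $\phi_\lambda(0)=0$, $\phi_\lambda(x)=b^{-(-\log_bx)^\lambda}$ for $0<x\le1/b$, and $\phi_\lambda(x)=\lambda(x-1/b)+1/b$ for $x>1/b$ (an increasing bijection), and $\phi_\lambda^{-1}$ its inverse. Let $\log$ denote the natural logarithm. Then for every $\delta\in(0,1)$, $\Pr[e^{\mathrm{wor}}(Q_P;B)\le\epsilon]\ge1-\delta$ holds for the following $\epsilon$: (1) if there is a constant $a\ge0$ with $a_1=a_2=\cdots=a$, then \[\epsilon=\inf_{\substack{\lambda\in(1/2,1)\\\tau\in(0,\min(\lambda,1/\log b))}}\phi_\lambda^{-1}\left(\frac{3C_{s,\lambda,\tau}}{(b^m-1)\delta(\tau e\log b)^{1/\tau}}\right),\quad C_{s,\lambda,\tau}=\sum_{i=1}^\infty\exp\left(2\sqrt{s(b-1)(i+1)}-(i^\lambda-i^\tau)\log b\right);\] (2) if there are constants $a,q>0$ with $a_j\ge a(j-1)^q$ for all $j$, then \[\epsilon=\inf_{\substack{\lambda\in((q+1)/(2q+1),1)\\\tau\in(0,\min(\lambda,1/\log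 b))}}\phi_\lambda^{-1}\left(\frac{3C_{a,q,\lambda,\tau}}{(b^m-1)\delta(\tau e\log b)^{1/\tau}}\right),\quad C_{a,q,\lambda,\tau}=\sum_{i=1}^\infty\exp\left(A_{a,q}(i+1)^{\frac{q+1}{2q+1}}-(i^\lambda-i^\tau)\log b\right),\] with $A_{a,q}=1+(b-1)\left(1+\frac{\Gamma(1/q)}{qa^{1/q}}\right)$ and $\Gamma$ the Gamma function.
   Context: $m_b=2\sin(\pi/b)$; $M_b=2$ if $b$ is even and $M_b=2\sin((b+1)\pi/(2b))$ if $b$ is odd; $C_b=M_b+bm_b/(b-M_b)$ for $b\ge3$. $\mathbb{F}_b$ is the field with $b$ elements; $\mathbb{P}_m$ is the set of monic irreducible polynomials of degree $m$ in $\mathbb{F}_b[x]$; $\mathbb{G}_m=\{g\in\mathbb{F}_b[x]\mid g\ne0,\deg g<m\}$. For $0\le k<b^m$ with digits $\kappa_i$, $k(x)=\sum_i\kappa_ix^i$. The infinite-precision polynomial lattice point set is the multiset $P(p,\boldsymbol g)=\{\boldsymbol x_k=\nu_\infty(k(x)\boldsymbol g(x)/p(x))\mid0\le k<b^m\}$, where $\nu_\infty(\sum_{i\ge c}a_ix^{-i})=\sum_{i\ge\max(1,c)}a_ib^{-i}$ on $\mathbb{F}_b((x^{-1}))$, componentwise. $\mathcal{F}_{s,\infty,\boldsymbol u}$ is the Banach space of $f\in C^\infty([0,1]^s)$ with norm $\sup_{(\alpha_1,\dots,\alpha_s)\in\mathbb{N}_0^s}\prod_{j=1}^su_j^{-\alpha_j}\int_{[0,1]^s}|f^{(\alpha_1,\dots,\alpha_s)}(\boldsymbol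 x)|\,\mathrm d\boldsymbol x$. $Q_P(f)=b^{-m}\sum_kf(\boldsymbol x_k)$, $I_s(f)=\int_{[0,1]^s}f$, $e^{\mathrm{wor}}(Q_P;B)=\sup_{\|f\|_B\le1}|Q_P(f)-I_s(f)|$. *)

theory Defs
  imports "HOL-Analysis.Analysis" "Berlekamp_Zassenhaus.Finite_Field"
begin

definition m_b :: "nat \<Rightarrow> real" where
  "m_b b = 2 * sin (pi / real b)"

definition M_b :: "nat \<Rightarrow> real" where
  "M_b b = (if even b then 2 else 2 * sin ((real b + 1) * pi / (2 * real b)))"

definition C_b :: "nat \<Rightarrow> real" where
  "C_b b = M_b b + real b * m_b b / (real b - M_b b)"

definition monic_irred_polys :: "nat \<Rightarrow> ('b::prime_card mod_ring) poly set" where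
  "monic_irred_polys m = {p. Polynomial.lead_coeff p = 1 \<and> irreducible p \<and> Polynomial.degree p = m}"

definition G_polys :: "nat \<Rightarrow> ('b::prime_card mod_ring) poly set" where
  "G_polys m = {g. g \<noteq> 0 \<and> Polynomial.degree g < m}"

definition k_poly :: "nat \<Rightarrow> nat \<Rightarrow> ('b::prime_card mod_ring) poly" where
  "k_poly m k = (\<Sum>i<m. Polynomial.monom (of_nat ((k div CARD('b) ^ i) mod CARD('b))) i)"

text \<open>Coefficient a_i of x^(-i) (i >= 1) in the Laurent expansion in x^(-1) of h/p.
  Writing h = q p + r, h/p = q + sum_(i>=1) a_i x^(-i), and a_i is the constant coefficient
  of (x^i h) div p.\<close>
definition laurent_coeff :: "'a::field poly \<Rightarrow> 'a poly \<Rightarrow> nat \<Rightarrow> 'a" where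
  "laurent_coeff h p i = Polynomial.coeff ((Polynomial.monom 1 i * h) div p) 0"

definition nu_inf :: "('b::prime_card mod_ring) poly \<Rightarrow> 'b mod_ring poly \<Rightarrow> real" where
  "nu_inf h p = (\<Sum>i. real_of_int (to_int_mod_ring (laurent_coeff h p (Suc i)))
                        / real CARD('b) ^ Suc i)"

definition pl_point :: "nat \<Rightarrow> nat \<Rightarrow> ('b::prime_card mod_ring) poly \<Rightarrow>
    (nat \<Rightarrow> 'b mod_ring poly) \<Rightarrow> nat \<Rightarrow> (nat \<Rightarrow> real)" where
  "pl_point s m p g k = restrict (\<lambda>j. nu_inf (k_poly m k * g j) p) {1..s}"

definition unit_cube :: "nat \<Rightarrow> (nat \<Rightarrow> real) set" where
  "unit_cube s = PiE {1..s} (\<lambda>_. {0..1})"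

definition cube_measure :: "nat \<Rightarrow> (nat \<Rightarrow> real) measure" where
  "cube_measure s = PiM {1..s} (\<lambda>_. restrict_space lborel {0..1})"

text \<open>D is a family of (iterated, mixed) partial derivatives of f on [0,1]^s, indexed by
  multi-indices alpha (supported on {1..s}): D 0 = f, each D alpha is continuous on the cube,
  and D (alpha + e_j) is the partial derivative of D alpha in coordinate j (one-sided at the
  boundary). f is C^infinity on [0,1]^s iff such a D exists.\<close>
definition smooth_derivs :: "nat \<Rightarrow> ((nat \<Rightarrow> real) \<Rightarrow> real) \<Rightarrow>
    ((nat \<Rightarrow> nat) \<Rightarrow> (nat \<Rightarrow> real) \<Rightarrow> real) \<Rightarrow> bool" where
  "smooth_derivs s f D \<longleftrightarrow>
     (\<forall>x\<in>unit_cube s. D (\<lambda>_. 0) x = f x) \<and>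
     (\<forall>\<alpha>. continuous_on (unit_cube s) (D \<alpha>)) \<and>
     (\<forall>\<alpha> j x. j \<in> {1..s} \<longrightarrow> x \<in> unit_cube s \<longrightarrow>
        ((\<lambda>t. D \<alpha> (x(j := t))) has_real_derivative D (\<alpha>(j := Suc (\<alpha> j))) x)
          (at (x j) within {0..1}))"

definition in_unit_ball :: "nat \<Rightarrow> (nat \<Rightarrow> real) \<Rightarrow> ((nat \<Rightarrow> real) \<Rightarrow> real) \<Rightarrow> bool" where
  "in_unit_ball s u f \<longleftrightarrow>
     (\<exists>D. smooth_derivs s f D \<and>
        (\<forall>\<alpha>. (\<forall>j. j \<notin> {1..s} \<longrightarrow> \<alpha> j = 0) \<longrightarrow>
           (\<Prod>j\<in>{1..s}. u j powr (- real (\<alpha> j))) *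
             integral\<^sup>L (cube_measure s) (\<lambda>x. \<bar>D \<alpha> x\<bar>) \<le> 1))"

definition Q_rule :: "nat \<Rightarrow> nat \<Rightarrow> ('b::prime_card mod_ring) poly \<Rightarrow>
    (nat \<Rightarrow> 'b mod_ring poly) \<Rightarrow> ((nat \<Rightarrow> real) \<Rightarrow> real) \<Rightarrow> real" where
  "Q_rule s m p g f = (\<Sum>k<CARD('b) ^ m. f (pl_point s m p g k)) / real CARD('b) ^ m"

definition I_s :: "nat \<Rightarrow> ((nat \<Rightarrow> real) \<Rightarrow> real) \<Rightarrow> real" where
  "I_s s f = integral\<^sup>L (cube_measure s) f"

definition e_wor :: "nat \<Rightarrow> (nat \<Rightarrow> real) \<Rightarrow> nat \<Rightarrow> ('b::prime_card mod_ring) poly \<Rightarrow>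
    (nat \<Rightarrow> 'b mod_ring poly) \<Rightarrow> ereal" where
  "e_wor s u m p g = (SUP f\<in>{f. in_unit_ball s u f}. ereal \<bar>Q_rule s m p g f - I_s s f\<bar>)"

definition prob_err_le :: "'b::prime_card itself \<Rightarrow> nat \<Rightarrow> (nat \<Rightarrow> real) \<Rightarrow> nat \<Rightarrow> real \<Rightarrow> real" where
  "prob_err_le (_ :: 'b itself) s u m \<epsilon> =
     real (card {(p :: 'b::prime_card mod_ring poly, g). p \<in> monic_irred_polys m \<and>
                   g \<in> PiE {1..s} (\<lambda>_. G_polys m) \<and> e_wor s u m p g \<le> ereal \<epsilon>})
     / real (card ((monic_irred_polys m :: 'b mod_ring poly set) \<times> PiE {1..s} (\<lambda>_. (G_polys m :: 'b mod_ring poly set))))"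

definition phi :: "nat \<Rightarrow> real \<Rightarrow> real \<Rightarrow> real" where
  "phi b lam x = (if x = 0 then 0
                  else if x \<le> 1 / real b then real b powr (- ((- log (real b) x) powr lam))
                  else lam * (x - 1 / real b) + 1 / real b)"

definition phi_inv :: "nat \<Rightarrow> real \<Rightarrow> real \<Rightarrow> real" where
  "phi_inv b lam = inv_into {0..} (phi b lam)"

definition C_const1 :: "nat \<Rightarrow> nat \<Rightarrow> real \<Rightarrow> real \<Rightarrow> real" where
  "C_const1 b s lam tau = (\<Sum>i. let n = real (Suc i) in
     exp (2 * sqrt (real s * (real b - 1) * (n + 1)) - (n powr lam - n powr tau) * ln (real b)))"

definition A_const :: "nat \<Rightarrow> real \<Rightarrow> real \<Rightarrow> real" where
  "A_const b a q = 1 + (real b - 1) * (1 + Gamma (1 / q) / (q * a powr (1 / q)))"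

definition C_const2 :: "nat \<Rightarrow> real \<Rightarrow> real \<Rightarrow> real \<Rightarrow> real \<Rightarrow> real" where
  "C_const2 b a q lam tau = (\<Sum>i. let n = real (Suc i) in
     exp (A_const b a q * (n + 1) powr ((q + 1) / (2 * q + 1)) - (n powr lam - n powr tau) * ln (real b)))"

end

theory Submission
  imports Defs "HOL-Probability.Probability" "HOL-Real_Asymp.Real_Asymp"
    "Berlekamp_Zassenhaus.Distinct_Degree_Factorization"
begin

text \<open>The Walsh coefficient of \<open>f\<close> at an index \<open>k\<close> whose \<open>j\<close>-th component has \<open>v\<^sub>j\<close> nonzero digits is the
  integral of the mixed derivative of order \<open>(v\<^sub>1, \<dots>, v\<^sub>s)\<close> against a bounded kernel, hence at most
  \<open>b\<close> to the power \<open>-\<mu>(k)\<close> for \<open>f\<close> in the unit ball, where \<open>\<mu>\<close> is the Dick weight shifted by \<open>a\<^sub>j\<close>.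
  Partial sums of the Walsh series are averages of \<open>f\<close> over shrinking \<open>b\<close>-adic boxes, and a character sum over
  the points vanishes unless \<open>p\<close> divides \<open>\<Sum>\<^sub>j k\<^sub>j g\<^sub>j\<close>; so the worst-case error is at most the sum of
  these powers over the nonzero dual vectors.

  For fixed \<open>k \<noteq> 0\<close> the divisibility has probability at most \<open>3 \<lfloor>\<mu>(k)\<rfloor> / (b\<^sup>m - 1)\<close>: either \<open>p\<close> misses some
  \<open>k\<^sub>j\<close> and fixes \<open>g\<^sub>j\<close> given the others, or \<open>p\<close> is one of the at most \<open>deg k\<^sub>j / m\<close> irreducible divisors of a
  nonzero \<open>k\<^sub>j\<close>, while there are at least \<open>b\<^sup>m / (2m)\<close> candidates for \<open>p\<close>. As \<open>\<phi>\<^sub>\<lambda>\<close> is subadditive, it maps the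
  error bound to a sum whose expectation is controlled by counting indices of given weight, and Markov's
  inequality gives the claim.\<close>

text \<open>Applied to the sum of \<open>b powr (- mu)\<close> itself, Markov's inequality would
  yield only order b^(-m). For the sum of \<open>b powr (- (mu powr lam))\<close> it also yields
  order b^(-m), but \<open>phi_inv\<close> takes b^(-x), x \<ge> 1, to b^(-x^(1/lam)), so the error
  decays faster than any power of b^m. The price is convergence: at most exp(O(M^r)) indices have
  weight at most M, with r = 1/2 or r = (q+1)/(2q+1), hence the range of \<open>lam\<close>. The
  parameter \<open>tau\<close> serves to absorb the factor floor(mu) of the divisibility probability
  into b^(i^tau). Two obstacles shape the lemmas. The dual vectors are infinitely many, so all sums
  run over indices with fewer than \<open>n\<close> digits and all bounds are uniform in
  \<open>n\<close>. And the Laurent digits of a point may end in repeated digits b-1, so they need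
  not be the digits of the real number that they define; the box averaged over is therefore the one
  given by the digit sequence, and its closure contains the point.\<close>

hide_const (open) up_ring.coeff up_ring.monom module.smult

section \<open>The functions phi\<close>

lemma phi_zero [simp]: "phi b lam 0 = 0"
  by (simp add: phi_def)

lemma phi_small:
  assumes "0 < x" "x \<le> 1 / real b"
  shows "phi b lam x = real b powr (- ((- log (real b) x) powr lam))"
  using assms by (simp add: phi_def)

text \<open>Both branches take the value 1/b at 1/b. Including this point lets the two regions
  overlap, so that later case distinctions can be glued there.\<close>

lemma phi_large:
  assumes "b \<ge> 2" "1 / real b \<le> x"
  shows "phi b lam x = lam * (x - 1 / real b) + 1 / real b"
proof (cases "x = 1 / real b")
  case True
  have "log (real b) (1 / real b) = -1"
    using assms(1) by (simp add: log_divide)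
  with assms(1) show ?thesis
    unfolding True by (simp add: phi_def powr_minus inverse_eq_divide)
next
  case False
  have "x > 0" using assms by (smt (verit) divide_pos_pos of_nat_0_less_iff pos2 less_le_trans)
  with assms False show ?thesis by (simp add: phi_def)
qed

lemma neg_log_ge_1:
  assumes "b \<ge> (2::nat)" "0 < x" "x \<le> 1 / real b"
  shows "- log (real b) x \<ge> 1"
proof -
  have "log (real b) x \<le> log (real b) (1 / real b)"
    using assms by (subst log_le_cancel_iff) auto
  also have "\<dots> = -1" using assms by (simp add: log_divide)
  finally show ?thesis by simp
qed

lemma phi_strict_mono:
  assumes b: "b \<ge> 2" and lam: "0 < lam" and xy: "0 \<le> x" "x < y"
  shows "phi b lam x < phi b lam y"
proof -
  have less: "phi b lam x < phi b lam y" if "0 < x" "x < y" "y \<le> 1 / real b" for x y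
  proof -
    have "log (real b) x < log (real b) y"
      using that b by (subst log_less_cancel_iff) auto
    moreover have "- log (real b) y \<ge> 1" using neg_log_ge_1[OF b] that by simp
    ultimately have "(- log (real b) y) powr lam < (- log (real b) x) powr lam"
      using lam by (intro powr_less_mono2) auto
    thus ?thesis using that b by (simp add: phi_small)
  qed
  have large: "phi b lam x < phi b lam y" if "1 / real b \<le> x" "x < y" for x y
    using that b lam by (simp add: phi_large)
  have pos: "0 < phi b lam y" if "0 < y" for y
  proof (cases "y \<le> 1 / real b")
    case True
    thus ?thesis using that b by (simp add: phi_small)
  next
    case False
    thus ?thesis using b lam by (simp add: phi_large add_nonneg_pos)
  qed
  consider "x = 0" | "0 < x" "y \<le> 1 / real b" | "1 / real b \<le> x" | "0 < x" "x < 1 / real b" "1 / real b < y"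
    using xy by linarith
  thus ?thesis
  proof cases
    case 4
    have "phi b lam x < phi b lam (1 / real b)" using 4 by (intro less) auto
    also have "\<dots> < phi b lam y" using 4 by (intro large) auto
    finally show ?thesis .
  qed (use less large pos xy in auto)
qed

lemma phi_nonneg:
  assumes "b \<ge> 2" "0 < lam" "0 \<le> x"
  shows "0 \<le> phi b lam x"
  using phi_strict_mono[OF assms(1,2), of 0 x] assms(3) by (cases "x = 0") auto

text \<open>Monotonicity of \<open>phi x / x\<close>, written without division. With t = -log_b x
  the ratio is b^(t - t^lam) on the first branch, and t - t^lam = t^lam (t^(1-lam) - 1) is a product
  of nonnegative nondecreasing factors for t \<ge> 1. On the affine branch the intercept (1 - lam)/b
  is nonnegative.\<close>

lemma phi_ratio_decreasing:
  assumes b: "b \<ge> 2" and lam: "0 < lam" "lam \<le> 1" and xy: "0 < x" "x \<le> y"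
  shows "phi b lam y * x \<le> phi b lam x * y"
proof -
  have B: "1 < real b" using b by simp
  have small: "phi b lam y * x \<le> phi b lam x * y" if "0 < x" "x \<le> y" "y \<le> 1 / real b" for x y
  proof -
    define t where "t = - log (real b) x"
    define r where "r = - log (real b) y"
    have r1: "r \<ge> 1" using neg_log_ge_1[OF b] that by (simp add: r_def)
    have rt: "r \<le> t" using that B by (simp add: r_def t_def)
    have x: "x = real b powr (- t)" and y: "y = real b powr (- r)"
      using that B by (simp_all add: t_def r_def)
    have split: "u - u powr lam = u powr lam * (u powr (1 - lam) - 1)" if "u \<ge> 1" for u :: real
      using that by (simp add: algebra_simps flip: powr_add)
    have "r - r powr lam \<le> t - t powr lam"
      unfolding split[OF r1] split[OF order.trans[OF r1 rt]]
      using r1 rt lam by (intro mult_mono) (auto intro!: powr_mono2 ge_one_powr_ge_zero)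
    hence "real b powr (- (r powr lam) - t) \<le> real b powr (- (t powr lam) - r)"
      using B by simp
    moreover have "phi b lam x = real b powr (- (t powr lam))" "phi b lam y = real b powr (- (r powr lam))"
      using that by (simp_all add: phi_small t_def r_def)
    moreover have "phi b lam y * x = real b powr (- (r powr lam) - t)"
      "phi b lam x * y = real b powr (- (t powr lam) - r)"
      using calculation(2,3) by (simp_all add: x y powr_add[symmetric])
    ultimately show ?thesis by simp
  qed
  have large: "phi b lam y * x \<le> phi b lam x * y" if "1 / real b \<le> x" "x \<le> y" for x y
  proof -
    have "(1 - lam) / real b * x \<le> (1 - lam) / real b * y"
      using that lam by (intro mult_left_mono) auto
    thus ?thesis using that b by (simp add: phi_large algebra_simps diff_divide_distrib)
  qed
  consider "y \<le> 1 / real b" | "1 / real b \<le> x" | "x < 1 / real b" "1 / real b < y"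
    by linarith
  thus ?thesis
  proof cases
    case 3
    \<comment> \<open>The joint 1/b is a fixed point of \<open>phi\<close>; comparing with it on
      either side gives x \<le> \<open>phi x\<close> on the left and \<open>phi y\<close> \<le> y on
      the right.\<close>
    define c where "c = 1 / real b"
    have c: "c > 0" "phi b lam c = c" using B b by (simp_all add: c_def phi_large)
    have "phi b lam c * x \<le> phi b lam x * c" using 3 xy by (intro small) (auto simp: c_def)
    hence 1: "x \<le> phi b lam x" using c by (simp add: mult.commute)
    have "phi b lam y * c \<le> phi b lam c * y" using 3 xy by (intro large) (auto simp: c_def)
    hence 2: "phi b lam y \<le> y" using c by (simp add: mult.commute)
    show ?thesis using mult_mono[OF 1 2] xy phi_nonneg[OF b lam(1)] 1 2
      by (smt (verit) mult.commute mult_mono)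
  qed (use small large xy in auto)
qed

text \<open>Each of x and y is compared with x + y by the ratio lemma; adding the two inequalities
  and cancelling x + y gives the claim.\<close>

lemma phi_subadd:
  assumes b: "b \<ge> 2" and lam: "0 < lam" "lam \<le> 1" and xy: "0 \<le> x" "0 \<le> y"
  shows "phi b lam (x + y) \<le> phi b lam x + phi b lam y"
proof (cases "x = 0 \<or> y = 0")
  case False
  hence "0 < x" "0 < y" using xy by auto
  with phi_ratio_decreasing[OF b lam, of x "x + y"] phi_ratio_decreasing[OF b lam, of y "x + y"]
  have "phi b lam (x + y) * (x + y) \<le> (phi b lam x + phi b lam y) * (x + y)"
    by (simp add: algebra_simps)
  thus ?thesis using \<open>0 < x\<close> \<open>0 < y\<close> by (simp add: mult_le_cancel_right)
qed auto

lemma phi_sum_le: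
  assumes b: "b \<ge> 2" and lam: "0 < lam" "lam \<le> 1" and "\<And>i. i \<in> A \<Longrightarrow> 0 \<le> f i"
  shows "phi b lam (\<Sum>i\<in>A. f i) \<le> (\<Sum>i\<in>A. phi b lam (f i))"
  using assms(4)
proof (induction A rule: infinite_finite_induct)
  case (insert a A)
  have "phi b lam (f a + sum f A) \<le> phi b lam (f a) + phi b lam (sum f A)"
    using insert.prems by (intro phi_subadd b lam sum_nonneg) auto
  with insert show ?case by simp
qed auto

lemma phi_surj:
  assumes b: "b \<ge> 2" and lam: "0 < lam" and y: "0 \<le> y"
  shows "\<exists>x\<ge>0. phi b lam x = y"
proof -
  have B: "1 < real b" using b by simp
  consider "y = 0" | "0 < y" "y \<le> 1 / real b" | "1 / real b < y" using y by linarith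
  thus ?thesis
  proof cases
    case 2
    define t where "t = - log (real b) y"
    have t: "t \<ge> 1" using neg_log_ge_1[OF b] 2 by (simp add: t_def)
    define x where "x = real b powr (- (t powr (1 / lam)))"
    have "real b powr 1 \<le> real b powr (t powr (1 / lam))"
      using t lam B by (intro powr_mono ge_one_powr_ge_zero) auto
    hence "x \<le> 1 / real b" using B by (simp add: x_def powr_minus field_simps)
    moreover have "x > 0" using B by (simp add: x_def)
    ultimately have "phi b lam x = real b powr (- t)"
      using B t lam by (simp add: phi_small x_def powr_powr)
    also have "\<dots> = y" using 2 B by (simp add: t_def)
    finally show ?thesis using \<open>x > 0\<close> by (intro exI[of _ x]) auto
  next
    case 3
    define x where "x = (y - 1 / real b) / lam + 1 / real b"
    have "1 / real b \<le> x" using 3 lam by (simp add: x_def)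
    moreover have "0 \<le> x" using calculation by (smt (verit) of_nat_0_le_iff zero_le_divide_1_iff)
    ultimately show ?thesis using b lam by (intro exI[of _ x]) (auto simp: phi_large x_def)
  qed (auto intro: exI[of _ 0])
qed

lemma phi_inv_nonneg:
  assumes "b \<ge> 2" "0 < lam" "0 \<le> y"
  shows "0 \<le> phi_inv b lam y"
  using inv_into_into[of y "phi b lam" "{0..}"] phi_surj[OF assms] by (auto simp: phi_inv_def image_iff)

lemma le_phi_inv:
  assumes b: "b \<ge> 2" and lam: "0 < lam" and "0 \<le> x" "phi b lam x \<le> y"
  shows "x \<le> phi_inv b lam y"
proof -
  have y: "0 \<le> y" using phi_nonneg[OF b lam] assms by (meson order.trans)
  have "phi b lam (phi_inv b lam y) = y"
    unfolding phi_inv_def using phi_surj[OF b lam y] by (intro f_inv_into_f) (auto simp: image_iff)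
  thus ?thesis using phi_strict_mono[OF b lam phi_inv_nonneg[OF b lam y], of x] assms(4)
    by (force simp: not_less[symmetric])
qed

section \<open>Series and the Gamma function\<close>

text \<open>Origin of the constant (tau e log b)^(1/tau): with y = n^tau ln B, the inequality tau y
  \<le> exp(tau y - 1) is raised to the power 1/tau.\<close>

lemma le_exp_powr:
  fixes B :: real
  assumes "1 < B" "0 < tau" "0 < n"
  shows "n \<le> B powr (n powr tau) / (tau * exp 1 * ln B) powr (1 / tau)"
proof -
  have lnB: "ln B > 0" using assms by simp
  define y where "y = n powr tau * ln B"
  have y: "y > 0" using assms lnB by (simp add: y_def)
  have "tau * y \<le> exp (tau * y - 1)" using exp_ge_add_one_self[of "tau * y - 1"] by simp
  also have "\<dots> = exp (tau * y) / exp 1" by (simp add: exp_diff)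
  finally have "tau * exp 1 * ln B * n powr tau \<le> exp (tau * y)"
    by (simp add: y_def field_simps)
  hence "(tau * exp 1 * ln B * n powr tau) powr (1 / tau) \<le> exp (tau * y) powr (1 / tau)"
    using assms lnB by (intro powr_mono2) auto
  moreover have "(tau * exp 1 * ln B * n powr tau) powr (1 / tau) = (tau * exp 1 * ln B) powr (1 / tau) * n"
    using assms lnB by (subst powr_mult) (auto simp: powr_powr)
  moreover have "exp (tau * y) powr (1 / tau) = B powr (n powr tau)"
    using assms by (simp add: powr_def y_def)
  ultimately show ?thesis using assms lnB by (simp add: field_simps)
qed

text \<open>Since \<open>lam\<close> exceeds both \<open>r\<close> and \<open>tau\<close>, the term
  -n^lam dominates the exponent, and the summands are eventually below 1/n^2.\<close>

lemma summable_exp_powr_diff: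
  fixes A B lam r tau :: real
  assumes "0 < r" "r < lam" "0 < tau" "tau < lam" "lam < 1" "0 < B" "A > 0"
  shows "summable (\<lambda>i. exp (A * (real (Suc i) + 1) powr r - (real (Suc i) powr lam - real (Suc i) powr tau) * B))"
proof -
  have "((\<lambda>n::real. exp (A * (n + 1) powr r - (n powr lam - n powr tau) * B) * n ^ 2) \<longlongrightarrow> 0) at_top"
    using assms by real_asymp
  from order_tendstoD(2)[OF tendsto_rabs_zero[OF filterlim_compose[OF this filterlim_real_sequentially]], of 1]
  have "eventually (\<lambda>n. \<bar>exp (A * (real n + 1) powr r - (real n powr lam - real n powr tau) * B) * real n ^ 2\<bar> < 1) sequentially"
    by simp
  hence "eventually (\<lambda>n. norm (exp (A * (real n + 1) powr r - (real n powr lam - real n powr tau) * B)) \<le> 1 / real n ^ 2) sequentially"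
    using eventually_gt_at_top[of 0]
    by eventually_elim (simp add: abs_mult field_simps)
  hence "summable (\<lambda>n. exp (A * (real n + 1) powr r - (real n powr lam - real n powr tau) * B))"
    by (rule summable_comparison_test_ev) (use inverse_power_summable[of 2, where 'a=real] in \<open>simp add: inverse_eq_divide\<close>)
  from summable_Suc_iff[THEN iffD2, OF this] show ?thesis .
qed

text \<open>The Gamma integral is split at the points \<open>c j\<^sup>q\<close>; on each piece \<open>e\<^sup>-\<^sup>t\<close> is bounded below by its value
  at the right end point, and the remaining power integrates to \<open>q c powr (1 / q)\<close>.\<close>

lemma sum_exp_powr_le_Gamma:
  fixes c q :: real
  assumes c: "0 < c" and q: "0 < q"
  shows "(\<Sum>j=1..N. exp (- (c * real j powr q))) \<le> Gamma (1 / q) / (q * c powr (1 / q))"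
proof -
  define p where "p = 1 / q"
  have p: "p > 0" using q by (simp add: p_def)
  define G where "G = (\<lambda>t::real. t powr (p - 1) / exp t)"
  define t where "t = (\<lambda>j::nat. c * real j powr q)"
  have t_mono: "t i \<le> t j" if "i \<le> j" for i j
    using that c q by (auto simp: t_def intro!: mult_left_mono powr_mono2)
  have t0: "t 0 = 0" by (simp add: t_def)
  have Gamma: "(G has_integral Gamma p) {0..}"
    using Gamma_integral_real[OF p] by (simp add: G_def)
  have G_int: "G integrable_on {x..y}" if "0 \<le> x" for x y
    by (rule integrable_on_subinterval[OF has_integral_integrable[OF Gamma]]) (use that in auto)
  have tp: "t j powr p = c powr p * real j" for j
    using c q by (simp add: t_def p_def powr_mult powr_powr)
  have step: "q * c powr p * exp (- t (Suc j)) \<le> integral {t j..t (Suc j)} G" for j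
  proof -
    have le: "0 \<le> t j" "t j \<le> t (Suc j)" using t_mono[of 0 j] t_mono[of j "Suc j"] t0 by auto
    have "((\<lambda>x. x powr (p - 1)) has_integral (t (Suc j) powr p / p - t j powr p / p)) {t j..t (Suc j)}"
    proof (rule fundamental_theorem_of_calculus_interior[OF le(2)])
      show "continuous_on {t j..t (Suc j)} (\<lambda>x. x powr p / p)"
        using le p by (intro continuous_intros continuous_on_powr') auto
      fix x assume "x \<in> {t j<..<t (Suc j)}"
      hence "x > 0" using le by auto
      hence "((\<lambda>x. x powr p / p) has_real_derivative x powr (p - 1)) (at x)"
        using p by (auto intro!: derivative_eq_intros simp: powr_diff)
      thus "((\<lambda>x. x powr p / p) has_vector_derivative x powr (p - 1)) (at x)"
        by (simp add: has_real_derivative_iff_has_vector_derivative)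
    qed
    from has_integral_mult_left[OF this, of "exp (- t (Suc j))"]
    have I: "((\<lambda>x. x powr (p - 1) * exp (- t (Suc j))) has_integral (q * c powr p * exp (- t (Suc j)))) {t j..t (Suc j)}"
    proof -
      have "(t (Suc j) powr p / p - t j powr p / p) * exp (- t (Suc j)) = q * c powr p * exp (- t (Suc j))"
        using q by (simp add: tp[of j] tp[of "Suc j"]) (simp add: p_def algebra_simps)
      with \<open>((\<lambda>x. x powr (p - 1) * exp (- t (Suc j))) has_integral _) _\<close> show ?thesis by simp
    qed
    have "q * c powr p * exp (- t (Suc j)) \<le> integral {t j..t (Suc j)} G"
      by (rule has_integral_le[OF I integrable_integral[OF G_int]])
         (use le in \<open>auto simp: G_def exp_minus field_simps intro!: mult_right_mono\<close>)
    thus ?thesis .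
  qed
  have "q * c powr p * (\<Sum>j=1..N. exp (- t j)) \<le> integral {0..t N} G"
  proof (induction N)
    case (Suc N)
    have "q * c powr p * (\<Sum>j=1..Suc N. exp (- t j)) \<le> integral {0..t N} G + integral {t N..t (Suc N)} G"
      using Suc step[of N] by (simp add: algebra_simps)
    also have "\<dots> = integral {0..t (Suc N)} G"
      using t_mono[of 0 N] t_mono[of N "Suc N"] t0
      by (intro Henstock_Kurzweil_Integration.integral_combine G_int) auto
    finally show ?case .
  qed (simp add: t0)
  also have "\<dots> \<le> integral {0..} G"
    by (rule integral_subset_le) (use G_int Gamma in \<open>auto simp: G_def\<close>)
  also have "\<dots> = Gamma p" using Gamma by (rule integral_unique)
  finally show ?thesis using c q by (simp add: t_def p_def field_simps)
qed

section \<open>Polynomial indices and characters\<close>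

text \<open>The bound is put on coefficients and not on the degree, because the zero polynomial has
  degree 0: in this form \<open>polys 0\<close> is {0} and \<open>pCons\<close> gives a uniform
  recursion in \<open>n\<close>.\<close>

definition polys :: "nat \<Rightarrow> 'a::zero poly set" where
  "polys n = {k. \<forall>i\<ge>n. coeff k i = 0}"

lemma zero_in_polys [simp]: "0 \<in> polys n"
  by (simp add: polys_def)

lemma polys_0: "polys 0 = {0}"
  by (auto simp: polys_def poly_eq_iff)

lemma pCons_in_polys_iff [simp]: "pCons c k \<in> polys (Suc n) \<longleftrightarrow> k \<in> polys n"
proof
  assume "pCons c k \<in> polys (Suc n)"
  hence "coeff (pCons c k) (Suc i) = 0" if "n \<le> i" for i using that by (simp add: polys_def del: coeff_pCons_Suc)
  thus "k \<in> polys n" by (simp add: polys_def)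
qed (auto simp: polys_def coeff_pCons split: nat.splits)

lemma polys_mono: "n \<le> n' \<Longrightarrow> polys n \<subseteq> polys n'"
  by (auto simp: polys_def)

lemma in_polys_iff: "k \<in> polys n \<longleftrightarrow> k = 0 \<or> degree k < n"
proof
  assume "k \<in> polys n"
  thus "k = 0 \<or> degree k < n" by (auto simp: polys_def not_less[symmetric] leading_coeff_0_iff[symmetric] simp del: leading_coeff_0_iff)
qed (auto simp: polys_def intro: coeff_eq_0)

lemma bij_betw_pCons_polys:
  "bij_betw (\<lambda>(c, k). pCons c k) (UNIV \<times> polys n) (polys (Suc n) :: 'a::zero poly set)"
proof (rule bij_betwI')
  fix y :: "'a poly" assume "y \<in> polys (Suc n)"
  moreover obtain c k where "y = pCons c k" by (cases y)
  ultimately show "\<exists>x\<in>UNIV \<times> polys n. y = (case x of (c, k) \<Rightarrow> pCons c k)" by force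
qed auto

lemma finite_polys [simp]: "finite (polys n :: 'a::{finite,zero} poly set)"
proof (induction n)
  case (Suc n)
  thus ?case using bij_betw_finite[OF bij_betw_pCons_polys[of n, where 'a='a]] by simp
qed (simp add: polys_0)

lemma card_polys: "card (polys n :: 'a::{finite,zero} poly set) = CARD('a) ^ n"
proof (induction n)
  case (Suc n)
  thus ?case using bij_betw_same_card[OF bij_betw_pCons_polys[of n, where 'a='a]]
    by (simp add: card_cartesian_product)
qed (simp add: polys_0)

lemma sum_polys_Suc:
  fixes F :: "'a::{finite,zero} poly \<Rightarrow> 'c::comm_monoid_add"
  shows "(\<Sum>k\<in>polys (Suc n). F k) = (\<Sum>c\<in>UNIV. \<Sum>k\<in>polys n. F (pCons c k))"
  by (subst sum.reindex_bij_betw[OF bij_betw_pCons_polys, symmetric])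
     (simp add: sum.cartesian_product split_def)

text \<open>Walsh functions are indexed by polynomials: the digits of the index are the coefficients. In these terms
  \<open>mu a\<close> is the Dick weight, shifted by \<open>a\<close> per nonzero digit.\<close>

definition nzc :: "'a::zero poly \<Rightarrow> nat" where
  "nzc k = card {i. coeff k i \<noteq> 0}"

definition mu :: "real \<Rightarrow> 'a::zero poly \<Rightarrow> real" where
  "mu a k = (\<Sum>i | coeff k i \<noteq> 0. real i + 1 + a)"

lemma finite_coeff_support [simp]: "finite {i. coeff k i \<noteq> 0}"
  by (rule finite_subset[of _ "{..degree k}"]) (auto intro: le_degree)

lemma coeff_support_pCons:
  "{i. coeff (pCons c k) i \<noteq> 0} = (if c = 0 then {} else {0}) \<union> Suc ` {i. coeff k i \<noteq> 0}"
proof (rule Set.set_eqI)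
  fix i show "i \<in> {i. coeff (pCons c k) i \<noteq> 0} \<longleftrightarrow> i \<in> (if c = 0 then {} else {0}) \<union> Suc ` {i. coeff k i \<noteq> 0}"
    by (cases i) auto
qed

lemma nzc_0 [simp]: "nzc 0 = 0" by (simp add: nzc_def)

lemma mu_0 [simp]: "mu a 0 = 0" by (simp add: mu_def)

lemma nzc_pCons: "nzc (pCons c k) = (if c = 0 then 0 else 1) + nzc k"
  unfolding nzc_def coeff_support_pCons
  by (subst card_Un_disjoint) (auto simp: card_image)

text \<open>Prepending a coefficient moves every digit up one place, which adds 1 per nonzero digit
  and so amounts to raising \<open>a\<close> by 1. This is why \<open>mu\<close> carries the shift
  as an argument and inductions must generalise over it.\<close>

lemma mu_pCons: "mu a (pCons c k) = (if c = 0 then 0 else 1 + a) + mu (a + 1) k"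
  unfolding mu_def coeff_support_pCons
  by (subst sum.union_disjoint) (auto simp: sum.reindex o_def card_image)

lemma mu_eq: "mu a k = mu 0 k + real (nzc k) * a"
  by (simp add: mu_def nzc_def sum.distrib)

lemma nzc_eq_0_iff [simp]: "nzc k = 0 \<longleftrightarrow> k = 0"
  by (auto simp: nzc_def poly_eq_iff)

lemma mu_nonneg: "0 \<le> a \<Longrightarrow> 0 \<le> mu a k"
  unfolding mu_def by (rule sum_nonneg) simp

lemma mu_ge_degree:
  assumes "k \<noteq> 0" "0 \<le> a"
  shows "real (degree k) + 1 \<le> mu a k"
proof -
  have "real (degree k) + 1 + a \<le> mu a k"
    unfolding mu_def using assms by (intro member_le_sum) auto
  with assms show ?thesis by simp
qed

lemma sum_UNIV_nonzero:
  fixes x y :: real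
  shows "(\<Sum>c\<in>UNIV. if (c::'a::{finite,zero}) = 0 then x else y) = x + (real CARD('a) - 1) * y"
proof -
  have "(\<Sum>c\<in>UNIV. if (c::'a) = 0 then x else y) = x + (\<Sum>c\<in>UNIV - {0::'a}. y)"
    by (subst sum.remove[of _ 0]) (auto intro!: sum.cong)
  thus ?thesis by (simp add: card_Diff_singleton of_nat_diff Suc_leI card_gt_0_iff)
qed

text \<open>The digits are independent, so the sum is the product over positions i of 1 + (b-1)
  exp(-t(i+1+a)). Bounding 1 + x by exp x leaves a geometric series in exp(-t), which is at most
  1/(exp t - 1) \<le> 1/t.\<close>

lemma sum_polys_exp_mu_le:
  fixes t a :: real
  assumes t: "0 < t"
  shows "(\<Sum>k\<in>(polys n :: 'a::{finite,zero} poly set). exp (- t * mu a k)) \<le> exp ((real CARD('a) - 1) / t * exp (- t * a))"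
proof -
  let ?b = "real CARD('a)"
  have b: "?b \<ge> 1" by (simp add: Suc_leI card_gt_0_iff)
  have 1: "(\<Sum>k\<in>(polys n :: 'a poly set). exp (- t * mu a k)) \<le>
             exp ((?b - 1) * exp (- t * a) * (\<Sum>i<n. exp (- t) ^ Suc i))" for n a
  proof (induction n arbitrary: a)
    case (Suc n)
    have "(\<Sum>k\<in>(polys (Suc n) :: 'a poly set). exp (- t * mu a k)) =
      (\<Sum>c\<in>UNIV. (if c = (0::'a) then 1 else exp (- t * (1 + a))) * (\<Sum>k\<in>(polys n :: 'a poly set). exp (- t * mu (a + 1) k)))"
      by (simp add: sum_polys_Suc mu_pCons sum_distrib_left)
         (auto intro!: sum.cong simp: algebra_simps simp flip: exp_add)
    also have "\<dots> = (1 + (?b - 1) * exp (- t * (1 + a))) * (\<Sum>k\<in>(polys n :: 'a poly set). exp (- t * mu (a + 1) k))"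
      by (simp add: sum_UNIV_nonzero flip: sum_distrib_right)
    also have "\<dots> \<le> exp ((?b - 1) * exp (- t * (1 + a))) * exp ((?b - 1) * exp (- t * (a + 1)) * (\<Sum>i<n. exp (- t) ^ Suc i))"
      using b by (intro mult_mono Suc sum_nonneg exp_ge_add_one_self) auto
    also have "\<dots> = exp ((?b - 1) * exp (- t * a) * (\<Sum>i<Suc n. exp (- t) ^ Suc i))"
    proof -
      define r E S where "r = exp (- t)" and "E = exp (- t * a)" and "S = (\<Sum>i<n. r ^ Suc i)"
      have e: "exp (- t * (1 + a)) = E * r" "exp (- t * (a + 1)) = E * r"
        by (simp_all add: E_def r_def algebra_simps flip: exp_add)
      have S: "(\<Sum>i<Suc n. r ^ Suc i) = r + r * S"
        unfolding sum.lessThan_Suc_shift S_def by (simp add: sum_distrib_left)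
      show ?thesis
        unfolding e r_def[symmetric] E_def[symmetric] S S_def[symmetric]
        by (simp add: algebra_simps flip: exp_add)
    qed
    finally show ?case .
  qed (simp add: polys_0)
  have "(\<Sum>i<n. exp (- t) ^ Suc i) \<le> 1 / t"
  proof -
    have "(exp t - 1) * (\<Sum>i<n. exp (- t) ^ Suc i) = 1 - exp (- t) ^ n"
    proof (induction n)
      case (Suc n)
      have "exp t * exp (- t) ^ Suc n = exp (- t) ^ n"
        by (simp add: mult.assoc[symmetric] flip: exp_add)
      moreover have "(exp t - 1) * (\<Sum>i<Suc n. exp (- t) ^ Suc i) = (exp t - 1) * (\<Sum>i<n. exp (- t) ^ Suc i)
          + exp t * exp (- t) ^ Suc n - exp (- t) ^ Suc n"
        by (simp add: ring_distribs)
      ultimately show ?case using Suc by simp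
    qed simp
    also have "\<dots> \<le> 1" by simp
    finally have "(exp t - 1) * (\<Sum>i<n. exp (- t) ^ Suc i) \<le> 1" .
    moreover have "t \<le> exp t - 1" using exp_ge_add_one_self[of t] by linarith
    hence "t * (\<Sum>i<n. exp (- t) ^ Suc i) \<le> (exp t - 1) * (\<Sum>i<n. exp (- t) ^ Suc i)"
      by (intro mult_right_mono sum_nonneg) auto
    ultimately show ?thesis using t by (simp add: field_simps)
  qed
  hence "(?b - 1) * exp (- t * a) * (\<Sum>i<n. exp (- t) ^ Suc i) \<le> (?b - 1) * exp (- t * a) * (1 / t)"
    using b by (intro mult_left_mono) auto
  hence "exp ((?b - 1) * exp (- t * a) * (\<Sum>i<n. exp (- t) ^ Suc i)) \<le> exp ((?b - 1) / t * exp (- t * a))"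
    by (simp add: mult_ac)
  with 1[of a n] show ?thesis by linarith
qed

definition muv :: "nat \<Rightarrow> (nat \<Rightarrow> real) \<Rightarrow> (nat \<Rightarrow> 'a::zero poly) \<Rightarrow> real" where
  "muv s a k = (\<Sum>j=1..s. mu (a j) (k j))"

text \<open>Rankin's trick: \<open>t > 0\<close> is a free parameter, optimised later.\<close>

lemma card_muv_le:
  fixes t M :: real and a :: "nat \<Rightarrow> real"
  assumes t: "0 < t"
  shows "real (card {k \<in> PiE {1..s} (\<lambda>_. polys n :: 'a::{finite,zero} poly set). muv s a k \<le> M}) \<le>
           exp (t * M + (real CARD('a) - 1) / t * (\<Sum>j=1..s. exp (- t * a j)))"
proof -
  let ?P = "PiE {1..s} (\<lambda>_. polys n :: 'a poly set)"
  have fin: "finite ?P" by (intro finite_PiE) auto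
  have "real (card {k \<in> ?P. muv s a k \<le> M}) = (\<Sum>k\<in>{k \<in> ?P. muv s a k \<le> M}. 1)" by simp
  also have "\<dots> \<le> (\<Sum>k\<in>{k \<in> ?P. muv s a k \<le> M}. exp (t * M) * exp (- t * muv s a k))"
    using t by (intro sum_mono) (auto simp flip: exp_add)
  also have "\<dots> \<le> (\<Sum>k\<in>?P. exp (t * M) * exp (- t * muv s a k))"
    by (intro sum_mono2 fin) auto
  also have "\<dots> = exp (t * M) * (\<Sum>k\<in>?P. \<Prod>j=1..s. exp (- t * mu (a j) (k j)))"
    by (simp add: muv_def sum_distrib_left exp_sum flip: sum_negf)
  also have "\<dots> = exp (t * M) * (\<Prod>j=1..s. \<Sum>k\<in>(polys n :: 'a poly set). exp (- t * mu (a j) k))"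
    by (subst prod_sum_PiE) auto
  also have "\<dots> \<le> exp (t * M) * (\<Prod>j=1..s. exp ((real CARD('a) - 1) / t * exp (- t * a j)))"
    by (intro mult_left_mono prod_mono conjI sum_polys_exp_mu_le t sum_nonneg) auto
  also have "\<dots> = exp (t * M + (real CARD('a) - 1) / t * (\<Sum>j=1..s. exp (- t * a j)))"
    by (simp add: exp_add exp_sum sum_distrib_left)
  finally show ?thesis .
qed

section \<open>Additive characters of the prime field\<close>

definition chi :: "'b::prime_card mod_ring \<Rightarrow> complex" where
  "chi c = cis (2 * pi * real_of_int (to_int_mod_ring c) / real CARD('b))"

lemma cis_mod:
  assumes "0 < n"
  shows "cis (2 * pi * real_of_int (z mod int n) / real n) = cis (2 * pi * real_of_int z / real n)"
proof -
  have "real_of_int z = real n * real_of_int (z div int n) + real_of_int (z mod int n)"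
    by (metis div_mult_mod_eq mult.commute of_int_add of_int_mult of_int_of_nat_eq)
  hence "2 * pi * real_of_int z / real n = 2 * pi * real_of_int (z mod int n) / real n + 2 * pi * real_of_int (z div int n)"
    using assms by (simp add: field_simps)
  moreover have "cis (2 * pi * real_of_int (z div int n)) = 1"
    by (simp add: cis_multiple_2pi)
  ultimately show ?thesis by (simp add: cis_mult[symmetric])
qed

lemma to_int_mod_ring_of_int: "to_int_mod_ring (of_int z :: 'b::prime_card mod_ring) = z mod int CARD('b)"
  by (simp add: of_int_of_int_mod_ring of_int_mod_ring.rep_eq to_int_mod_ring.rep_eq)

lemma chi_of_int: "chi (of_int z :: 'b::prime_card mod_ring) = cis (2 * pi * real_of_int z / real CARD('b))"
  by (simp add: chi_def cis_mod to_int_mod_ring_of_int)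

lemma ex_of_int_mod_ring: "\<exists>z. (c :: 'b::prime_card mod_ring) = of_int z"
proof -
  obtain i where "c = of_nat i" using surj_of_nat_mod_ring by blast
  thus ?thesis by (intro exI[of _ "int i"]) simp
qed

lemma chi_0 [simp]: "chi 0 = 1"
  using chi_of_int[of 0] by simp

lemma chi_add: "chi (x + y) = chi x * chi (y :: 'b::prime_card mod_ring)"
proof -
  obtain z w where "x = of_int z" "y = of_int w" using ex_of_int_mod_ring by metis
  hence "x + y = of_int (z + w)" by simp
  thus ?thesis using \<open>x = _\<close> \<open>y = _\<close>
    by (simp only: chi_of_int) (simp add: cis_mult add_divide_distrib algebra_simps)
qed

lemma chi_sum: "chi (\<Sum>i\<in>A. f i) = (\<Prod>i\<in>A. chi (f i))"
  by (induction A rule: infinite_finite_induct) (auto simp: chi_add)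

lemma norm_chi [simp]: "norm (chi c) = 1"
  by (simp add: chi_def)

lemma norm_cis_minus_1: "norm (cis x - 1) = 2 * \<bar>sin (x / 2)\<bar>"
proof -
  have "norm (cis x - 1) ^ 2 = (cos x - 1)\<^sup>2 + (sin x)\<^sup>2"
    by (simp add: cmod_power2)
  also have "\<dots> = 2 - 2 * cos x"
    using sin_cos_squared_add[of x] by (simp add: power2_eq_square algebra_simps)
  also have "\<dots> = (2 * \<bar>sin (x / 2)\<bar>)\<^sup>2"
    using cos_double_sin[of "x / 2"] by (simp add: power_mult_distrib)
  finally show ?thesis by (subst (asm) power2_eq_iff_nonneg) auto
qed

lemma norm_chi_minus_1:
  fixes c :: "'b::prime_card mod_ring"
  assumes "c \<noteq> 0"
  obtains d where "1 \<le> d" "d < CARD('b)" "norm (chi c - 1) = 2 * sin (pi * real d / real CARD('b))"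
proof -
  obtain d where d: "d < CARD('b)" "c = of_nat d" using surj_of_nat_mod_ring by metis
  have "d \<noteq> 0" using d(2) assms by (metis of_nat_0)
  have "0 \<le> sin (pi * real d / real CARD('b))"
    using d by (intro sin_ge_zero) (auto simp: field_simps)
  moreover have "chi c = cis (2 * pi * real d / real CARD('b))"
    using chi_of_int[of "int d", where 'b='b] d by simp
  ultimately have "norm (chi c - 1) = 2 * sin (pi * real d / real CARD('b))"
    by (simp add: norm_cis_minus_1)
  with that d \<open>d \<noteq> 0\<close> show thesis by (metis Suc_leI neq0_conv One_nat_def)
qed

text \<open>\<open>m_b\<close> is the shortest chord from 1 to another b-th root of unity. The
  representatives d and b - d give equal chords, so only d \<le> b/2 matters, where the sine is
  increasing.\<close>

lemma m_b_le_norm_chi_minus_1: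
  fixes c :: "'b::prime_card mod_ring"
  assumes "c \<noteq> 0"
  shows "m_b CARD('b) \<le> norm (chi c - 1)"
proof -
  let ?b = "real CARD('b)"
  obtain d where d: "1 \<le> d" "d < CARD('b)" "norm (chi c - 1) = 2 * sin (pi * real d / ?b)"
    using norm_chi_minus_1[OF assms] .
  have b: "?b > 0" using d by simp
  have sin_mono: "sin (pi / ?b) \<le> sin (pi * real e / ?b)" if "1 \<le> e" "2 * e \<le> CARD('b)" for e
  proof (intro sin_monotone_2pi_le)
    show "- (pi / 2) \<le> pi / ?b" by (rule order.trans[of _ 0]) auto
    have "real (2 * e) \<le> ?b" using that by (subst of_nat_le_iff)
    thus "pi * real e / ?b \<le> pi / 2" using b by (simp add: field_simps)
  qed (use that b in \<open>auto simp: field_simps\<close>)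
  have "sin (pi / ?b) \<le> sin (pi * real d / ?b)"
  proof (cases "2 * d \<le> CARD('b)")
    case False
    have "sin (pi / ?b) \<le> sin (pi * real (CARD('b) - d) / ?b)"
      using False d by (intro sin_mono) auto
    also have "pi * real (CARD('b) - d) / ?b = pi - pi * real d / ?b"
      using d b by (simp add: of_nat_diff field_simps)
    finally show ?thesis by simp
  qed (use sin_mono d in auto)
  thus ?thesis using d by (simp add: m_b_def)
qed

text \<open>\<open>M_b\<close> is the longest such chord: a diameter for even b. For odd b no d
  attains the angle pi/2, and the nearest angles differ from it by pi/(2b), which gives 2
  cos(pi/(2b)).\<close>

lemma norm_chi_minus_1_le_M_b:
  fixes c :: "'b::prime_card mod_ring"
  shows "norm (chi c - 1) \<le> M_b CARD('b)"
proof (cases "even CARD('b)")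
  case True
  have "norm (chi c - 1) \<le> norm (chi c) + norm (1::complex)" by (rule norm_triangle_ineq4)
  thus ?thesis using True by (simp add: M_b_def)
next
  case False
  let ?b = "real CARD('b)"
  have b: "?b > 0" by simp
  have M: "M_b CARD('b) = 2 * cos (pi / (2 * ?b))"
  proof -
    have "(?b + 1) * pi / (2 * ?b) = pi / (2 * ?b) + pi / 2" using b by (simp add: field_simps)
    thus ?thesis using False by (simp add: M_b_def sin_add)
  qed
  show ?thesis
  proof (cases "c = 0")
    case True
    have "pi / (2 * ?b) \<le> pi / 2" using b by (intro divide_left_mono) auto
    moreover have "0 \<le> pi / (2 * ?b)" by simp
    ultimately have "0 \<le> cos (pi / (2 * ?b))"
      by (intro cos_ge_zero) linarith+
    thus ?thesis using True M by simp
  next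
    case nz: False
    obtain d where d: "1 \<le> d" "d < CARD('b)" "norm (chi c - 1) = 2 * sin (pi * real d / ?b)"
      using norm_chi_minus_1[OF nz] .
    have cos_mono: "sin (pi * real e / ?b) \<le> cos (pi / (2 * ?b))" if "2 * e < CARD('b)" for e
    proof -
      have "2 * e + 1 \<le> CARD('b)" using that by simp
      hence "2 * real e + 1 \<le> ?b" by linarith
      hence "pi * (2 * real e + 1) \<le> pi * ?b" by (intro mult_left_mono) auto
      hence le: "pi / (2 * ?b) \<le> pi / 2 - pi * real e / ?b"
        using b by (simp add: field_simps)
      have "sin (pi * real e / ?b) = cos (pi / 2 - pi * real e / ?b)"
        by (simp add: cos_diff)
      also have "\<dots> \<le> cos (pi / (2 * ?b))"
        using le b pi_gt_zero
        by (intro cos_monotone_0_pi_le le) (auto simp: field_simps add_increasing2)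
      finally show ?thesis .
    qed
    have "sin (pi * real d / ?b) \<le> cos (pi / (2 * ?b))"
    proof (cases "2 * d < CARD('b)")
      case False
      have "2 * d \<noteq> CARD('b)" using \<open>odd CARD('b)\<close> by (metis dvd_triv_left)
      have "sin (pi * real (CARD('b) - d) / ?b) \<le> cos (pi / (2 * ?b))"
        using False d \<open>2 * d \<noteq> CARD('b)\<close> by (intro cos_mono) auto
      also have "pi * real (CARD('b) - d) / ?b = pi - pi * real d / ?b"
        using d b by (simp add: of_nat_diff field_simps)
      finally show ?thesis by simp
    qed (use cos_mono in auto)
    thus ?thesis using d M by simp
  qed
qed

lemma m_b_pos: "b \<ge> 2 \<Longrightarrow> 0 < m_b b"
  unfolding m_b_def using sin_gt_zero[of "pi / real b"] by (simp add: field_simps)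

lemma chi_neq_1: "c \<noteq> 0 \<Longrightarrow> chi (c :: 'b::prime_card mod_ring) \<noteq> 1"
  using m_b_le_norm_chi_minus_1[of c] m_b_pos[of "CARD('b)"] prime_card[where 'a='b] prime_ge_2_nat
  by force

text \<open>An integration by parts will cost the factor \<open>M_b / m_b + 1\<close>; since b/(b -
  M_b) \<ge> 1, it may be replaced by \<open>C_b / m_b\<close>, the factor built into the exponents
  a_j.\<close>

lemma M_b_plus_m_b_le_C_b:
  assumes "b \<ge> 3" "0 \<le> M_b b"
  shows "M_b b + m_b b \<le> C_b b" "0 < C_b b"
proof -
  have m: "m_b b > 0" using assms by (intro m_b_pos) auto
  have "M_b b \<le> 2" by (auto simp: M_b_def)
  hence M: "M_b b < real b" using assms by linarith
  hence "m_b b * (real b - M_b b) \<le> m_b b * real b" using m assms by (intro mult_left_mono) auto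
  hence "m_b b \<le> real b * m_b b / (real b - M_b b)"
    using M by (simp add: pos_le_divide_eq mult.commute)
  thus "M_b b + m_b b \<le> C_b b" by (simp add: C_b_def)
  with m assms show "0 < C_b b" by linarith
qed

lemma sum_chi_mult:
  fixes e :: "'b::prime_card mod_ring"
  shows "(\<Sum>c\<in>UNIV. chi (c * e)) = (if e = 0 then of_nat CARD('b) else 0)"
proof (cases "e = 0")
  case False
  have "(\<Sum>c\<in>UNIV. chi (c * e)) = (\<Sum>c\<in>UNIV. chi ((c + 1) * e))"
    by (rule sum.reindex_bij_witness[of _ "\<lambda>c. c + 1" "\<lambda>c. c - 1"]) auto
  also have "\<dots> = chi e * (\<Sum>c\<in>UNIV. chi (c * e))"
    by (simp add: algebra_simps chi_add sum_distrib_left)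
  finally have "(chi e - 1) * (\<Sum>c\<in>UNIV. chi (c * e)) = 0" by (simp add: algebra_simps)
  thus ?thesis using False chi_neq_1 by auto
qed simp

text \<open>Orthogonality of characters, one digit at a time. It serves to detect agreement of the
  first n digits of two points.\<close>

lemma sum_polys_chi:
  fixes e :: "nat \<Rightarrow> 'b::prime_card mod_ring"
  shows "(\<Sum>k\<in>polys n. chi (\<Sum>i<n. coeff k i * e i)) = (if \<forall>i<n. e i = 0 then of_nat CARD('b) ^ n else 0)"
proof (induction n arbitrary: e)
  case (Suc n)
  have "(\<Sum>k\<in>polys (Suc n). chi (\<Sum>i<Suc n. coeff k i * e i)) =
        (\<Sum>c\<in>UNIV. chi (c * e 0)) * (\<Sum>k\<in>polys n. chi (\<Sum>i<n. coeff k i * e (Suc i)))"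
    unfolding sum_polys_Suc sum.lessThan_Suc_shift
    by (simp add: chi_add sum_distrib_left sum_distrib_right del: sum.lessThan_Suc) (rule sum.swap)
  thus ?case by (auto simp: Suc sum_chi_mult All_less_Suc2)
qed (simp add: polys_0)

section \<open>Dual vectors and irreducible polynomials\<close>

lemma of_nat_mod_ring_eq_iff:
  assumes "i < CARD('b)" "j < CARD('b)" "of_nat i = (of_nat j :: 'b::prime_card mod_ring)"
  shows "i = j"
proof -
  have "[i = j] (mod CARD('b))"
    using assms(3) by (simp add: of_nat_eq_iff_cong_CHAR)
  thus ?thesis using assms(1,2) by (simp add: cong_def)
qed

lemma eq_if_digits_eq:
  fixes b :: nat
  assumes "k < b ^ m" "l < b ^ m" "\<And>i. i < m \<Longrightarrow> k div b ^ i mod b = l div b ^ i mod b"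
  shows "k = l"
  using assms
proof (induction m arbitrary: k l)
  case (Suc m)
  have "k div b = l div b"
  proof (rule Suc.IH)
    fix i assume "i < m"
    thus "k div b div b ^ i mod b = l div b div b ^ i mod b"
      using Suc.prems(3)[of "Suc i"] by (simp add: div_mult2_eq)
  qed (use Suc.prems in \<open>simp_all add: less_mult_imp_div_less mult.commute\<close>)
  moreover have "k mod b = l mod b" using Suc.prems(3)[of 0] by simp
  ultimately show ?case by (metis div_mult_mod_eq)
qed auto

lemma coeff_k_poly:
  "coeff (k_poly m k :: 'b::prime_card mod_ring poly) i = (if i < m then of_nat (k div CARD('b) ^ i mod CARD('b)) else 0)"
  by (simp add: k_poly_def coeff_sum)

lemma bij_betw_k_poly: "bij_betw (k_poly m) {..<CARD('b) ^ m} (polys m :: 'b::prime_card mod_ring poly set)"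
proof -
  let ?f = "k_poly m :: nat \<Rightarrow> 'b mod_ring poly"
  have inj: "inj_on ?f {..<CARD('b) ^ m}"
  proof (rule inj_onI)
    fix k l assume kl: "k \<in> {..<CARD('b) ^ m}" "l \<in> {..<CARD('b) ^ m}" "?f k = ?f l"
    show "k = l"
    proof (rule eq_if_digits_eq)
      fix i assume "i < m"
      hence "of_nat (k div CARD('b) ^ i mod CARD('b)) = (of_nat (l div CARD('b) ^ i mod CARD('b)) :: 'b mod_ring)"
        using arg_cong[OF kl(3), of "\<lambda>p. coeff p i"] by (simp add: coeff_k_poly)
      thus "k div CARD('b) ^ i mod CARD('b) = l div CARD('b) ^ i mod CARD('b)"
        by (rule of_nat_mod_ring_eq_iff[rotated 2]) auto
    qed (use kl in auto)
  qed
  have "?f ` {..<CARD('b) ^ m} = polys m"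
  proof (rule card_subset_eq)
    show "?f ` {..<CARD('b) ^ m} \<subseteq> polys m" by (auto simp: polys_def coeff_k_poly)
  qed (simp_all add: card_image[OF inj] card_polys)
  with inj show ?thesis by (simp add: bij_betw_def)
qed

lemma poly_div_sum_left: "(\<Sum>i\<in>A. f i) div p = (\<Sum>i\<in>A. f i div (p :: 'a::field poly))"
  by (induction A rule: infinite_finite_induct) (auto simp: poly_div_add_left)

text \<open>Pairing the digits of k with the expansion of h/p gives the residue of k h / p, that is,
  its coefficient at x^(-1). Division by a fixed p is additive, so k can be expanded into
  monomials.\<close>

lemma sum_coeff_laurent_coeff:
  fixes k h p :: "'a::field poly"
  assumes "k \<in> polys n"
  shows "(\<Sum>i<n. coeff k i * laurent_coeff h p (Suc i)) = coeff ((monom 1 1 * (k * h)) div p) 0"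
proof -
  have k: "k = (\<Sum>i<n. monom (coeff k i) i)"
    using assms by (auto simp: poly_eq_iff coeff_sum polys_def not_less)
  have "monom 1 1 * (k * h) = (\<Sum>i<n. smult (coeff k i) (monom 1 (Suc i) * h))"
    by (subst k) (simp add: sum_distrib_right sum_distrib_left smult_monom mult_monom flip: mult.assoc mult_smult_left)
  hence "coeff ((monom 1 1 * (k * h)) div p) 0 = (\<Sum>i<n. coeff k i * coeff ((monom 1 (Suc i) * h) div p) 0)"
    by (simp add: poly_div_sum_left coeff_sum div_smult_left)
  thus ?thesis by (simp add: laurent_coeff_def)
qed

lemma irreducible_imp_prime_elem_mod_ring:
  "irreducible (p :: 'b::prime_card mod_ring poly) \<Longrightarrow> prime_elem p"
  by (rule irreducible_imp_prime_elem_gcd)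

text \<open>The residue of h G / p is additive in h. When p does not divide G it takes the value 1
  for some h, and translating the summation by this h multiplies the sum by \<open>chi 1\<close>,
  which is not 1.\<close>

lemma sum_chi_residue_eq_0:
  fixes p G :: "'b::prime_card mod_ring poly"
  assumes p: "p \<in> monic_irred_polys m" and m: "1 \<le> m" and nd: "\<not> p dvd G"
  shows "(\<Sum>h\<in>polys m. chi (coeff ((monom 1 1 * (h * G)) div p) 0)) = 0"
proof -
  have p': "lead_coeff p = 1" "irreducible p" "degree p = m" using p by (auto simp: monic_irred_polys_def)
  have "p \<noteq> 0" using p' by auto
  define L where "L = (\<lambda>h. coeff ((monom 1 1 * (h * G)) div p) 0)"
  have L_add: "L (h + h') = L h + L h'" for h h'
    by (simp add: L_def algebra_simps poly_div_add_left)
  have "coprime p G" using p'(2) nd by (simp add: irreducible_imp_prime_elem_mod_ring prime_elem_imp_coprime)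
  obtain x y where xy: "x * G + y * p = 1"
    using \<open>coprime p G\<close> that[of "snd (bezout_coefficients p G)" "fst (bezout_coefficients p G)"]
      bezout_coefficients_fst_snd[of p G] by (simp add: coprime_imp_gcd_eq_1 add.commute)
  \<comment> \<open>Chosen so that h G is congruent to x^(m-1) modulo p (here x is the variable): as
    p is monic of degree m, x^m div p = 1, which is the residue wanted.\<close>
  define h where "h = (x * monom 1 (m - 1)) mod p"
  have h: "h \<in> polys m" using p' m degree_mod_less'[of p "x * monom 1 (m - 1)"] \<open>p \<noteq> 0\<close>
    by (auto simp: in_polys_iff h_def)
  have "\<exists>c. h * G = monom 1 (m - 1) + p * c"
  proof -
    define q where "q = (x * monom 1 (m - 1)) div p"
    have "h = x * monom 1 (m - 1) - q * p" by (simp add: h_def q_def minus_div_mult_eq_mod)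
    hence "h * G = (x * G) * monom 1 (m - 1) - q * p * G" by (simp only:) (simp add: algebra_simps)
    also have "x * G = 1 - y * p" using xy by (simp add: algebra_simps)
    finally have "h * G = monom 1 (m - 1) + p * (- y * monom 1 (m - 1) - q * G)"
      by (simp add: algebra_simps)
    thus ?thesis by blast
  qed
  then obtain c where c: "h * G = monom 1 (m - 1) + p * c" by blast
  have "monom 1 1 * (h * G) = monom 1 m + p * (monom 1 1 * c)"
  proof -
    have "monom 1 1 * (h * G) = monom 1 1 * monom 1 (m - 1) + p * (monom 1 1 * c)"
      unfolding c by (simp only: ring_distribs mult_ac)
    thus ?thesis using m by (simp add: mult_monom)
  qed
  hence "(monom 1 1 * (h * G)) div p = monom 1 m div p + monom 1 1 * c"
    using \<open>p \<noteq> 0\<close> by (simp add: poly_div_add_left)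
  moreover have "monom 1 m div p = 1"
  proof -
    have "monom 1 m = p * 1 + (monom 1 m - p)" by simp
    moreover have "(monom 1 m - p) div p = 0"
    proof (rule div_poly_less)
      have "coeff (monom 1 m - p) i = 0" if "i \<ge> m" for i
        using that p' by (cases "i = m") (auto simp: coeff_eq_0)
      hence "monom 1 m - p \<in> polys m" by (simp add: polys_def)
      thus "degree (monom 1 m - p) < degree p" using p' m by (auto simp: in_polys_iff)
    qed
    ultimately show ?thesis using \<open>p \<noteq> 0\<close> poly_div_add_left[of "p * 1" "monom 1 m - p" p] by simp
  qed
  ultimately have L1: "L h = 1" by (simp add: L_def coeff_mult)
  have "(\<Sum>h'\<in>polys m. chi (L h')) = (\<Sum>h'\<in>polys m. chi (L (h' + h)))"
    by (rule sum.reindex_bij_witness[of _ "\<lambda>h'. h' + h" "\<lambda>h'. h' - h"]) (use h in \<open>auto simp: polys_def\<close>)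
  also have "\<dots> = chi (1 :: 'b mod_ring) * (\<Sum>h'\<in>polys m. chi (L h'))"
    by (simp add: L_add L1 chi_add sum_distrib_left mult.commute)
  finally have "(chi (1 :: 'b mod_ring) - 1) * (\<Sum>h'\<in>polys m. chi (L h')) = 0" by (simp add: algebra_simps)
  thus ?thesis using chi_neq_1[of "1 :: 'b mod_ring"] by (auto simp: L_def)
qed

section \<open>Counting monic irreducible polynomials\<close>

lemma monic_irred_dvd_imp_eq:
  fixes p q :: "'a::field poly"
  assumes "lead_coeff p = 1" "irreducible p" "lead_coeff q = 1" "irreducible q" "p dvd q"
  shows "p = q"
proof -
  from assms(5) obtain c where c: "q = p * c" by (elim dvdE)
  have "\<not> p dvd 1" using assms(2) by (rule irreducible_not_unit)
  with irreducibleD[OF assms(4) c] have "c dvd 1" by blast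
  then obtain u where u: "c = [:u:]" by (metis is_unit_polyE)
  hence "lead_coeff q = lead_coeff p * u" by (simp add: c lead_coeff_mult)
  with assms u c show ?thesis by simp
qed

text \<open>Distinct monic irreducibles do not divide one another, so each new prime factor of F
  must divide the cofactor of the product collected so far.\<close>

lemma prod_monic_irred_dvd:
  fixes F :: "'b::prime_card mod_ring poly"
  assumes "finite S" "\<And>p. p \<in> S \<Longrightarrow> lead_coeff p = 1 \<and> irreducible p \<and> p dvd F"
  shows "\<Prod>S dvd F"
  using assms
proof (induction S rule: finite_induct)
  case (insert p S)
  then obtain c where c: "F = \<Prod>S * c" by (auto elim: dvdE)
  have p: "lead_coeff p = 1" "irreducible p" "p dvd F" using insert.prems by auto
  have pe: "prime_elem p" using p irreducible_imp_prime_elem_mod_ring by blast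
  have "\<not> p dvd \<Prod>S"
  proof
    assume "p dvd \<Prod>S"
    then obtain q where "q \<in> S" "p dvd q"
      using irreducible_dvd_prod[OF p(2)] by blast
    with monic_irred_dvd_imp_eq[of p q] p insert.prems have "p = q" by auto
    with \<open>q \<in> S\<close> insert.hyps show False by simp
  qed
  with pe p c have "p dvd c" by (simp add: prime_elem_dvd_mult_iff)
  then obtain e where "c = p * e" by (elim dvdE)
  with c insert.hyps show ?case by (simp add: mult_ac)
qed simp

lemma sum_degree_le_of_monic_irred_dvd:
  fixes F :: "'b::prime_card mod_ring poly"
  assumes "finite S" "\<And>p. p \<in> S \<Longrightarrow> lead_coeff p = 1 \<and> irreducible p \<and> p dvd F" "F \<noteq> 0"
  shows "(\<Sum>p\<in>S. degree p) \<le> degree F"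
proof -
  have "degree (\<Prod>S) \<le> degree F"
    using prod_monic_irred_dvd[OF assms(1,2)] assms(3) by (intro dvd_imp_degree_le) auto
  moreover have "degree (\<Prod>S) = (\<Sum>p\<in>S. degree p)"
    using assms(2) by (subst degree_prod_eq_sum_degree) force+
  ultimately show ?thesis by simp
qed

lemma finite_monic_irred_polys [simp]: "finite (monic_irred_polys d :: 'b::prime_card mod_ring poly set)"
  by (rule finite_subset[of _ "polys (Suc d)"]) (auto simp: monic_irred_polys_def in_polys_iff)

text \<open>The polynomial x^(b^n) - x, whose monic irreducible divisors are those of degree
  dividing n, each occurring once.\<close>

definition Frob :: "nat \<Rightarrow> 'b::prime_card mod_ring poly" where
  "Frob n = monom 1 1 ^ (CARD('b) ^ n) - monom 1 1"

lemma degree_Frob: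
  assumes "1 \<le> n"
  shows "degree (Frob n :: 'b::prime_card mod_ring poly) = CARD('b) ^ n"
proof -
  have "1 < CARD('b) ^ n"
    using assms prime_gt_1_nat[OF prime_card[where 'a='b]] by (intro one_less_power) auto
  hence "degree (monom 1 (CARD('b) ^ n) + (- monom 1 1 :: 'b mod_ring poly)) = degree (monom (1 :: 'b mod_ring) (CARD('b) ^ n))"
    by (intro degree_add_eq_left) (simp add: degree_monom_eq)
  thus ?thesis by (simp add: Frob_def monom_power degree_monom_eq)
qed

text \<open>All irreducibles of degree d divide \<open>Frob d\<close>, so their degrees add up to at
  most b^d.\<close>

lemma card_monic_irred_polys_upper:
  assumes "1 \<le> d"
  shows "d * card (monic_irred_polys d :: 'b::prime_card mod_ring poly set) \<le> CARD('b) ^ d"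
proof -
  have "Frob d \<noteq> (0 :: 'b mod_ring poly)" using degree_Frob[OF assms, where 'b='b] by force
  have "(\<Sum>p\<in>(monic_irred_polys d :: 'b mod_ring poly set). degree p) \<le> degree (Frob d :: 'b mod_ring poly)"
  proof (rule sum_degree_le_of_monic_irred_dvd)
    fix p :: "'b mod_ring poly" assume "p \<in> monic_irred_polys d"
    thus "lead_coeff p = 1 \<and> irreducible p \<and> p dvd Frob d"
      using degree_divisor1[of p d] by (auto simp: monic_irred_polys_def Frob_def)
  qed (use \<open>Frob d \<noteq> 0\<close> in auto)
  moreover have "(\<Sum>p\<in>(monic_irred_polys d :: 'b mod_ring poly set). degree p) = (\<Sum>p\<in>(monic_irred_polys d :: 'b mod_ring poly set). d)"
    by (rule sum.cong) (auto simp: monic_irred_polys_def)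
  ultimately show ?thesis using degree_Frob[OF assms, where 'b='b] by (simp add: mult.commute)
qed

lemma pderiv_Frob:
  assumes "1 \<le> n"
  shows "pderiv (Frob n :: 'b::prime_card mod_ring poly) = -1"
proof -
  have "of_nat (CARD('b) ^ n) = (0 :: 'b mod_ring)" using assms by simp
  moreover have "Frob n = monom 1 (CARD('b) ^ n) - (monom 1 1 :: 'b mod_ring poly)"
    by (simp add: Frob_def monom_power)
  ultimately show ?thesis
    by (simp only: pderiv_diff pderiv_monom) simp
qed

text \<open>\<open>Frob m\<close> is squarefree, so its degree b^m is the sum of the degrees of its
  monic irreducible divisors, all of degree at most m. The degrees d < m account for at most b^d
  each, altogether at most b^m / 2 because b \<ge> 3.\<close>

lemma card_monic_irred_polys_lower:
  assumes "1 \<le> m" and b3: "3 \<le> CARD('b)"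
  shows "CARD('b) ^ m \<le> 2 * (m * card (monic_irred_polys m :: 'b::prime_card mod_ring poly set))"
proof -
  let ?F = "Frob m :: 'b mod_ring poly"
  let ?P = "monic_irred_polys :: nat \<Rightarrow> 'b mod_ring poly set"
  have F0: "?F \<noteq> 0" using degree_Frob[OF assms(1), where 'b='b] by force
  define S where "S = {p. lead_coeff p = 1 \<and> irreducible p \<and> p dvd ?F}"
  have deg: "degree p \<in> {1..m}" if "p \<in> S" for p
  proof -
    have "irreducible p" "p dvd ?F" using that by (auto simp: S_def)
    hence "degree p \<noteq> 0" using irreducible_degree_field[of p] by blast
    moreover have "\<not> m < degree p"
      using degree_divisor2[of p "degree p" m] \<open>irreducible p\<close> \<open>p dvd ?F\<close> assms(1) by (auto simp: Frob_def)
    ultimately show ?thesis by simp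
  qed
  have S_sub: "S \<subseteq> (\<Union>d\<in>{1..m}. ?P d)" using deg by (force simp: S_def monic_irred_polys_def)
  hence finS: "finite S" by (rule finite_subset) auto
  have "\<Prod>S dvd ?F" by (rule prod_monic_irred_dvd[OF finS]) (auto simp: S_def)
  then obtain c where c: "?F = \<Prod>S * c" by (elim dvdE)
  have "c \<noteq> 0" using c F0 by auto
  \<comment> \<open>A prime factor of the cofactor would, made monic, belong to \<open>S\<close> and
    so divide \<open>\<Prod>S\<close> as well; its square would divide \<open>Frob m\<close>, and it
    would divide the derivative -1.\<close>
  have "degree c = 0"
  proof (rule ccontr)
    assume "degree c \<noteq> 0"
    hence "\<not> c dvd 1" by (simp add: poly_dvd_1)
    with \<open>c \<noteq> 0\<close> obtain q where q: "prime q" "q dvd c" by (rule prime_divisorE)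
    have "irreducible q" using q(1) by (intro prime_elem_imp_irreducible prime_imp_prime_elem)
    define q' where "q' = smult (inverse (lead_coeff q)) q"
    have lq: "lead_coeff q \<noteq> 0" using q by auto
    hence q': "lead_coeff q' = 1" "irreducible q'" "q' dvd c"
      using q(2) \<open>irreducible q\<close> by (simp_all add: q'_def smult_dvd_iff)
    moreover have "q' dvd ?F" unfolding c using q'(3) by (rule dvd_mult)
    ultimately have "q' \<in> S" by (simp add: S_def)
    hence "q' dvd \<Prod>S" using finS by (intro dvd_prodI) auto
    with q'(3) c have "q' * q' dvd ?F" by (simp add: mult_dvd_mono)
    then obtain e where "?F = q' * q' * e" by (elim dvdE)
    hence "q' dvd pderiv ?F" by (simp add: pderiv_mult algebra_simps)
    hence "q' dvd 1" by (simp add: pderiv_Frob[OF assms(1)])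
    with irreducible_not_unit[OF q'(2)] show False by contradiction
  qed
  hence "degree ?F = degree (\<Prod>S)"
    using c F0 by (simp add: degree_mult_eq)
  also have "\<dots> = (\<Sum>p\<in>S. degree p)"
    by (subst degree_prod_eq_sum_degree) (force simp: S_def)+
  also have "\<dots> \<le> (\<Sum>p\<in>(\<Union>d\<in>{1..m}. ?P d). degree p)"
    using S_sub by (intro sum_mono2) auto
  also have "\<dots> = (\<Sum>d\<in>{1..m}. \<Sum>p\<in>?P d. degree p)"
  proof (rule sum.UNION_disjoint)
    show "\<forall>i\<in>{1..m}. \<forall>j\<in>{1..m}. i \<noteq> j \<longrightarrow> ?P i \<inter> ?P j = {}" by (auto simp: monic_irred_polys_def)
  qed auto
  also have "\<dots> = (\<Sum>d\<in>{1..m}. d * card (?P d))"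
    by (intro sum.cong refl) (simp add: monic_irred_polys_def)
  also have "{1..m} = insert m {1..<m}" using assms(1) by auto
  also have "(\<Sum>d\<in>insert m {1..<m}. d * card (?P d)) = m * card (?P m) + (\<Sum>d\<in>{1..<m}. d * card (?P d))"
    by simp
  also have "(\<Sum>d\<in>{1..<m}. d * card (?P d)) \<le> (\<Sum>d\<in>{1..<m}. CARD('b) ^ d)"
    by (intro sum_mono card_monic_irred_polys_upper) auto
  finally have 1: "CARD('b) ^ m \<le> m * card (?P m) + (\<Sum>d\<in>{1..<m}. CARD('b) ^ d)"
    by (simp add: degree_Frob[OF assms(1)])
  have "2 * (\<Sum>d\<in>{1..<m}. CARD('b) ^ d) \<le> CARD('b) ^ m"
    using assms(1)
  proof (induction m rule: dec_induct)
    case (step n)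
    have "3 * CARD('b) ^ n \<le> CARD('b) * CARD('b) ^ n" using b3 by (intro mult_right_mono) auto
    moreover have "(\<Sum>d\<in>{1..<Suc n}. CARD('b) ^ d) = (\<Sum>d\<in>{1..<n}. CARD('b) ^ d) + CARD('b) ^ n"
      using step.hyps by simp
    ultimately show ?case using step.IH unfolding power_Suc by linarith
  qed simp
  with 1 show ?thesis by simp
qed

section \<open>Counting the lattices that have a given dual vector\<close>

lemma G_polys_eq: "1 \<le> m \<Longrightarrow> G_polys m = polys m - {0}"
  by (auto simp: G_polys_def in_polys_iff)

lemma finite_G_polys [simp]: "finite (G_polys m :: 'b::prime_card mod_ring poly set)"
  by (rule finite_subset[of _ "polys m"]) (auto simp: G_polys_def in_polys_iff)

lemma card_G_polys: "1 \<le> m \<Longrightarrow> card (G_polys m :: 'b::prime_card mod_ring poly set) = CARD('b) ^ m - 1"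
  by (simp add: G_polys_eq card_Diff_singleton card_polys)

text \<open>Dropping the component g_j is injective on the solutions: if two of them agree
  elsewhere, p divides k_j (g_j - h_j), hence g_j - h_j, whose degree is below m = deg p.\<close>

lemma card_dual_generators:
  fixes p :: "'b::prime_card mod_ring poly"
  assumes p: "p \<in> monic_irred_polys m" and j: "j \<in> {1..s}" "\<not> p dvd k j" and m: "1 \<le> m"
  shows "card {g \<in> PiE {1..s} (\<lambda>_. G_polys m). p dvd (\<Sum>j=1..s. k j * g j)} \<le> (CARD('b) ^ m - 1) ^ (s - 1)"
proof -
  let ?A = "{g \<in> PiE {1..s} (\<lambda>_. G_polys m). p dvd (\<Sum>j=1..s. k j * g j)}"
  let ?B = "PiE ({1..s} - {j}) (\<lambda>_. G_polys m :: 'b mod_ring poly set)"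
  have pe: "prime_elem p" using p irreducible_imp_prime_elem_mod_ring by (auto simp: monic_irred_polys_def)
  have "inj_on (\<lambda>g. restrict g ({1..s} - {j})) ?A"
  proof (rule inj_onI)
    fix g h assume gh: "g \<in> ?A" "h \<in> ?A" "restrict g ({1..s} - {j}) = restrict h ({1..s} - {j})"
    have eq: "g i = h i" if "i \<noteq> j" for i
    proof (cases "i \<in> {1..s}")
      case True
      thus ?thesis using fun_cong[OF gh(3), of i] that by simp
    next
      case False
      thus ?thesis using gh(1,2) by (auto simp: PiE_def extensional_def)
    qed
    have "(\<Sum>j=1..s. k j * g j) - (\<Sum>j=1..s. k j * h j) = (\<Sum>i=1..s. k i * (g i - h i))"
      by (simp add: sum_subtractf algebra_simps)
    also have "\<dots> = k j * (g j - h j)"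
      using j eq by (subst sum.remove[of _ j]) auto
    finally have "k j * (g j - h j) = (\<Sum>j=1..s. k j * g j) - (\<Sum>j=1..s. k j * h j)" by (rule sym)
    hence "p dvd k j * (g j - h j)" using gh(1,2) by (simp only: mem_Collect_eq dvd_diff)
    with pe j have "p dvd g j - h j" by (simp add: prime_elem_dvd_mult_iff)
    moreover have "g j - h j \<in> polys m"
      using gh(1,2) j m by (auto simp: G_polys_eq polys_def dest!: PiE_mem[of _ _ _ j])
    moreover have "degree p = m" using p by (simp add: monic_irred_polys_def)
    ultimately have "g j - h j = 0" using divides_degree[of p "g j - h j"] by (auto simp: in_polys_iff)
    hence "g i = h i" for i using eq by (cases "i = j") auto
    thus "g = h" by (rule ext)
  qed
  moreover have "(\<lambda>g. restrict g ({1..s} - {j})) ` ?A \<subseteq> ?B"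
    unfolding image_subset_iff restrict_PiE_iff by (auto dest: PiE_mem)
  moreover have "finite ?B" by (intro finite_PiE) auto
  ultimately have "card ?A \<le> card ?B" by (rule card_inj_on_le)
  also have "\<dots> = (CARD('b) ^ m - 1) ^ (s - 1)"
    using j m by (simp add: card_PiE card_G_polys)
  finally show ?thesis .
qed

lemma card_dual_le:
  fixes k :: "nat \<Rightarrow> 'b::prime_card mod_ring poly"
  assumes b3: "3 \<le> CARD('b)" and m: "1 \<le> m" and j0: "j0 \<in> {1..s}" "k j0 \<noteq> 0"
  defines "PG \<equiv> monic_irred_polys m \<times> PiE {1..s} (\<lambda>_. G_polys m :: 'b mod_ring poly set)"
  shows "real (card {(p, g) \<in> PG. p dvd (\<Sum>j=1..s. k j * g j)}) \<le>
           3 * real (Suc (degree (k j0))) / (real CARD('b) ^ m - 1) * real (card PG)"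
proof -
  let ?P = "monic_irred_polys m :: 'b mod_ring poly set"
  let ?Gs = "PiE {1..s} (\<lambda>_. G_polys m :: 'b mod_ring poly set)"
  let ?N = "CARD('b) ^ m"
  define bad where "bad = {p \<in> ?P. p dvd k j0}"
  have fin: "finite bad" "bad \<subseteq> ?P" by (auto simp: bad_def)
  have finG: "finite ?Gs" by (intro finite_PiE) auto
  have cardG: "card ?Gs = (?N - 1) ^ s" using m by (simp add: card_PiE card_G_polys)
  have N: "?N > 1" using m b3 by (intro one_less_power) auto
  have s1: "(?N - 1) ^ s = (?N - 1) * (?N - 1) ^ (s - 1)" using j0 by (cases s) auto
  have "m * card bad = (\<Sum>p\<in>bad. degree p)" by (simp add: bad_def monic_irred_polys_def)
  also have "\<dots> \<le> degree (k j0)"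
    by (rule sum_degree_le_of_monic_irred_dvd) (use j0 fin in \<open>auto simp: bad_def monic_irred_polys_def\<close>)
  finally have mbad: "m * card bad \<le> degree (k j0)" .
  have "card {(p, g) \<in> PG. p dvd (\<Sum>j=1..s. k j * g j)} = card (SIGMA p:?P. {g \<in> ?Gs. p dvd (\<Sum>j=1..s. k j * g j)})"
    by (rule arg_cong[of _ _ card]) (auto simp: PG_def)
  also have "\<dots> = (\<Sum>p\<in>?P. card {g \<in> ?Gs. p dvd (\<Sum>j=1..s. k j * g j)})"
    using finG by (intro card_SigmaI) auto
  also have "\<dots> \<le> (\<Sum>p\<in>?P. (?N - 1) ^ (s - 1) + (if p \<in> bad then (?N - 1) ^ s else 0))"
  proof (rule sum_mono)
    fix p assume p: "p \<in> ?P"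
    show "card {g \<in> ?Gs. p dvd (\<Sum>j=1..s. k j * g j)} \<le> (?N - 1) ^ (s - 1) + (if p \<in> bad then (?N - 1) ^ s else 0)"
    proof (cases "p \<in> bad")
      case True
      have "card {g \<in> ?Gs. p dvd (\<Sum>j=1..s. k j * g j)} \<le> card ?Gs" by (rule card_mono[OF finG]) auto
      with True cardG show ?thesis by simp
    next
      case False
      thus ?thesis using card_dual_generators[OF p j0(1) _ m, of k] p by (simp add: bad_def)
    qed
  qed
  also have "\<dots> = card ?P * (?N - 1) ^ (s - 1) + card bad * (?N - 1) ^ s"
    using fin by (simp add: sum.distrib sum.If_cases Int_absorb1)
  finally have "card {(p, g) \<in> PG. p dvd (\<Sum>j=1..s. k j * g j)} * (?N - 1) \<le>
      (card ?P * (?N - 1) ^ (s - 1) + card bad * (?N - 1) ^ s) * (?N - 1)"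
    by (rule mult_right_mono) simp
  also have "\<dots> = card ?P * (?N - 1) ^ s + card bad * (?N - 1) * (?N - 1) ^ s"
    unfolding s1 by (simp only: ring_distribs mult_ac)
  \<comment> \<open>The factor m of the lower bound on \<open>card ?P\<close> is what turns
    \<open>card bad\<close> into m * \<open>card bad\<close>, which is at most the degree of k_j0;
    no power of m survives.\<close>
  also have "card bad * (?N - 1) \<le> card bad * (2 * (m * card ?P))"
    using card_monic_irred_polys_lower[OF m b3] by (intro mult_left_mono) auto
  also have "card bad * (2 * (m * card ?P)) = 2 * (m * card bad) * card ?P" by simp
  also have "\<dots> \<le> 2 * degree (k j0) * card ?P" using mbad by (intro mult_right_mono) auto
  finally have "card {(p, g) \<in> PG. p dvd (\<Sum>j=1..s. k j * g j)} * (?N - 1) \<le>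
      (1 + 2 * degree (k j0)) * (card ?P * (?N - 1) ^ s)"
    by (simp add: algebra_simps)
  also have "card ?P * (?N - 1) ^ s = card PG" unfolding PG_def card_cartesian_product cardG ..
  \<comment> \<open>Source of the constant 3: 1 for the p not dividing k_j0 and 2 deg for the
    others. Using deg + 1 prepares the comparison with the weight, which is at least deg +
    1.\<close>
  also have "(1 + 2 * degree (k j0)) * card PG \<le> 3 * Suc (degree (k j0)) * card PG"
    by (intro mult_right_mono) auto
  finally have "real (card {(p, g) \<in> PG. p dvd (\<Sum>j=1..s. k j * g j)} * (?N - 1)) \<le> real (3 * Suc (degree (k j0)) * card PG)"
    by (rule of_nat_mono)
  moreover have "real (?N - 1) = real CARD('b) ^ m - 1" using N by (simp add: of_nat_diff)
  moreover have "real CARD('b) ^ m - 1 > 0" using N by (metis calculation(2) of_nat_0_less_iff zero_less_diff)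
  ultimately show ?thesis by (simp add: field_simps)
qed

section \<open>Integration over the unit interval\<close>

abbreviation lborel01 :: "real measure" where
  "lborel01 \<equiv> restrict_space lborel {0..1}"

lemma space_lborel01 [simp]: "space lborel01 = {0..1}"
  by (simp add: space_restrict_space)

lemma prob_space_lborel01: "prob_space lborel01"
  by (rule prob_spaceI) (simp add: emeasure_restrict_space)

interpretation lborel01: prob_space lborel01
  by (rule prob_space_lborel01)

lemma measurable_lborel01 [measurable (raw)]:
  "f \<in> borel_measurable borel \<Longrightarrow> f \<in> borel_measurable lborel01"
  by (intro measurable_restrict_space1) simp

lemma continuous_on_measurable_lborel01:
  fixes f :: "real \<Rightarrow> real"
  assumes "continuous_on {0..1} f"
  shows "f \<in> borel_measurable lborel01"
  using assms borel_measurable_continuous_on_restrict[of "{0..1}" f]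
  by (simp cong: measurable_cong_sets sets_restrict_space_cong)

lemma AE_lborel01_neq_1: "AE x in lborel01. x \<noteq> 1"
  by (subst AE_restrict_space_iff) (auto intro: AE_mp[OF AE_lborel_singleton[of 1]])

text \<open>Self-similarity of [0,1] under its b affine pieces. The integrand is extended by zero to
  the whole line, where the affine substitution rule applies; \<open>Hd d\<close> is its part on the
  d-th piece.\<close>

lemma integral_lborel01_scale:
  fixes G :: "real \<Rightarrow> complex" and b :: nat
  assumes b: "0 < b" and G: "G \<in> borel_measurable lborel01" and B: "\<And>x. x \<in> {0..1} \<Longrightarrow> norm (G x) \<le> B"
  shows "(\<integral>x. G x \<partial>lborel01) = (1 / of_nat b) * (\<Sum>d<b. \<integral>y. G ((real d + y) / real b) \<partial>lborel01)"
proof -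
  define H where "H = (\<lambda>x. indicator {0..1} x *\<^sub>R G x)"
  have H_meas [measurable]: "H \<in> borel_measurable borel"
    using G unfolding H_def by (subst (asm) borel_measurable_restrict_space_iff) auto
  have B0: "0 \<le> B" using B[of 0] norm_ge_zero[of "G 0"] by (meson atLeastAtMost_iff order.trans order_refl zero_le_one)
  have H_bd: "norm (H x) \<le> B" for x
    using B B0 by (auto simp: H_def indicator_def)
  define Hd where "Hd = (\<lambda>d::nat. \<lambda>x. indicator {0..1} (real b * x - real d) *\<^sub>R H x)"
  have Hd_int: "integrable lborel (Hd d)" for d
  proof (rule Bochner_Integration.integrable_bound)
    show "integrable lborel (\<lambda>x::real. indicator {0..1} x *\<^sub>R B)"
      by (intro integrable_scaleR_left integrable_real_indicator) auto
    show "AE x in lborel. norm (Hd d x) \<le> norm (indicator {0..1} x *\<^sub>R B)"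
      using B by (intro AE_I2) (auto simp: Hd_def H_def indicator_def B0)
  qed (simp add: Hd_def)
  \<comment> \<open>The breakpoints e/b lie in two closed pieces, so the decomposition of
    \<open>H\<close> holds only off this finite null set.\<close>
  let ?S = "(\<lambda>e. real e / real b) ` {..b}"
  have "AE x in lborel. x \<notin> ?S"
    by (rule AE_not_in) (auto intro: finite_imp_null_set_lborel)
  hence AE: "AE x in lborel. H x = (\<Sum>d<b. Hd d x)"
  proof eventually_elim
    case (elim x)
    show ?case
    proof (cases "x \<in> {0..1}")
      case True
      have nint: "real b * x \<noteq> real e" if "e \<le> b" for e
        using elim that b by (auto simp: image_iff field_simps)
      define d0 where "d0 = nat \<lfloor>real b * x\<rfloor>"
      have pos: "0 \<le> real b * x" using True b by simp
      have le: "real b * x \<le> real b" using True b by (simp add: mult_left_le)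
      have d0: "real d0 \<le> real b * x" "real b * x < real d0 + 1"
        using pos by (simp_all add: d0_def)
      have "real d0 \<le> real b" using d0 le by linarith
      hence "d0 \<le> b" by simp
      moreover have "d0 \<noteq> b" using nint[of b] d0 le by auto
      ultimately have "d0 < b" by simp
      have "indicator {0..1} (real b * x - real d) = (if d = d0 then 1 else 0 :: real)" if "d < b" for d
      proof (cases "d = d0")
        case False
        have ne: "real b * x \<noteq> real (Suc d)" using nint[of "Suc d"] that by simp
        have "real (Suc d) \<le> real d0 \<or> real (Suc d0) \<le> real d"
          using False unfolding of_nat_le_iff by linarith
        hence "\<not> (real d \<le> real b * x \<and> real b * x \<le> real d + 1)"
          using ne d0 by auto
        thus ?thesis using False by (auto simp: indicator_def)
      qed (use d0 in auto)
      hence "(\<Sum>d<b. Hd d x) = (\<Sum>d<b. if d = d0 then H x else 0)"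
        by (intro sum.cong) (auto simp: Hd_def)
      thus ?thesis using \<open>d0 < b\<close> by simp
    next
      case False
      thus ?thesis by (simp add: H_def Hd_def)
    qed
  qed
  have "(\<integral>x. G x \<partial>lborel01) = (\<integral>x. H x \<partial>lborel)"
    by (simp add: integral_restrict_space H_def)
  also have "\<dots> = (\<integral>x. (\<Sum>d<b. Hd d x) \<partial>lborel)"
    by (rule integral_cong_AE) (use AE in \<open>auto simp: Hd_def\<close>)
  also have "\<dots> = (\<Sum>d<b. \<integral>x. Hd d x \<partial>lborel)"
    by (rule Bochner_Integration.integral_sum) (rule Hd_int)
  also have "\<dots> = (\<Sum>d<b. (1 / of_nat b) * (\<integral>y. G ((real d + y) / real b) \<partial>lborel01))"
  proof (rule sum.cong[OF refl])
    fix d assume "d \<in> {..<b}"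
    have "(\<integral>x. Hd d x \<partial>lborel) = \<bar>1 / real b\<bar> *\<^sub>R (\<integral>y. Hd d (real d / real b + (1 / real b) * y) \<partial>lborel)"
      using b by (intro lborel_integral_real_affine) auto
    also have "(\<lambda>y. Hd d (real d / real b + (1 / real b) * y)) = (\<lambda>y. indicator {0..1} y *\<^sub>R G ((real d + y) / real b))"
    proof
      fix y :: real
      have eq: "real b * (real d / real b + (1 / real b) * y) - real d = y" "real d / real b + (1 / real b) * y = (real d + y) / real b"
        using b by (simp_all add: field_simps)
      have "(real d + y) / real b \<in> {0..1}" if "y \<in> {0..1}"
      proof -
        have "real (Suc d) \<le> real b" using \<open>d \<in> {..<b}\<close> by (subst of_nat_le_iff) auto
        thus ?thesis using that b by (auto simp: field_simps)
      qed
      thus "Hd d (real d / real b + (1 / real b) * y) = indicator {0..1} y *\<^sub>R G ((real d + y) / real b)"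
        unfolding Hd_def eq H_def using b by (cases "y \<in> {0..1}") simp_all
    qed
    also have "(\<integral>y. indicator {0..1} y *\<^sub>R G ((real d + y) / real b) \<partial>lborel) = (\<integral>y. G ((real d + y) / real b) \<partial>lborel01)"
      by (simp add: integral_restrict_space)
    finally show "(\<integral>x. Hd d x \<partial>lborel) = (1 / of_nat b) * (\<integral>y. G ((real d + y) / real b) \<partial>lborel01)"
      by (simp add: scaleR_conv_of_real)
  qed
  finally show ?thesis by (simp add: sum_distrib_left)
qed

text \<open>The function \<phi> is merely bounded and measurable, so its primitive need not be
  differentiable everywhere. Fubini on the triangle t \<le> x replaces the product rule, and the
  boundary term at 1 is g(1) times the integral of \<phi>, which vanishes.\<close>

lemma integral_by_parts_lborel01:
  fixes g g' :: "real \<Rightarrow> real" and \<phi> :: "real \<Rightarrow> complex"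
  assumes g: "\<And>x. x \<in> {0..1} \<Longrightarrow> (g has_real_derivative g' x) (at x within {0..1})"
    and g': "continuous_on {0..1} g'"
    and [measurable]: "\<phi> \<in> borel_measurable borel" and B: "\<And>x. norm (\<phi> x) \<le> B"
    and zero: "(\<integral>x. \<phi> x \<partial>lborel01) = 0"
  shows "(\<integral>x. of_real (g x) * \<phi> x \<partial>lborel01) =
         - (\<integral>x. of_real (g' x) * (\<integral>t. indicator {..x} t *\<^sub>R \<phi> t \<partial>lborel01) \<partial>lborel01)"
proof -
  interpret pair_sigma_finite lborel01 lborel01 ..
  interpret P: pair_prob_space lborel01 lborel01 ..
  have gc: "continuous_on {0..1} g"
    using g by (meson DERIV_continuous continuous_on_eq_continuous_within)
  have [measurable]: "g \<in> borel_measurable lborel01" "g' \<in> borel_measurable lborel01"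
    using gc g' by (auto intro: continuous_on_measurable_lborel01)
  obtain B1 where B1: "\<And>x. x \<in> {0..1} \<Longrightarrow> norm (g x) \<le> B1"
    using compact_imp_bounded[OF compact_continuous_image[OF gc compact_Icc]] unfolding bounded_iff by blast
  obtain B2 where B2: "\<And>x. x \<in> {0..1} \<Longrightarrow> norm (g' x) \<le> B2"
    using compact_imp_bounded[OF compact_continuous_image[OF g' compact_Icc]] unfolding bounded_iff by blast
  have B0: "0 \<le> B" using B[of 0] norm_ge_zero order.trans by blast
  have "0 \<le> B2" using B2[of 0] norm_ge_zero[of "g' 0"] by (meson atLeastAtMost_iff order.trans order_refl zero_le_one)
  define F where "F = (\<lambda>x t. of_real (g' x) * (indicator {..x} t *\<^sub>R \<phi> t))"
  have F_int: "integrable (lborel01 \<Otimes>\<^sub>M lborel01) (\<lambda>(x, t). F x t)"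
  proof (rule P.integrable_const_bound[where B = "B2 * B"])
    show "AE p in lborel01 \<Otimes>\<^sub>M lborel01. norm (case p of (x, t) \<Rightarrow> F x t) \<le> B2 * B"
    proof (rule AE_I2)
      fix p assume "p \<in> space (lborel01 \<Otimes>\<^sub>M lborel01)"
      hence "fst p \<in> {0..1}" by (auto simp: space_pair_measure)
      thus "norm (case p of (x, t) \<Rightarrow> F x t) \<le> B2 * B"
        using B2[of "fst p"] B[of "snd p"] B0 \<open>0 \<le> B2\<close>
        by (auto simp: F_def norm_mult split_def indicator_def intro!: mult_mono)
    qed
    have "(\<lambda>(x, t). F x t) = (\<lambda>p. of_real (g' (fst p)) * ((if snd p \<le> fst p then 1 else 0) *\<^sub>R \<phi> (snd p)))"
      by (auto simp: F_def indicator_def)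
    also have "\<dots> \<in> borel_measurable (lborel01 \<Otimes>\<^sub>M lborel01)"
    proof -
      have id: "(\<lambda>x. x) \<in> borel_measurable lborel01" by (rule measurable_lborel01) simp
      have [measurable]: "fst \<in> borel_measurable (lborel01 \<Otimes>\<^sub>M lborel01)" "snd \<in> borel_measurable (lborel01 \<Otimes>\<^sub>M lborel01)"
        using measurable_compose[OF measurable_fst id] measurable_compose[OF measurable_snd id] by blast+
      have [measurable]: "(\<lambda>p. g' (fst p)) \<in> borel_measurable (lborel01 \<Otimes>\<^sub>M lborel01)"
        by (rule measurable_compose[OF measurable_fst]) measurable
      have [measurable]: "(\<lambda>p. \<phi> (snd p)) \<in> borel_measurable (lborel01 \<Otimes>\<^sub>M lborel01)"
        by (rule measurable_compose[of snd _ borel]) measurable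
      show ?thesis by measurable
    qed
    finally show "(\<lambda>(x, t). F x t) \<in> borel_measurable (lborel01 \<Otimes>\<^sub>M lborel01)" .
  qed
  have inner: "(\<integral>x. F x t \<partial>lborel01) = \<phi> t * of_real (g 1 - g t)" if t: "t \<in> {0..1}" for t
  proof -
    have "(\<integral>x. indicator {t..1} x *\<^sub>R g' x \<partial>lborel) = g 1 - g t"
    proof (rule integral_FTC_atLeastAtMost)
      fix x assume "t \<le> x" "x \<le> 1"
      hence "(g has_real_derivative g' x) (at x within {t..1})"
        using g[of x] t by (auto intro: DERIV_subset)
      thus "(g has_vector_derivative g' x) (at x within {t..1})"
        by (simp add: has_real_derivative_iff_has_vector_derivative)
    qed (use t g' in \<open>auto intro: continuous_on_subset\<close>)
    moreover have "(\<integral>x. F x t \<partial>lborel01) = (\<integral>x. \<phi> t * of_real (indicator {t..1} x *\<^sub>R g' x) \<partial>lborel)"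
    proof (subst integral_restrict_space, simp, rule Bochner_Integration.integral_cong[OF refl])
      fix x show "indicator {0..1} x *\<^sub>R F x t = \<phi> t * of_real (indicator {t..1} x *\<^sub>R g' x)"
        using t by (auto simp: F_def indicator_def)
    qed
    moreover have "\<dots> = \<phi> t * of_real (\<integral>x. indicator {t..1} x *\<^sub>R g' x \<partial>lborel)"
      by (simp only: integral_mult_right_zero integral_complex_of_real)
    ultimately show ?thesis by simp
  qed
  have int1: "integrable lborel01 \<phi>"
    by (rule lborel01.integrable_const_bound[where B = B]) (use B in auto)
  have int2: "integrable lborel01 (\<lambda>t. \<phi> t * of_real (g t))"
    by (rule lborel01.integrable_const_bound[where B = "B * B1"])
       (use B B1 B0 in \<open>auto intro!: AE_I2 mult_mono simp: norm_mult\<close>)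
  have "(\<integral>x. of_real (g' x) * (\<integral>t. indicator {..x} t *\<^sub>R \<phi> t \<partial>lborel01) \<partial>lborel01) =
        (\<integral>x. (\<integral>t. F x t \<partial>lborel01) \<partial>lborel01)"
    unfolding F_def by (simp only: integral_mult_right_zero)
  also have "\<dots> = (\<integral>t. (\<integral>x. F x t \<partial>lborel01) \<partial>lborel01)"
    using Fubini_integral[OF F_int] by simp
  also have "\<dots> = (\<integral>t. \<phi> t * of_real (g 1) - \<phi> t * of_real (g t) \<partial>lborel01)"
    using inner by (intro Bochner_Integration.integral_cong) (auto simp: algebra_simps)
  also have "\<dots> = (\<integral>t. \<phi> t * of_real (g 1) \<partial>lborel01) - (\<integral>t. \<phi> t * of_real (g t) \<partial>lborel01)"
    using int1 int2 by (intro Bochner_Integration.integral_diff) auto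
  also have "(\<integral>t. \<phi> t * of_real (g 1) \<partial>lborel01) = 0" using zero by simp
  finally show ?thesis by (simp add: mult.commute)
qed

section \<open>Walsh functions and their kernels\<close>

text \<open>Digits of points of \<open>[0,1)\<close>; at \<open>x = 1\<close> all digits vanish, so this point is removed as a null set
  whenever digits have to determine a point.\<close>

definition dig :: "nat \<Rightarrow> real \<Rightarrow> 'b::prime_card mod_ring" where
  "dig i x = of_int \<lfloor>real CARD('b) ^ Suc i * x\<rfloor>"

text \<open>The conjugate of the usual Walsh function: integrating f against it gives a Walsh
  coefficient directly, and the points later enter through \<open>chi\<close> with a plus sign.
  Summing up to the degree keeps the definition free of a truncation order.\<close>

definition wal :: "'b::prime_card mod_ring poly \<Rightarrow> real \<Rightarrow> complex" where
  "wal k x = chi (- (\<Sum>i\<le>degree k. coeff k i * dig i x))"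

lemma wal_eq:
  assumes "k \<in> polys n"
  shows "wal k x = chi (- (\<Sum>i<n. coeff k i * dig i x))"
proof -
  have "(\<Sum>i\<le>degree k. coeff k i * dig i x) = (\<Sum>i | coeff k i \<noteq> 0. coeff k i * dig i x)"
    by (rule sum.mono_neutral_right) (auto intro: le_degree)
  also have "\<dots> = (\<Sum>i<n. coeff k i * dig i x)"
    by (rule sum.mono_neutral_left) (use assms in \<open>auto simp: polys_def not_less[symmetric]\<close>)
  finally show ?thesis by (simp add: wal_def)
qed

lemma wal_0 [simp]: "wal 0 x = 1"
  by (simp add: wal_def)

lemma norm_wal [simp]: "norm (wal k x) = 1"
  by (simp add: wal_def)

lemma dig_0: "(dig 0 x :: 'b::prime_card mod_ring) = of_int \<lfloor>real CARD('b) * x\<rfloor>"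
  by (simp add: dig_def)

lemma dig_Suc: "(dig (Suc i) x :: 'b::prime_card mod_ring) = dig i (real CARD('b) * x)"
  by (simp add: dig_def mult_ac)

lemma wal_pCons:
  "wal (pCons c k) x = chi (- (c * of_int \<lfloor>real CARD('b) * x\<rfloor>)) * wal k (real CARD('b) * x)"
  for c :: "'b::prime_card mod_ring"
proof -
  let ?n = "Suc (degree k)"
  have "k \<in> polys ?n" by (simp add: in_polys_iff)
  hence "wal (pCons c k) x = chi (- (\<Sum>i<Suc ?n. coeff (pCons c k) i * dig i x))"
    by (intro wal_eq) simp
  also have "\<dots> = chi (- (c * dig 0 x) + - (\<Sum>i<?n. coeff k i * dig i (real CARD('b) * x)))"
    unfolding sum.lessThan_Suc_shift[of _ ?n] by (simp only: coeff_pCons_0 coeff_pCons_Suc dig_Suc minus_add_distrib)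
  finally show ?thesis using \<open>k \<in> polys ?n\<close> by (simp only: chi_add dig_0 wal_eq)
qed

lemma wal_plus_nat: "wal k (real d + y) = wal k y" for k :: "'b::prime_card mod_ring poly"
proof -
  have "(dig i (real d + y) :: 'b mod_ring) = dig i y" for i
  proof -
    have "real CARD('b) ^ Suc i * (real d + y) = real CARD('b) ^ Suc i * y + of_int (int CARD('b) ^ Suc i * int d)"
      by (simp add: algebra_simps)
    hence "\<lfloor>real CARD('b) ^ Suc i * (real d + y)\<rfloor> = \<lfloor>real CARD('b) ^ Suc i * y\<rfloor> + int CARD('b) ^ Suc i * int d"
      by (simp only: floor_add_int[symmetric])
    thus ?thesis by (simp add: dig_def)
  qed
  thus ?thesis by (simp add: wal_def)
qed

lemma measurable_chi_floor [measurable]: "(\<lambda>x::real. chi (- (c * of_int \<lfloor>r * x\<rfloor>))) \<in> borel_measurable borel"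
proof -
  have "(\<lambda>x::real. \<lfloor>r * x\<rfloor>) \<in> measurable borel (count_space UNIV)" by measurable
  from measurable_compose[OF this, of "\<lambda>z. chi (- (c * of_int z))" borel] show ?thesis by simp
qed

lemma measurable_wal [measurable]: "wal k \<in> borel_measurable borel"
proof -
  have "wal k = (\<lambda>x. \<Prod>i\<le>degree k. chi (- (coeff k i * of_int \<lfloor>real CARD('a) ^ Suc i * x\<rfloor>)))"
    unfolding wal_def dig_def by (simp add: chi_sum sum_negf[symmetric])
  also have "\<dots> \<in> borel_measurable borel" by (intro borel_measurable_prod measurable_chi_floor)
  finally show ?thesis .
qed

text \<open>A smooth function on the closed interval together with all its derivatives, one-sided at
  the end points. Carrying the whole sequence matches \<open>smooth_derivs\<close>, where the
  derivatives are also given as a family.\<close>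

definition deriv_chain :: "(nat \<Rightarrow> real \<Rightarrow> real) \<Rightarrow> bool" where
  "deriv_chain g \<longleftrightarrow> (\<forall>i. \<forall>x\<in>{0..1}. (g i has_real_derivative g (Suc i) x) (at x within {0..1}))"

lemma deriv_chain_continuous: "deriv_chain g \<Longrightarrow> continuous_on {0..1} (g i)"
  unfolding deriv_chain_def by (meson DERIV_continuous continuous_on_eq_continuous_within)

lemma deriv_chain_scale:
  assumes g: "deriv_chain g" and d: "d < b"
  shows "deriv_chain (\<lambda>i y. (1 / real b) ^ i * g i ((real d + y) / real b))"
  unfolding deriv_chain_def
proof (intro allI ballI)
  fix i and x :: real assume x: "x \<in> {0..1}"
  have img: "(real d + y) / real b \<in> {0..1}" if "y \<in> {0..1}" for y
  proof -
    have "real (Suc d) \<le> real b" using d by (subst of_nat_le_iff) auto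
    thus ?thesis using that d by (auto simp: field_simps)
  qed
  have "(g i has_real_derivative g (Suc i) ((real d + x) / real b)) (at ((real d + x) / real b) within {0..1})"
    using g img[OF x] by (simp add: deriv_chain_def)
  hence "(g i has_real_derivative g (Suc i) ((real d + x) / real b))
          (at ((real d + x) / real b) within (\<lambda>y. (real d + y) / real b) ` {0..1})"
    by (rule DERIV_subset) (use img in auto)
  moreover have "((\<lambda>y. (real d + y) / real b) has_real_derivative 1 / real b) (at x within {0..1})"
    using d by (auto intro!: derivative_eq_intros)
  ultimately have "((g i \<circ> (\<lambda>y. (real d + y) / real b)) has_real_derivative g (Suc i) ((real d + x) / real b) * (1 / real b)) (at x within {0..1})"
    by (rule DERIV_image_chain)
  from DERIV_cmult[OF this, of "(1 / real b) ^ i"]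
  show "((\<lambda>y. (1 / real b) ^ i * g i ((real d + y) / real b)) has_real_derivative
          (1 / real b) ^ Suc i * g (Suc i) ((real d + x) / real b)) (at x within {0..1})"
    by (simp add: o_def mult_ac)
qed

lemma sum_chi_geometric: "(chi c - 1) * (\<Sum>d<j. chi (of_nat d * c)) = chi (of_nat j * c) - 1"
  by (induction j) (auto simp: algebra_simps chi_add)

text \<open>An incomplete geometric sum: its numerator is a chord, at most \<open>M_b\<close>, and
  its denominator a nontrivial chord, at least \<open>m_b\<close>.\<close>

lemma norm_sum_chi_le:
  fixes c :: "'b::prime_card mod_ring"
  assumes "c \<noteq> 0"
  shows "norm (\<Sum>d<j. chi (of_nat d * c)) \<le> M_b CARD('b) / m_b CARD('b)"
proof -
  have m: "0 < m_b CARD('b)" using prime_ge_2_nat[OF prime_card[where 'a='b]] by (rule m_b_pos)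
  have "norm (chi c - 1) * norm (\<Sum>d<j. chi (of_nat d * c)) = norm (chi (of_nat j * c) - 1)"
    by (metis norm_mult sum_chi_geometric)
  also have "\<dots> \<le> M_b CARD('b)" by (rule norm_chi_minus_1_le_M_b)
  finally have "norm (chi c - 1) * norm (\<Sum>d<j. chi (of_nat d * c)) \<le> M_b CARD('b)" .
  moreover have "m_b CARD('b) * norm (\<Sum>d<j. chi (of_nat d * c)) \<le> norm (chi c - 1) * norm (\<Sum>d<j. chi (of_nat d * c))"
    using m_b_le_norm_chi_minus_1[OF assms] by (intro mult_right_mono) auto
  ultimately have "m_b CARD('b) * norm (\<Sum>d<j. chi (of_nat d * c)) \<le> M_b CARD('b)" by linarith
  thus ?thesis using m by (simp add: field_simps)
qed

text \<open>Copies K to each of the b pieces and multiplies the copy on piece d by the phase of the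
  digit d. Prepending a digit to a Walsh index acts in this way, and kernels are built by the same
  operation.\<close>

definition dig_twist :: "'b::prime_card mod_ring \<Rightarrow> (real \<Rightarrow> complex) \<Rightarrow> real \<Rightarrow> complex" where
  "dig_twist c K x = chi (- (c * of_int \<lfloor>real CARD('b) * x\<rfloor>)) * K (frac (real CARD('b) * x))"

lemma measurable_dig_twist [measurable]:
  assumes [measurable]: "K \<in> borel_measurable borel"
  shows "dig_twist c K \<in> borel_measurable borel"
  unfolding dig_twist_def frac_def by measurable

lemma norm_dig_twist_le:
  assumes "\<And>x. x \<in> {0..1} \<Longrightarrow> norm (K x) \<le> B"
  shows "norm (dig_twist c K x) \<le> B"
  using assms by (auto simp: dig_twist_def norm_mult intro!: assms frac_ge_0 less_imp_le[OF frac_lt_1])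

lemma dig_twist_shift:
  fixes c :: "'b::prime_card mod_ring"
  assumes "0 \<le> y" "y < 1"
  shows "dig_twist c K ((real d + y) / real CARD('b)) = chi (- (c * of_nat d)) * K y"
proof -
  have "\<lfloor>real d + y\<rfloor> = int d" using assms by linarith
  moreover have "frac (real d + y) = y" using assms by (simp add: frac_def calculation)
  ultimately show ?thesis by (simp add: dig_twist_def)
qed

lemma AE_lborel01_lt_1: "AE x in lborel01. 0 \<le> x \<and> x < 1"
  using AE_lborel01_neq_1 AE_space by eventually_elim auto

lemma integral_dig_twist:
  fixes g :: "real \<Rightarrow> real" and c :: "'b::prime_card mod_ring"
  assumes K [measurable]: "K \<in> borel_measurable borel" and B: "\<And>x. x \<in> {0..1} \<Longrightarrow> norm (K x) \<le> B"
    and g [measurable]: "g \<in> borel_measurable lborel01" and Bg: "\<And>x. x \<in> {0..1} \<Longrightarrow> \<bar>g x\<bar> \<le> B'"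
  shows "(\<integral>x. of_real (g x) * dig_twist c K x \<partial>lborel01) =
    (1 / of_nat CARD('b)) * (\<Sum>d<CARD('b). chi (- (c * of_nat d)) * (\<integral>y. of_real (g ((real d + y) / real CARD('b))) * K y \<partial>lborel01))"
proof -
  let ?b = "CARD('b)"
  have B0: "0 \<le> B" "0 \<le> B'" using B[of 0] Bg[of 0] norm_ge_zero[of "K 0"] abs_ge_zero[of "g 0"]
    by (meson atLeastAtMost_iff order.trans order_refl zero_le_one)+
  have "(\<integral>x. of_real (g x) * dig_twist c K x \<partial>lborel01) = (1 / of_nat ?b) *
     (\<Sum>d<?b. \<integral>y. of_real (g ((real d + y) / real ?b)) * dig_twist c K ((real d + y) / real ?b) \<partial>lborel01)"
  proof (rule integral_lborel01_scale)
    show "norm (of_real (g x) * dig_twist c K x) \<le> B' * B" if "x \<in> {0..1}" for x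
      using Bg[OF that] norm_dig_twist_le[OF B] B0 by (auto simp: norm_mult intro!: mult_mono)
  qed auto
  also have "(\<Sum>d<?b. \<integral>y. of_real (g ((real d + y) / real ?b)) * dig_twist c K ((real d + y) / real ?b) \<partial>lborel01) =
     (\<Sum>d<?b. chi (- (c * of_nat d)) * (\<integral>y. of_real (g ((real d + y) / real ?b)) * K y \<partial>lborel01))"
  proof (rule sum.cong[OF refl])
    fix d assume d: "d \<in> {..<?b}"
    have [measurable]: "(\<lambda>y. (real d + y) / real ?b) \<in> measurable lborel01 lborel01"
    proof (rule measurable_restrict_space2)
      have "real (Suc d) \<le> real ?b" using d by (subst of_nat_le_iff) auto
      thus "(\<lambda>y. (real d + y) / real ?b) \<in> space lborel01 \<rightarrow> {0..1}" by (auto simp: field_simps)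
      show "(\<lambda>y. (real d + y) / real ?b) \<in> lborel01 \<rightarrow>\<^sub>M lborel"
        unfolding measurable_lborel1 by (rule measurable_lborel01) measurable
    qed
    have [measurable]: "(\<lambda>y. g ((real d + y) / real ?b)) \<in> borel_measurable lborel01"
      by (rule measurable_compose[of _ _ lborel01]) measurable
    have "(\<integral>y. of_real (g ((real d + y) / real ?b)) * dig_twist c K ((real d + y) / real ?b) \<partial>lborel01)
        = (\<integral>y. chi (- (c * of_nat d)) * (of_real (g ((real d + y) / real ?b)) * K y) \<partial>lborel01)"
    proof (rule integral_cong_AE)
      show "AE y in lborel01. of_real (g ((real d + y) / real ?b)) * dig_twist c K ((real d + y) / real ?b) =
         chi (- (c * of_nat d)) * (of_real (g ((real d + y) / real ?b)) * K y)"
        using AE_lborel01_lt_1 by eventually_elim (simp add: dig_twist_shift)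
      have "(\<lambda>y. dig_twist c K ((real d + y) / real ?b)) \<in> borel_measurable lborel01"
        by (rule measurable_lborel01) measurable
      thus "(\<lambda>y. of_real (g ((real d + y) / real ?b)) * dig_twist c K ((real d + y) / real ?b)) \<in> borel_measurable lborel01"
        by measurable
    qed measurable
    thus "(\<integral>y. of_real (g ((real d + y) / real ?b)) * dig_twist c K ((real d + y) / real ?b) \<partial>lborel01) =
      chi (- (c * of_nat d)) * (\<integral>y. of_real (g ((real d + y) / real ?b)) * K y \<partial>lborel01)"
      by (simp only: integral_mult_right_zero)
  qed
  finally show ?thesis .
qed

lemma wal_pCons_dig_twist:
  fixes c :: "'b::prime_card mod_ring"
  shows "wal (pCons c k) x = dig_twist c (wal k) x"
proof -
  define z where "z = \<lfloor>real CARD('b) * x\<rfloor>"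
  have "wal k (real CARD('b) * x) = wal k (frac (real CARD('b) * x))"
  proof (cases "0 \<le> z")
    case True
    hence "real CARD('b) * x = real (nat z) + frac (real CARD('b) * x)"
      by (simp add: frac_def z_def)
    thus ?thesis by (metis wal_plus_nat)
  next
    case False
    hence "frac (real CARD('b) * x) = real (nat (- z)) + real CARD('b) * x"
      by (simp add: frac_def z_def)
    thus ?thesis by (metis wal_plus_nat)
  qed
  thus ?thesis by (simp add: dig_twist_def wal_pCons)
qed

text \<open>The pieces wholly to the left of x contribute the integral of K times an incomplete
  geometric sum, bounded by \<open>M_b / m_b\<close>; the piece containing x contributes at most B.
  All pieces have length 1/b.\<close>

lemma norm_integral_dig_twist_le:
  fixes c :: "'b::prime_card mod_ring"
  assumes c: "c \<noteq> 0" and [measurable]: "K \<in> borel_measurable borel" and B: "\<And>x. x \<in> {0..1} \<Longrightarrow> norm (K x) \<le> B"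
    and x: "x \<in> {0..1}"
  shows "norm (\<integral>t. indicator {..x} t *\<^sub>R dig_twist c K t \<partial>lborel01) \<le> B / real CARD('b) * (M_b CARD('b) / m_b CARD('b) + 1)"
proof -
  let ?b = "CARD('b)"
  let ?J = "\<lambda>d. \<integral>y. indicator {..real ?b * x - real d} y *\<^sub>R K y \<partial>lborel01"
  have B0: "0 \<le> B" using B[of 0] norm_ge_zero[of "K 0"] by (meson atLeastAtMost_iff order.trans order_refl zero_le_one)
  have Kint: "norm (\<integral>y. indicator A y *\<^sub>R K y \<partial>lborel01) \<le> B" if [measurable]: "A \<in> sets borel" for A
  proof -
    have "norm (\<integral>y. indicator A y *\<^sub>R K y \<partial>lborel01) \<le> (\<integral>y. norm (indicator A y *\<^sub>R K y) \<partial>lborel01)"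
      by (rule integral_norm_bound)
    also have "\<dots> \<le> (\<integral>y. B \<partial>lborel01)"
    proof (rule integral_mono')
      show "norm (indicator A y *\<^sub>R K y) \<le> B" if "y \<in> space lborel01" for y
        using B[of y] that B0 by (auto simp: indicator_def)
    qed (use B0 in auto)
    finally show ?thesis using lborel01.prob_space by simp
  qed
  define I where "I = (\<integral>y. K y \<partial>lborel01)"
  have I: "norm I \<le> B" using Kint[of UNIV] by (simp add: I_def)
  have "(\<integral>t. indicator {..x} t *\<^sub>R dig_twist c K t \<partial>lborel01) = (\<integral>t. of_real (indicator {..x} t) * dig_twist c K t \<partial>lborel01)"
    by (simp add: scaleR_conv_of_real)
  also have "\<dots> = (1 / of_nat ?b) * (\<Sum>d<?b. chi (- (c * of_nat d)) *
       (\<integral>y. of_real (indicator {..x} ((real d + y) / real ?b)) * K y \<partial>lborel01))"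
  proof (rule integral_dig_twist[OF _ B])
    show "indicat_real {..x} \<in> borel_measurable lborel01" by (rule measurable_lborel01) measurable
    show "\<bar>indicat_real {..x} y\<bar> \<le> 1" if "y \<in> {0..1}" for y by (auto simp: indicator_def)
  qed auto
  also have "(\<Sum>d<?b. chi (- (c * of_nat d)) * (\<integral>y. of_real (indicator {..x} ((real d + y) / real ?b)) * K y \<partial>lborel01)) =
    (\<Sum>d<?b. chi (- (c * of_nat d)) * ?J d)"
    by (intro sum.cong refl arg_cong2[of _ _ _ _ "(*)"] Bochner_Integration.integral_cong)
       (auto simp: indicator_def field_simps)
  also have "\<dots> = (\<Sum>d<?b. chi (of_nat d * (- c)) * ?J d)"
    by (simp add: mult.commute)
  finally have eq: "(\<integral>t. indicator {..x} t *\<^sub>R dig_twist c K t \<partial>lborel01) =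
    (1 / of_nat ?b) * (\<Sum>d<?b. chi (of_nat d * (- c)) * ?J d)" .
  \<comment> \<open>The index of the piece containing x; for x = 1 it is b, and then there is no
    partial piece.\<close>
  define j where "j = nat \<lfloor>real ?b * x\<rfloor>"
  have pos: "0 \<le> real ?b * x" using x by simp
  have j: "real j \<le> real ?b * x" "real ?b * x < real j + 1"
    using pos by (simp_all add: j_def)
  have "real j \<le> real ?b" using j x by (meson atLeastAtMost_iff mult_left_le of_nat_0_le_iff order.trans)
  hence jb: "j \<le> ?b" by simp
  define T where "T = (\<lambda>d. chi (of_nat d * (- c)) * ?J d)"
  have T1: "T d = chi (of_nat d * (- c)) * I" if "d < j" for d
  proof -
    have "real (Suc d) \<le> real j" using that by (subst of_nat_le_iff) auto
    hence "1 \<le> real ?b * x - real d" using j by simp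
    thus ?thesis unfolding T_def I_def
      by (intro arg_cong2[of _ _ _ _ "(*)"] refl Bochner_Integration.integral_cong) (auto simp: indicator_def)
  qed
  have T2: "T d = 0" if "j < d" for d
  proof -
    have "real (Suc j) \<le> real d" using that by (subst of_nat_le_iff) auto
    hence "real ?b * x - real d < 0" using j by simp
    hence "?J d = (\<integral>y. 0 \<partial>lborel01)"
      by (intro Bochner_Integration.integral_cong) (auto simp: indicator_def)
    thus ?thesis by (simp add: T_def)
  qed
  have Tj: "norm (T j) \<le> B" using Kint[of "{..real ?b * x - real j}"] by (simp add: T_def norm_mult)
  have Tsum: "norm (\<Sum>d<?b. T d) \<le> norm (\<Sum>d<j. T d) + B"
  proof (cases "j < ?b")
    case True
    have "(\<Sum>d<?b. T d) = (\<Sum>d\<in>{..<Suc j}. T d)"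
      by (rule sum.mono_neutral_right) (use True T2 in auto)
    thus ?thesis using Tj norm_triangle_ineq[of "\<Sum>d<j. T d" "T j"] by simp
  next
    case False
    with jb have "j = ?b" by simp
    thus ?thesis using B0 by simp
  qed
  have "norm (\<Sum>d<j. T d) = norm ((\<Sum>d<j. chi (of_nat d * (- c))) * I)"
    using T1 by (simp add: sum_distrib_right)
  also have "\<dots> \<le> (M_b ?b / m_b ?b) * B"
    unfolding norm_mult using norm_sum_chi_le[of "- c" j] c I
    by (intro mult_mono) (auto intro: order.trans[OF norm_ge_zero])
  finally have "norm (\<Sum>d<?b. T d) \<le> B * (M_b ?b / m_b ?b + 1)"
    using Tsum by (simp add: algebra_simps)
  hence "norm (\<Sum>d<?b. T d) / real ?b \<le> B * (M_b ?b / m_b ?b + 1) / real ?b" by (rule divide_right_mono) simp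
  thus ?thesis unfolding eq T_def[symmetric] by (simp add: norm_mult norm_divide)
qed

text \<open>The kernel is built from the lowest digit \<open>c\<close> of the index upwards, using the self-similarity of \<open>[0,1]\<close>: the
  remaining digits contribute the kernel of \<open>k\<close> rescaled to each interval of length \<open>1 / b\<close>, and only if
  \<open>c \<noteq> 0\<close> an integration by parts, which costs the factor \<open>M_b / m_b + 1\<close>, is performed.\<close>

lemma walsh_kernel_exists:
  fixes k :: "'b::prime_card mod_ring poly"
  assumes b3: "3 \<le> CARD('b)"
  shows "\<exists>K. K \<in> borel_measurable borel \<and>
    (\<forall>x\<in>{0..1}. norm (K x) \<le> real CARD('b) powr (- mu 0 k) * (C_b CARD('b) / m_b CARD('b)) ^ nzc k) \<and>
    (\<forall>g. deriv_chain g \<longrightarrow> (\<integral>x. of_real (g 0 x) * wal k x \<partial>lborel01) = (\<integral>x. of_real (g (nzc k) x) * K x \<partial>lborel01))"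
proof (induction k)
  case 0
  show ?case by (intro exI[of _ "\<lambda>_. 1"]) (use b3 in auto)
next
  case (pCons c k)
  let ?b = "CARD('b)"
  let ?v = "nzc k"
  let ?J = "\<lambda>F H d. \<integral>y. of_real (F ((real d + y) / real ?b)) * H y \<partial>lborel01"
  define B where "B = real ?b powr (- mu 0 k) * (C_b ?b / m_b ?b) ^ ?v"
  from pCons obtain K where K [measurable]: "K \<in> borel_measurable borel" and KB: "\<And>x. x \<in> {0..1} \<Longrightarrow> norm (K x) \<le> B"
    and Kg: "\<And>g. deriv_chain g \<Longrightarrow> (\<integral>x. of_real (g 0 x) * wal k x \<partial>lborel01) = (\<integral>x. of_real (g ?v x) * K x \<partial>lborel01)"
    unfolding B_def by blast
  have b0: "real ?b > 0" by simp
  have bd: "\<exists>B'. \<forall>x\<in>{0..1}. \<bar>g i x\<bar> \<le> B'" if "deriv_chain g" for g :: "nat \<Rightarrow> real \<Rightarrow> real" and i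
    using compact_imp_bounded[OF compact_continuous_image[OF deriv_chain_continuous[OF that, of i] compact_Icc]]
    unfolding bounded_iff by (auto simp: ball_simps)
  \<comment> \<open>Differentiating \<open>?v\<close> times after rescaling to a piece of length 1/b
    produces this factor.\<close>
  define \<beta> :: complex where "\<beta> = (1 / of_nat ?b) ^ ?v"
  have step: "(\<integral>x. of_real (g 0 x) * wal (pCons c k) x \<partial>lborel01) = \<beta> * (\<integral>x. of_real (g ?v x) * dig_twist c K x \<partial>lborel01)"
    if g: "deriv_chain g" for g
  proof -
    have gm: "g i \<in> borel_measurable lborel01" for i
      using deriv_chain_continuous[OF g] by (rule continuous_on_measurable_lborel01)
    obtain B0 where B0: "\<And>x. x \<in> {0..1} \<Longrightarrow> \<bar>g 0 x\<bar> \<le> B0" using bd[OF g, of 0] by blast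
    obtain Bv where Bv: "\<And>x. x \<in> {0..1} \<Longrightarrow> \<bar>g ?v x\<bar> \<le> Bv" using bd[OF g, of ?v] by blast
    have "(\<integral>x. of_real (g 0 x) * wal (pCons c k) x \<partial>lborel01) = (\<integral>x. of_real (g 0 x) * dig_twist c (wal k) x \<partial>lborel01)"
      by (simp add: wal_pCons_dig_twist)
    also have "\<dots> = (1 / of_nat ?b) * (\<Sum>d<?b. chi (- (c * of_nat d)) * ?J (g 0) (wal k) d)"
      by (rule integral_dig_twist[OF _ _ gm B0, of _ 1]) auto
    also have "(\<Sum>d<?b. chi (- (c * of_nat d)) * ?J (g 0) (wal k) d) =
       (\<Sum>d<?b. \<beta> * (chi (- (c * of_nat d)) * ?J (g ?v) K d))"
    proof (rule sum.cong[OF refl])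
      fix d assume "d \<in> {..<?b}"
      hence "deriv_chain (\<lambda>i y. (1 / real ?b) ^ i * g i ((real d + y) / real ?b))"
        using deriv_chain_scale[OF g] by simp
      from Kg[OF this] have "?J (g 0) (wal k) d =
         (\<integral>y. \<beta> * (of_real (g ?v ((real d + y) / real ?b)) * K y) \<partial>lborel01)"
        by (simp add: \<beta>_def mult_ac)
      thus "chi (- (c * of_nat d)) * ?J (g 0) (wal k) d =
        \<beta> * (chi (- (c * of_nat d)) * ?J (g ?v) K d)"
        by (simp only: integral_mult_right_zero mult_ac)
    qed
    also have "(1 / of_nat ?b) * \<dots> = \<beta> * ((1 / of_nat ?b) * (\<Sum>d<?b. chi (- (c * of_nat d)) * ?J (g ?v) K d))"
      by (simp add: sum_distrib_left mult_ac)
    also have "(1 / of_nat ?b) * (\<Sum>d<?b. chi (- (c * of_nat d)) * ?J (g ?v) K d) =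
       (\<integral>x. of_real (g ?v x) * dig_twist c K x \<partial>lborel01)"
      by (rule integral_dig_twist[OF K KB gm Bv, symmetric]) auto
    finally show ?thesis .
  qed
  have norm_\<beta>: "norm \<beta> = real ?b powr (- real ?v)"
    by (simp add: \<beta>_def norm_power norm_divide powr_minus powr_realpow power_divide inverse_eq_divide)
  \<comment> \<open>The digits of k move up one place, so its weight grows by \<open>?v\<close>; the
    norm of \<beta> is the matching factor b^(-?v).\<close>
  have mu1: "mu (0 + 1) k = mu 0 k + real ?v" using mu_eq[of 1 k] by simp
  show ?case
  proof (cases "c = 0")
    case True
    show ?thesis
    proof (intro exI[of _ "\<lambda>x. \<beta> * dig_twist c K x"] conjI ballI allI impI)
      fix x :: real
      have "norm (\<beta> * dig_twist c K x) \<le> real ?b powr (- real ?v) * B"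
        unfolding norm_mult norm_\<beta> using norm_dig_twist_le[OF KB] by (intro mult_left_mono) auto
      also have "\<dots> = (real ?b powr (- real ?v) * real ?b powr (- mu 0 k)) * (C_b ?b / m_b ?b) ^ ?v"
        by (simp add: B_def)
      also have "real ?b powr (- real ?v) * real ?b powr (- mu 0 k) = real ?b powr (- mu 0 (pCons c k))"
        using True by (simp add: powr_add[symmetric] mu_pCons mu1[simplified] algebra_simps)
      also have "?v = nzc (pCons c k)" using True by (simp add: nzc_pCons)
      finally show "norm (\<beta> * dig_twist c K x) \<le> real ?b powr (- mu 0 (pCons c k)) * (C_b ?b / m_b ?b) ^ nzc (pCons c k)" .
    next
      fix g assume "deriv_chain g"
      from step[OF this] show "(\<integral>x. of_real (g 0 x) * wal (pCons c k) x \<partial>lborel01) =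
        (\<integral>x. of_real (g (nzc (pCons c k)) x) * (\<beta> * dig_twist c K x) \<partial>lborel01)"
        using True by (simp add: nzc_pCons mult.left_commute[of _ \<beta>])
    qed measurable
  next
    case False
    \<comment> \<open>For a nonzero lowest digit the kernel is -\<beta> times this primitive. The
      factor 1/b in its bound accounts for the weight 1 of position 0, and the remaining factor is
      absorbed into one more power of \<open>C_b / m_b\<close>.\<close>
    define \<Phi> where "\<Phi> = (\<lambda>x. \<integral>t. indicator {..x} t *\<^sub>R dig_twist c K t \<partial>lborel01)"
    have \<Phi>m: "\<Phi> \<in> borel_measurable borel"
    proof -
      have id: "(\<lambda>t. t) \<in> borel_measurable lborel01" by (rule measurable_lborel01) simp
      have [measurable]: "snd \<in> borel_measurable (borel \<Otimes>\<^sub>M lborel01)"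
        using measurable_compose[OF measurable_snd id] by blast
      have "(\<lambda>(x::real, t). (if t \<le> x then 1 else 0) *\<^sub>R dig_twist c K t) \<in> borel_measurable (borel \<Otimes>\<^sub>M lborel01)"
        unfolding split_def by measurable
      hence "(\<lambda>x. \<integral>t. (if t \<le> x then 1 else 0) *\<^sub>R dig_twist c K t \<partial>lborel01) \<in> borel_measurable borel"
        by (rule lborel01.borel_measurable_lebesgue_integral)
      thus ?thesis by (simp add: \<Phi>_def indicator_def of_bool_def)
    qed
    \<comment> \<open>The phases of the b pieces run through a full geometric sum of a nontrivial
      character, which is 0; this removes the boundary term.\<close>
    have int0: "(\<integral>x. dig_twist c K x \<partial>lborel01) = 0"
    proof -
      have "(\<integral>x. of_real 1 * dig_twist c K x \<partial>lborel01) =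
        (1 / of_nat ?b) * (\<Sum>d<?b. chi (- (c * of_nat d)) * (\<integral>y. of_real 1 * K y \<partial>lborel01))"
        by (rule integral_dig_twist[OF K KB, of _ 1]) auto
      also have "(\<Sum>d<?b. chi (- (c * of_nat d)) * (\<integral>y. of_real 1 * K y \<partial>lborel01)) =
        (\<Sum>d<?b. chi (of_nat d * (- c))) * (\<integral>y. of_real 1 * K y \<partial>lborel01)"
        unfolding sum_distrib_right by (simp add: mult.commute[of c])
      also have "(\<Sum>d<?b. chi (of_nat d * (- c))) = 0"
        using sum_chi_geometric[of "- c" ?b] chi_neq_1[of "- c"] False by simp
      finally show ?thesis by simp
    qed
    show ?thesis
    proof (intro exI[of _ "\<lambda>x. - \<beta> * \<Phi> x"] conjI ballI allI impI)
      show "(\<lambda>x. - \<beta> * \<Phi> x) \<in> borel_measurable borel" using \<Phi>m by measurable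
    next
      fix x :: real assume x: "x \<in> {0..1}"
      have m: "m_b ?b > 0" using b3 by (intro m_b_pos) auto
      have M: "0 \<le> M_b ?b" using norm_chi_minus_1_le_M_b[of "0 :: 'b mod_ring"] by simp
      have B0: "0 \<le> B" using KB[of 0] norm_ge_zero[of "K 0"] by (meson atLeastAtMost_iff order.trans order_refl zero_le_one)
      have "M_b ?b / m_b ?b + 1 \<le> C_b ?b / m_b ?b"
        using M_b_plus_m_b_le_C_b(1)[OF b3 M] m by (simp add: field_simps)
      hence "B / real ?b * (M_b ?b / m_b ?b + 1) \<le> B / real ?b * (C_b ?b / m_b ?b)"
        using B0 by (intro mult_left_mono) auto
      with norm_integral_dig_twist_le[OF False K KB x]
      have "norm (\<Phi> x) \<le> B / real ?b * (C_b ?b / m_b ?b)" unfolding \<Phi>_def by linarith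
      hence "norm (- \<beta> * \<Phi> x) \<le> real ?b powr (- real ?v) * (B / real ?b * (C_b ?b / m_b ?b))"
        unfolding norm_mult norm_minus_cancel norm_\<beta> by (intro mult_left_mono) auto
      also have "\<dots> = (real ?b powr (- real ?v) * real ?b powr (- mu 0 k) * real ?b powr (- 1)) * (C_b ?b / m_b ?b) ^ Suc ?v"
        by (simp add: B_def powr_minus inverse_eq_divide mult_ac)
      also have "real ?b powr (- real ?v) * real ?b powr (- mu 0 k) * real ?b powr (- 1) = real ?b powr (- mu 0 (pCons c k))"
      proof -
        have "- mu 0 (pCons c k) = - real ?v + - mu 0 k + - 1"
          using False by (simp add: mu_pCons mu1[simplified])
        thus ?thesis by (simp only: powr_add)
      qed
      finally show "norm (- \<beta> * \<Phi> x) \<le> real ?b powr (- mu 0 (pCons c k)) * (C_b ?b / m_b ?b) ^ nzc (pCons c k)"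
        using False by (simp add: nzc_pCons)
    next
      fix g assume g: "deriv_chain g"
      have "(\<integral>x. of_real (g ?v x) * dig_twist c K x \<partial>lborel01) = - (\<integral>x. of_real (g (Suc ?v) x) * \<Phi> x \<partial>lborel01)"
        unfolding \<Phi>_def
        by (rule integral_by_parts_lborel01[OF _ _ _ norm_dig_twist_le[OF KB] int0])
           (use g deriv_chain_continuous[OF g] in \<open>auto simp: deriv_chain_def\<close>)
      hence "(\<integral>x. of_real (g 0 x) * wal (pCons c k) x \<partial>lborel01) = (- \<beta>) * (\<integral>x. of_real (g (Suc ?v) x) * \<Phi> x \<partial>lborel01)"
        using step[OF g] by simp
      also have "\<dots> = (\<integral>x. of_real (g (Suc ?v) x) * (- \<beta> * \<Phi> x) \<partial>lborel01)"
        by (simp only: integral_mult_right_zero[symmetric] mult.left_commute)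
      finally show "(\<integral>x. of_real (g 0 x) * wal (pCons c k) x \<partial>lborel01) = (\<integral>x. of_real (g (nzc (pCons c k)) x) * (- \<beta> * \<Phi> x) \<partial>lborel01)"
        using False by (simp add: nzc_pCons)
    qed
  qed
qed

section \<open>Walsh coefficients on the unit cube\<close>

lemma cube_measure_eq: "cube_measure s = PiM {1..s} (\<lambda>_. lborel01)"
  by (simp add: cube_measure_def)

lemma space_cube_measure [simp]: "space (cube_measure s) = unit_cube s"
  by (simp add: cube_measure_eq space_PiM unit_cube_def)

interpretation unit_product: product_sigma_finite "\<lambda>_::nat. lborel01"
  by unfold_locales

interpretation cube: prob_space "cube_measure s" for s
  unfolding cube_measure_eq by (rule prob_space_PiM) (rule prob_space_lborel01)

lemma measurable_cube_component:
  assumes "j \<in> {1..s}" and [measurable]: "h \<in> borel_measurable borel"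
  shows "(\<lambda>x. h (x j)) \<in> borel_measurable (cube_measure s)"
proof (rule measurable_compose[of "\<lambda>x. x j" _ lborel01])
  show "(\<lambda>x. x j) \<in> cube_measure s \<rightarrow>\<^sub>M lborel01"
    unfolding cube_measure_eq using assms(1) by (rule measurable_component_singleton)
  show "h \<in> borel_measurable lborel01" by (rule measurable_lborel01) measurable
qed

text \<open>Continuity refers to the product topology on all of
  \<open>nat \<Rightarrow> real\<close>. Points of the cube are constantly \<open>undefined\<close>
  outside {1..s}, so every coordinate is either a measurable component or a constant.\<close>

lemma continuous_on_measurable_cube:
  fixes F :: "(nat \<Rightarrow> real) \<Rightarrow> real"
  assumes "continuous_on (unit_cube s) F"
  shows "F \<in> borel_measurable (cube_measure s)"
proof (rule measurable_compose[of "\<lambda>x. x" _ "restrict_space borel (unit_cube s)"])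
  show "F \<in> borel_measurable (restrict_space borel (unit_cube s))"
    using assms by (rule borel_measurable_continuous_on_restrict)
  show "(\<lambda>x. x) \<in> cube_measure s \<rightarrow>\<^sub>M restrict_space borel (unit_cube s)"
  proof (rule measurable_restrict_space2)
    show "(\<lambda>x. x) \<in> borel_measurable (cube_measure s)"
    proof (rule measurable_coordinatewise_then_product)
      fix j
      show "(\<lambda>x. x j) \<in> borel_measurable (cube_measure s)"
      proof (cases "j \<in> {1..s}")
        case True
        thus ?thesis using measurable_cube_component[of j s "\<lambda>y. y"] by simp
      next
        case False
        have "(\<lambda>x. x j) \<in> borel_measurable (cube_measure s) \<longleftrightarrow> (\<lambda>x. undefined :: real) \<in> borel_measurable (cube_measure s)"
          by (rule measurable_cong) (use False in \<open>auto simp: unit_cube_def PiE_def extensional_def\<close>)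
        thus ?thesis by simp
      qed
    qed
  qed simp
qed

lemma compact_unit_cube: "compact (unit_cube s)"
proof -
  have eq: "unit_cube s = PiE UNIV (\<lambda>j. if j \<in> {1..s} then {0..1} else {undefined})"
    by (auto simp: unit_cube_def PiE_def extensional_def Pi_def split: if_splits)
  have "compactin (product_topology (\<lambda>_. euclidean) UNIV) (PiE UNIV (\<lambda>j::nat. if j \<in> {1..s} then {0..1::real} else {undefined}))"
    unfolding compactin_PiE by (auto simp: compactin_euclidean_iff)
  thus ?thesis unfolding eq euclidean_product_topology compactin_euclidean_iff .
qed

lemma continuous_on_bounded_cube:
  fixes F :: "(nat \<Rightarrow> real) \<Rightarrow> real"
  assumes "continuous_on (unit_cube s) F"
  obtains B where "0 \<le> B" "\<And>x. x \<in> unit_cube s \<Longrightarrow> \<bar>F x\<bar> \<le> B"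
proof -
  obtain B where B: "\<And>x. x \<in> unit_cube s \<Longrightarrow> norm (F x) \<le> B"
    using compact_imp_bounded[OF compact_continuous_image[OF assms compact_unit_cube]]
    unfolding bounded_iff by blast
  show thesis by (rule that[of "max B 0"]) (use B in \<open>force+\<close>)
qed

lemma unit_cubeD: "x \<in> unit_cube s \<Longrightarrow> j \<in> {1..s} \<Longrightarrow> x j \<in> {0..1}"
  by (auto simp: unit_cube_def)

lemma integrable_cube_tensor:
  fixes F :: "(nat \<Rightarrow> real) \<Rightarrow> real" and h :: "nat \<Rightarrow> real \<Rightarrow> complex"
  assumes F: "continuous_on (unit_cube s) F"
    and h: "\<And>j. j \<in> {1..s} \<Longrightarrow> h j \<in> borel_measurable borel"
    and B: "\<And>j y. j \<in> {1..s} \<Longrightarrow> y \<in> {0..1} \<Longrightarrow> norm (h j y) \<le> B j"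
  shows "integrable (cube_measure s) (\<lambda>x. of_real (F x) * (\<Prod>j\<in>{1..s}. h j (x j)))"
proof -
  obtain BF where BF: "0 \<le> BF" "\<And>x. x \<in> unit_cube s \<Longrightarrow> \<bar>F x\<bar> \<le> BF"
    using continuous_on_bounded_cube[OF F] by blast
  show ?thesis
  proof (rule cube.integrable_const_bound[where B = "BF * (\<Prod>j\<in>{1..s}. B j)"])
    show "AE x in cube_measure s. norm (of_real (F x) * (\<Prod>j\<in>{1..s}. h j (x j))) \<le> BF * (\<Prod>j\<in>{1..s}. B j)"
    proof (rule AE_I2)
      fix x assume "x \<in> space (cube_measure s)"
      hence x: "x \<in> unit_cube s" by simp
      show "norm (of_real (F x) * (\<Prod>j\<in>{1..s}. h j (x j))) \<le> BF * (\<Prod>j\<in>{1..s}. B j)"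
        unfolding norm_mult prod_norm[symmetric] norm_of_real
        using BF(2)[OF x] B unit_cubeD[OF x] BF(1) by (intro mult_mono prod_mono prod_nonneg) auto
    qed
    have [measurable]: "F \<in> borel_measurable (cube_measure s)" using F by (rule continuous_on_measurable_cube)
    have [measurable]: "(\<lambda>x. \<Prod>j\<in>{1..s}. h j (x j)) \<in> borel_measurable (cube_measure s)"
      using h by (intro borel_measurable_prod measurable_cube_component) auto
    show "(\<lambda>x. of_real (F x) * (\<Prod>j\<in>{1..s}. h j (x j))) \<in> borel_measurable (cube_measure s)"
      by measurable
  qed
qed

lemma smooth_derivs_chain:
  assumes D: "smooth_derivs s f D" and i: "i \<in> {1..s}" and x: "x \<in> PiE ({1..s} - {i}) (\<lambda>_. {0..1})"
  shows "deriv_chain (\<lambda>n y. D (\<alpha>(i := n)) (x(i := y)))"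
  unfolding deriv_chain_def
proof (intro allI ballI)
  fix n and y :: real assume y: "y \<in> {0..1}"
  have ins: "insert i ({1..s} - {i}) = {1..s}" using i by auto
  have "x(i := y) \<in> unit_cube s"
    using PiE_fun_upd[OF y x, where x = i] unfolding ins unit_cube_def .
  with D i have "((\<lambda>t. D (\<alpha>(i := n)) ((x(i := y))(i := t))) has_real_derivative
      D ((\<alpha>(i := n))(i := Suc ((\<alpha>(i := n)) i))) (x(i := y))) (at ((x(i := y)) i) within {0..1})"
    unfolding smooth_derivs_def by blast
  thus "((\<lambda>y. D (\<alpha>(i := n)) (x(i := y))) has_real_derivative D (\<alpha>(i := Suc n)) (x(i := y))) (at y within {0..1})"
    by simp
qed

text \<open>The coordinates are treated one at a time: \<open>J\<close> is the set of those already
  transformed, where the Walsh function has been traded for its kernel and the order of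
  differentiation raised to \<open>nzc\<close>. Fubini isolates the next coordinate, and the
  one-dimensional identity applies to its derivative chain.\<close>

lemma cube_walsh_transform:
  fixes k :: "nat \<Rightarrow> 'b::prime_card mod_ring poly"
  assumes D: "smooth_derivs s f D"
    and K: "\<And>j. j \<in> {1..s} \<Longrightarrow> K j \<in> borel_measurable borel"
    and KB: "\<And>j y. j \<in> {1..s} \<Longrightarrow> y \<in> {0..1} \<Longrightarrow> norm (K j y) \<le> B j"
    and Kg: "\<And>j g. j \<in> {1..s} \<Longrightarrow> deriv_chain g \<Longrightarrow>
       (\<integral>x. of_real (g 0 x) * wal (k j) x \<partial>lborel01) = (\<integral>x. of_real (g (nzc (k j)) x) * K j x \<partial>lborel01)"
  shows "(\<integral>x. of_real (f x) * (\<Prod>j\<in>{1..s}. wal (k j) (x j)) \<partial>cube_measure s) =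
         (\<integral>x. of_real (D (\<lambda>j. if j \<in> {1..s} then nzc (k j) else 0) x) * (\<Prod>j\<in>{1..s}. K j (x j)) \<partial>cube_measure s)"
proof -
  define \<alpha> where "\<alpha> = (\<lambda>J j. if j \<in> J then nzc (k j) else 0)"
  define h where "h = (\<lambda>J j. if j \<in> J then K j else wal (k j))"
  define T where "T = (\<lambda>J. \<integral>x. of_real (D (\<alpha> J) x) * (\<Prod>j\<in>{1..s}. h J j (x j)) \<partial>cube_measure s)"
  have cont: "continuous_on (unit_cube s) (D \<alpha>)" for \<alpha> using D by (simp add: smooth_derivs_def)
  have int: "integrable (cube_measure s) (\<lambda>x. of_real (D \<alpha> x) * (\<Prod>j\<in>{1..s}. h J j (x j)))" for \<alpha> J
    by (rule integrable_cube_tensor[OF cont, where B = "\<lambda>j. if j \<in> J then B j else 1"]) (use K KB in \<open>auto simp: h_def\<close>)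
  have "T J = T {}" if "J \<subseteq> {1..s}" for J
    using finite_subset[OF that finite_atLeastAtMost] that
  proof (induction J rule: finite_induct)
    case (insert i J)
    hence i: "i \<in> {1..s}" "i \<notin> J" by auto
    let ?I = "{1..s} - {i}"
    have ins: "insert i ?I = {1..s}" using i by auto
    have fub: "(\<integral>x. of_real (D \<gamma> x) * (\<Prod>j\<in>{1..s}. h L j (x j)) \<partial>cube_measure s) =
        (\<integral>x. (\<Prod>j\<in>?I. h L j (x j)) * (\<integral>y. of_real (D \<gamma> (x(i := y))) * h L i y \<partial>lborel01) \<partial>PiM ?I (\<lambda>_. lborel01))" for \<gamma> L
    proof -
      have "integrable (PiM (insert i ?I) (\<lambda>_. lborel01)) (\<lambda>x. of_real (D \<gamma> x) * (\<Prod>j\<in>{1..s}. h L j (x j)))"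
        using int[of \<gamma> L] unfolding ins cube_measure_eq .
      from unit_product.product_integral_insert[OF _ _ this]
      have "(\<integral>x. of_real (D \<gamma> x) * (\<Prod>j\<in>{1..s}. h L j (x j)) \<partial>cube_measure s) =
        (\<integral>x. (\<integral>y. of_real (D \<gamma> (x(i := y))) * (\<Prod>j\<in>{1..s}. h L j ((x(i := y)) j)) \<partial>lborel01) \<partial>PiM ?I (\<lambda>_. lborel01))"
        unfolding ins cube_measure_eq by simp
      also have "\<dots> = (\<integral>x. (\<integral>y. (\<Prod>j\<in>?I. h L j (x j)) * (of_real (D \<gamma> (x(i := y))) * h L i y) \<partial>lborel01) \<partial>PiM ?I (\<lambda>_. lborel01))"
      proof (intro Bochner_Integration.integral_cong refl)
        fix x y
        have "(\<Prod>j\<in>{1..s}. h L j ((x(i := y)) j)) = h L i y * (\<Prod>j\<in>?I. h L j ((x(i := y)) j))"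
          using i by (subst prod.remove[of _ i]) auto
        also have "(\<Prod>j\<in>?I. h L j ((x(i := y)) j)) = (\<Prod>j\<in>?I. h L j (x j))"
          by (intro prod.cong) auto
        finally show "of_real (D \<gamma> (x(i := y))) * (\<Prod>j\<in>{1..s}. h L j ((x(i := y)) j)) =
          (\<Prod>j\<in>?I. h L j (x j)) * (of_real (D \<gamma> (x(i := y))) * h L i y)"
          by (simp add: mult_ac)
      qed
      finally show ?thesis by (simp only: integral_mult_right_zero)
    qed
    have "T (insert i J) = T J"
      unfolding T_def fub
    proof (intro Bochner_Integration.integral_cong refl)
      fix x assume "x \<in> space (PiM ?I (\<lambda>_. lborel01))"
      hence x: "x \<in> PiE ?I (\<lambda>_. {0..1})" by (simp add: space_PiM)
      have upd: "(\<alpha> J)(i := 0) = \<alpha> J" "(\<alpha> J)(i := nzc (k i)) = \<alpha> (insert i J)"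
        using i by (auto simp: \<alpha>_def)
      have swap: "(\<integral>y. of_real (D (\<alpha> J) (x(i := y))) * wal (k i) y \<partial>lborel01) =
         (\<integral>y. of_real (D (\<alpha> (insert i J)) (x(i := y))) * K i y \<partial>lborel01)"
        using Kg[OF i(1) smooth_derivs_chain[OF D i(1) x, of "\<alpha> J"]] unfolding upd .
      have hi: "h (insert i J) i = K i" "h J i = wal (k i)" using i by (auto simp: h_def)
      have "(\<Prod>j\<in>?I. h (insert i J) j (x j)) = (\<Prod>j\<in>?I. h J j (x j))"
        by (intro prod.cong) (auto simp: h_def)
      thus "(\<Prod>j\<in>?I. h (insert i J) j (x j)) * (\<integral>y. of_real (D (\<alpha> (insert i J)) (x(i := y))) * h (insert i J) i y \<partial>lborel01) =
         (\<Prod>j\<in>?I. h J j (x j)) * (\<integral>y. of_real (D (\<alpha> J) (x(i := y))) * h J i y \<partial>lborel01)"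
        by (simp only: hi swap)
    qed
    with insert show ?case by simp
  qed simp
  from this[OF order_refl] have "T {1..s} = T {}" .
  moreover have "T {} = (\<integral>x. of_real (f x) * (\<Prod>j\<in>{1..s}. wal (k j) (x j)) \<partial>cube_measure s)"
    unfolding T_def
  proof (rule Bochner_Integration.integral_cong[OF refl])
    fix x assume "x \<in> space (cube_measure s)"
    hence "D (\<lambda>_. 0) x = f x" using D by (simp add: smooth_derivs_def)
    thus "of_real (D (\<alpha> {}) x) * (\<Prod>j\<in>{1..s}. h {} j (x j)) = of_real (f x) * (\<Prod>j\<in>{1..s}. wal (k j) (x j))"
      by (simp add: \<alpha>_def h_def)
  qed
  moreover have "T {1..s} = (\<integral>x. of_real (D (\<lambda>j. if j \<in> {1..s} then nzc (k j) else 0) x) * (\<Prod>j\<in>{1..s}. K j (x j)) \<partial>cube_measure s)"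
    unfolding T_def \<alpha>_def
    by (intro Bochner_Integration.integral_cong refl arg_cong2[of _ _ _ _ "(*)"] prod.cong) (auto simp: h_def)
  ultimately show ?thesis by simp
qed

definition walsh_coeff :: "nat \<Rightarrow> ((nat \<Rightarrow> real) \<Rightarrow> real) \<Rightarrow> (nat \<Rightarrow> 'b::prime_card mod_ring poly) \<Rightarrow> complex" where
  "walsh_coeff s f k = (\<integral>x. of_real (f x) * (\<Prod>j\<in>{1..s}. wal (k j) (x j)) \<partial>cube_measure s)"

text \<open>The kernels are chosen before f, depending on k only. The same representation is thus
  available for functions of the unit ball and for constants.\<close>

lemma walsh_coeff_kernel:
  fixes k :: "nat \<Rightarrow> 'b::prime_card mod_ring poly"
  assumes b3: "3 \<le> CARD('b)"
  shows "\<exists>K. (\<forall>j. K j \<in> borel_measurable borel) \<and>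
    (\<forall>j. \<forall>y\<in>{0..1}. norm (K j y) \<le> real CARD('b) powr (- mu 0 (k j)) * (C_b CARD('b) / m_b CARD('b)) ^ nzc (k j)) \<and>
    (\<forall>f D. smooth_derivs s f D \<longrightarrow> walsh_coeff s f k =
       (\<integral>x. of_real (D (\<lambda>j. if j \<in> {1..s} then nzc (k j) else 0) x) * (\<Prod>j\<in>{1..s}. K j (x j)) \<partial>cube_measure s))"
proof -
  let ?B = "\<lambda>j. real CARD('b) powr (- mu 0 (k j)) * (C_b CARD('b) / m_b CARD('b)) ^ nzc (k j)"
  have "\<forall>j. \<exists>K. K \<in> borel_measurable borel \<and> (\<forall>x\<in>{0..1}. norm (K x) \<le> ?B j) \<and>
    (\<forall>g. deriv_chain g \<longrightarrow> (\<integral>x. of_real (g 0 x) * wal (k j) x \<partial>lborel01) = (\<integral>x. of_real (g (nzc (k j)) x) * K x \<partial>lborel01))"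
    using walsh_kernel_exists[OF b3] by (intro allI)
  from choice[OF this] obtain K where K: "\<forall>j. K j \<in> borel_measurable borel \<and> (\<forall>x\<in>{0..1}. norm (K j x) \<le> ?B j) \<and>
    (\<forall>g. deriv_chain g \<longrightarrow> (\<integral>x. of_real (g 0 x) * wal (k j) x \<partial>lborel01) = (\<integral>x. of_real (g (nzc (k j)) x) * K j x \<partial>lborel01))" ..
  have 1: "K j \<in> borel_measurable borel" for j using K by simp
  have 2: "norm (K j y) \<le> ?B j" if "y \<in> {0..1}" for j y using K that by simp
  have 3: "(\<integral>x. of_real (g 0 x) * wal (k j) x \<partial>lborel01) = (\<integral>x. of_real (g (nzc (k j)) x) * K j x \<partial>lborel01)"
    if "deriv_chain g" for g j using K that by blast
  show ?thesis
  proof (intro exI[of _ K] conjI allI ballI impI)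
    fix f D assume "smooth_derivs s f D"
    thus "walsh_coeff s f k =
       (\<integral>x. of_real (D (\<lambda>j. if j \<in> {1..s} then nzc (k j) else 0) x) * (\<Prod>j\<in>{1..s}. K j (x j)) \<partial>cube_measure s)"
      unfolding walsh_coeff_def by (rule cube_walsh_transform[OF _ 1 2 3])
  qed (rule 1, rule 2)
qed

text \<open>In coordinate j the kernel gives (C_b/m_b)^v and the norm gives u_j^v, where v is the
  number of nonzero digits; their product is b^(-v a_j), which shifts \<open>mu 0\<close> to
  \<open>mu (a j)\<close>.\<close>

lemma norm_walsh_coeff_le:
  fixes k :: "nat \<Rightarrow> 'b::prime_card mod_ring poly" and u :: "nat \<Rightarrow> real"
  assumes b3: "3 \<le> CARD('b)" and f: "in_unit_ball s u f" and u: "\<And>j. j \<in> {1..s} \<Longrightarrow> 0 < u j"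
  shows "norm (walsh_coeff s f k) \<le>
    real CARD('b) powr (- muv s (\<lambda>j. - log (real CARD('b)) (C_b CARD('b) / m_b CARD('b) * u j)) k)"
proof -
  let ?b = "real CARD('b)"
  define c where "c = C_b CARD('b) / m_b CARD('b)"
  define a where "a = (\<lambda>j. - log ?b (c * u j))"
  have m: "m_b CARD('b) > 0" using b3 by (intro m_b_pos) auto
  have M: "0 \<le> M_b CARD('b)" using norm_chi_minus_1_le_M_b[of "0 :: 'b mod_ring"] by simp
  have c: "c > 0" using M_b_plus_m_b_le_C_b(2)[OF b3 M] m by (simp add: c_def)
  obtain K where K: "(\<forall>j. K j \<in> borel_measurable borel) \<and>
    (\<forall>j. \<forall>y\<in>{0..1}. norm (K j y) \<le> ?b powr (- mu 0 (k j)) * c ^ nzc (k j)) \<and>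
    (\<forall>f D. smooth_derivs s f D \<longrightarrow> walsh_coeff s f k =
       (\<integral>x. of_real (D (\<lambda>j. if j \<in> {1..s} then nzc (k j) else 0) x) * (\<Prod>j\<in>{1..s}. K j (x j)) \<partial>cube_measure s))"
    using walsh_coeff_kernel[OF b3, of k s, folded c_def] ..
  have KB: "norm (K j y) \<le> ?b powr (- mu 0 (k j)) * c ^ nzc (k j)" if "y \<in> {0..1}" for j y
    using K that by simp
  define \<alpha> where "\<alpha> = (\<lambda>j. if j \<in> {1..s} then nzc (k j) else 0)"
  obtain D where D: "smooth_derivs s f D"
    and all: "\<forall>\<alpha>. (\<forall>j. j \<notin> {1..s} \<longrightarrow> \<alpha> j = 0) \<longrightarrow>
      (\<Prod>j\<in>{1..s}. u j powr (- real (\<alpha> j))) * (\<integral>x. \<bar>D \<alpha> x\<bar> \<partial>cube_measure s) \<le> 1"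
    using f unfolding in_unit_ball_def by blast
  have ball: "(\<Prod>j\<in>{1..s}. u j powr (- real (\<alpha> j))) * (\<integral>x. \<bar>D \<alpha> x\<bar> \<partial>cube_measure s) \<le> 1"
    by (rule all[THEN spec[where x = \<alpha>], THEN mp]) (simp add: \<alpha>_def)
  define P where "P = (\<Prod>j\<in>{1..s}. ?b powr (- mu 0 (k j)) * c ^ nzc (k j))"
  have cont: "continuous_on (unit_cube s) (D \<alpha>)" using D by (simp add: smooth_derivs_def)
  have "norm (walsh_coeff s f k) \<le> (\<integral>x. norm (of_real (D \<alpha> x) * (\<Prod>j\<in>{1..s}. K j (x j))) \<partial>cube_measure s)"
    using K D unfolding \<alpha>_def by (auto intro: integral_norm_bound)
  also have "\<dots> \<le> (\<integral>x. \<bar>D \<alpha> x\<bar> * P \<partial>cube_measure s)"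
  proof (rule integral_mono')
    have "integrable (cube_measure s) (D \<alpha>)"
      using integrable_cube_tensor[OF cont, of "\<lambda>_ _. 1" "\<lambda>_. 1"] by (simp add: complex_of_real_integrable_eq)
    thus "integrable (cube_measure s) (\<lambda>x. \<bar>D \<alpha> x\<bar> * P)" by simp
    fix x assume "x \<in> space (cube_measure s)"
    hence x: "x \<in> unit_cube s" by simp
    have "norm (\<Prod>j\<in>{1..s}. K j (x j)) \<le> P"
      unfolding P_def prod_norm[symmetric] using KB unit_cubeD[OF x] by (intro prod_mono) auto
    thus "norm (of_real (D \<alpha> x) * (\<Prod>j\<in>{1..s}. K j (x j))) \<le> \<bar>D \<alpha> x\<bar> * P"
      unfolding norm_mult norm_of_real by (intro mult_left_mono) auto
    have "0 \<le> P" unfolding P_def using c by (intro prod_nonneg) auto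
    thus "0 \<le> \<bar>D \<alpha> x\<bar> * P" by simp
  qed
  also have "\<dots> = P * (\<integral>x. \<bar>D \<alpha> x\<bar> \<partial>cube_measure s)" by simp
  also have "\<dots> \<le> P * (\<Prod>j\<in>{1..s}. u j powr real (\<alpha> j))"
  proof (rule mult_left_mono)
    have "(\<Prod>j\<in>{1..s}. u j powr (- real (\<alpha> j))) * (\<Prod>j\<in>{1..s}. u j powr real (\<alpha> j)) = (\<Prod>j\<in>{1..s}. 1)"
      unfolding prod.distrib[symmetric]
    proof (rule prod.cong[OF refl])
      fix j assume "j \<in> {1..s}"
      from u[OF this] show "u j powr (- real (\<alpha> j)) * u j powr real (\<alpha> j) = 1" by (simp flip: powr_add)
    qed
    moreover have "0 < (\<Prod>j\<in>{1..s}. u j powr real (\<alpha> j))"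
    proof (rule prod_pos)
      fix j assume "j \<in> {1..s}"
      from u[OF this] show "0 < u j powr real (\<alpha> j)" by simp
    qed
    ultimately show "(\<integral>x. \<bar>D \<alpha> x\<bar> \<partial>cube_measure s) \<le> (\<Prod>j\<in>{1..s}. u j powr real (\<alpha> j))"
      using mult_right_mono[OF ball, of "\<Prod>j\<in>{1..s}. u j powr real (\<alpha> j)"]
      by (simp add: mult.assoc mult.left_commute)
    show "0 \<le> P" unfolding P_def using c by (intro prod_nonneg) auto
  qed
  also have "\<dots> = (\<Prod>j\<in>{1..s}. ?b powr (- mu (a j) (k j)))"
    unfolding P_def prod.distrib[symmetric]
  proof (rule prod.cong[OF refl])
    fix j assume j: "j \<in> {1..s}"
    have "c ^ nzc (k j) * u j powr real (\<alpha> j) = (c * u j) ^ nzc (k j)"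
      using j u[OF j] by (simp add: \<alpha>_def powr_realpow power_mult_distrib)
    also have "\<dots> = (?b powr (- a j)) ^ nzc (k j)" using c u[OF j] b3 by (simp add: a_def)
    also have "\<dots> = ?b powr (- (real (nzc (k j)) * a j))" by (simp add: powr_power mult.commute)
    finally show "?b powr (- mu 0 (k j)) * c ^ nzc (k j) * u j powr real (\<alpha> j) = ?b powr (- mu (a j) (k j))"
      by (subst mu_eq) (simp add: powr_add[symmetric] mult.assoc)
  qed
  also have "\<dots> = ?b powr (- muv s a k)"
    using b3 by (simp add: muv_def powr_sum sum_negf[symmetric] flip: sum_negf)
  finally show ?thesis by (simp add: a_def c_def)
qed

lemma smooth_derivs_const: "smooth_derivs s (\<lambda>_. c) (\<lambda>\<alpha> _. if \<alpha> = (\<lambda>_. 0) then c else 0)"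
proof -
  have "\<alpha>(j := Suc (\<alpha> j)) \<noteq> (\<lambda>_. 0)" for \<alpha> :: "nat \<Rightarrow> nat" and j
    by (metis fun_upd_same nat.distinct(1))
  thus ?thesis by (auto simp: smooth_derivs_def)
qed

text \<open>Orthogonality to constants is read off the kernel representation: for a nonzero index
  the derivative involved has a nonzero order, and all such derivatives of a constant
  vanish.\<close>

lemma walsh_coeff_const:
  fixes k :: "nat \<Rightarrow> 'b::prime_card mod_ring poly"
  assumes b3: "3 \<le> CARD('b)"
  shows "walsh_coeff s (\<lambda>_. c) k = (if \<forall>j\<in>{1..s}. k j = 0 then of_real c else 0)"
proof (cases "\<forall>j\<in>{1..s}. k j = 0")
  case True
  hence "walsh_coeff s (\<lambda>_. c) k = (\<integral>x. of_real c \<partial>cube_measure s)"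
    unfolding walsh_coeff_def by (intro Bochner_Integration.integral_cong) auto
  thus ?thesis using True cube.prob_space by simp
next
  case False
  then obtain j where j: "j \<in> {1..s}" "k j \<noteq> 0" by blast
  define \<alpha> where "\<alpha> = (\<lambda>j. if j \<in> {1..s} then nzc (k j) else 0)"
  have "\<alpha> j \<noteq> 0" using j by (simp add: \<alpha>_def)
  hence neq: "(\<alpha> = (\<lambda>_. 0)) = False" by auto
  have "walsh_coeff s (\<lambda>_. c) k = 0"
  proof -
    obtain K where K: "(\<forall>j. K j \<in> borel_measurable borel) \<and>
      (\<forall>j. \<forall>y\<in>{0..1}. norm (K j y) \<le> real CARD('b) powr (- mu 0 (k j)) * (C_b CARD('b) / m_b CARD('b)) ^ nzc (k j)) \<and>
      (\<forall>f D. smooth_derivs s f D \<longrightarrow> walsh_coeff s f k =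
         (\<integral>x. of_real (D \<alpha> x) * (\<Prod>j\<in>{1..s}. K j (x j)) \<partial>cube_measure s))"
      using walsh_coeff_kernel[OF b3, of k s, folded \<alpha>_def] ..
    hence "walsh_coeff s (\<lambda>_. c) k =
        (\<integral>x. of_real (if \<alpha> = (\<lambda>_. 0) then c else 0) * (\<Prod>j\<in>{1..s}. K j (x j)) \<partial>cube_measure s)"
      using smooth_derivs_const[of s c] by blast
    thus ?thesis unfolding neq by simp
  qed
  thus ?thesis by (subst if_not_P[OF False])
qed

section \<open>The Walsh expansion and the quadrature error\<close>

lemma to_int_mod_ring_bounds: "0 \<le> to_int_mod_ring c" "to_int_mod_ring (c :: 'b::prime_card mod_ring) \<le> int CARD('b) - 1"
proof -
  have "to_int_mod_ring c \<in> {0..<int CARD('b)}" unfolding range_to_int_mod_ring[symmetric] by simp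
  thus "0 \<le> to_int_mod_ring c" "to_int_mod_ring c \<le> int CARD('b) - 1" by simp_all
qed

lemma floor_digits:
  assumes x: "0 \<le> x" "x < 1"
  shows "real_of_int \<lfloor>real CARD('b::prime_card) ^ n * x\<rfloor> / real CARD('b) ^ n =
     (\<Sum>i<n. real_of_int (to_int_mod_ring (dig i x :: 'b mod_ring)) / real CARD('b) ^ Suc i)"
proof (induction n)
  case 0
  have "\<lfloor>x\<rfloor> = 0" using x by linarith
  thus ?case by simp
next
  case (Suc n)
  let ?b = "real CARD('b)"
  have b: "?b > 0" by simp
  have "\<lfloor>?b ^ Suc n * x\<rfloor> div int CARD('b) = \<lfloor>?b ^ Suc n * x / real_of_int (int CARD('b))\<rfloor>"
    by (rule floor_divide_real_eq_div[symmetric]) simp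
  also have "?b ^ Suc n * x / real_of_int (int CARD('b)) = ?b ^ n * x" using b by simp
  finally have "\<lfloor>?b ^ Suc n * x\<rfloor> = int CARD('b) * \<lfloor>?b ^ n * x\<rfloor> + to_int_mod_ring (dig n x :: 'b mod_ring)"
    by (metis dig_def div_mult_mod_eq mult.commute to_int_mod_ring_of_int)
  hence "real_of_int \<lfloor>?b ^ Suc n * x\<rfloor> = ?b * real_of_int \<lfloor>?b ^ n * x\<rfloor> + real_of_int (to_int_mod_ring (dig n x :: 'b mod_ring))"
    by (simp only: of_int_add of_int_mult of_int_of_nat_eq)
  hence "real_of_int \<lfloor>?b ^ Suc n * x\<rfloor> / ?b ^ Suc n = real_of_int \<lfloor>?b ^ n * x\<rfloor> / ?b ^ n + real_of_int (to_int_mod_ring (dig n x :: 'b mod_ring)) / ?b ^ Suc n"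
    using b by (simp add: add_divide_distrib)
  thus ?case by (simp only: Suc sum.lessThan_Suc)
qed

text \<open>The sequence may end in repeated digits b-1, and then \<open>dig\<close> of the value
  differs from it. Hence the value is only compared with numbers that share its first n
  terms.\<close>

definition digit_value :: "(nat \<Rightarrow> 'b::prime_card mod_ring) \<Rightarrow> real" where
  "digit_value z = (\<Sum>i. real_of_int (to_int_mod_ring (z i)) / real CARD('b) ^ Suc i)"

lemma digit_value_tail:
  fixes z :: "nat \<Rightarrow> 'b::prime_card mod_ring"
  defines "q \<equiv> (\<lambda>n. \<Sum>i<n. real_of_int (to_int_mod_ring (z i)) / real CARD('b) ^ Suc i)"
  shows "q n \<le> digit_value z" "digit_value z \<le> q n + 1 / real CARD('b) ^ n"
proof -
  let ?b = "real CARD('b)"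
  have b: "?b > 1" using prime_gt_1_nat[OF prime_card[where 'a='b]] by simp
  define d where "d = (\<lambda>i. real_of_int (to_int_mod_ring (z i)) / ?b ^ Suc i)"
  have d: "0 \<le> d i" "d i \<le> (?b - 1) / ?b ^ Suc i" for i
  proof -
    have "real_of_int (to_int_mod_ring (z i)) \<le> real_of_int (int CARD('b) - 1)"
      using to_int_mod_ring_bounds(2)[of "z i"] by (simp only: of_int_le_iff)
    thus "d i \<le> (?b - 1) / ?b ^ Suc i" unfolding d_def by (intro divide_right_mono) auto
    show "0 \<le> d i" unfolding d_def using to_int_mod_ring_bounds(1)[of "z i"] by (intro divide_nonneg_nonneg) auto
  qed
  have geo: "(\<lambda>i. (?b - 1) / ?b ^ Suc (i + n)) sums (1 / ?b ^ n)" for n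
  proof -
    have "(\<lambda>i. (1 / ?b) ^ i) sums (1 / (1 - 1 / ?b))" using b by (intro geometric_sums) auto
    hence "(\<lambda>i. (?b - 1) / ?b ^ Suc n * (1 / ?b) ^ i) sums ((?b - 1) / ?b ^ Suc n * (1 / (1 - 1 / ?b)))"
      by (rule sums_mult)
    moreover have "(?b - 1) / ?b ^ Suc n * (1 / (1 - 1 / ?b)) = 1 / ?b ^ n" using b by (simp add: field_simps)
    moreover have "(?b - 1) / ?b ^ Suc n * (1 / ?b) ^ i = (?b - 1) / ?b ^ Suc (i + n)" for i
      by (simp add: power_add power_divide mult_ac)
    ultimately show ?thesis by simp
  qed
  have summ: "summable d"
    by (rule summable_comparison_test'[OF sums_summable[OF geo[of 0]], of 0]) (use d in auto)
  have split: "digit_value z = (\<Sum>i. d (i + n)) + q n"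
    unfolding digit_value_def q_def using suminf_split_initial_segment[OF summ, of n] by (simp add: d_def)
  have summ': "summable (\<lambda>i. d (i + n))" using summ by (rule summable_ignore_initial_segment)
  have "0 \<le> (\<Sum>i. d (i + n))" using d by (intro suminf_nonneg summ') auto
  thus "q n \<le> digit_value z" using split by simp
  have "(\<Sum>i. d (i + n)) \<le> (\<Sum>i. (?b - 1) / ?b ^ Suc (i + n))"
    using d by (intro suminf_le summ' sums_summable[OF geo]) auto
  thus "digit_value z \<le> q n + 1 / ?b ^ n" using split sums_unique[OF geo[of n]] by simp
qed

lemma digit_value_bounds: "digit_value z \<in> {0..1}"
  using digit_value_tail[where n = 0 and z = z] by simp

text \<open>Both numbers lie in the closed interval of length b^(-n) that starts at the common
  truncation.\<close>

lemma digit_value_close: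
  fixes z :: "nat \<Rightarrow> 'b::prime_card mod_ring"
  assumes x: "0 \<le> x" "x < 1" and eq: "\<And>i. i < n \<Longrightarrow> dig i x = z i"
  shows "\<bar>x - digit_value z\<bar> \<le> 1 / real CARD('b) ^ n"
proof -
  let ?b = "real CARD('b)"
  define q where "q = (\<Sum>i<n. real_of_int (to_int_mod_ring (z i)) / ?b ^ Suc i)"
  have q: "real_of_int \<lfloor>?b ^ n * x\<rfloor> / ?b ^ n = q"
    unfolding floor_digits[OF x] q_def using eq by (intro sum.cong) auto
  have pos: "?b ^ n > 0" by simp
  have "real_of_int \<lfloor>?b ^ n * x\<rfloor> \<le> ?b ^ n * x" "?b ^ n * x \<le> real_of_int \<lfloor>?b ^ n * x\<rfloor> + 1"
    by linarith+
  hence "q \<le> x" "x \<le> q + 1 / ?b ^ n" using pos by (simp_all add: q[symmetric] field_simps)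
  thus ?thesis using digit_value_tail[where n = n and z = z, folded q_def] unfolding abs_le_iff by linarith
qed

text \<open>The Dirichlet kernel of the Walsh system: the normalised indicator of the b-adic box
  with the prescribed first n digits in every coordinate.\<close>

lemma sum_chi_wal:
  fixes z :: "nat \<Rightarrow> nat \<Rightarrow> 'b::prime_card mod_ring"
  shows "(\<Sum>k\<in>PiE {1..s} (\<lambda>_. polys n). (\<Prod>j\<in>{1..s}. chi (\<Sum>i<n. coeff (k j) i * z j i)) * (\<Prod>j\<in>{1..s}. wal (k j) (x j))) =
    of_real (\<Prod>j\<in>{1..s}. if \<forall>i<n. dig i (x j) = z j i then real CARD('b) ^ n else 0)"
proof -
  have "(\<Sum>k\<in>PiE {1..s} (\<lambda>_. polys n). (\<Prod>j\<in>{1..s}. chi (\<Sum>i<n. coeff (k j) i * z j i)) * (\<Prod>j\<in>{1..s}. wal (k j) (x j))) =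
    (\<Sum>k\<in>PiE {1..s} (\<lambda>_. polys n). \<Prod>j\<in>{1..s}. chi (\<Sum>i<n. coeff (k j) i * (z j i - dig i (x j))))"
    unfolding prod.distrib[symmetric]
  proof (intro sum.cong prod.cong refl)
    fix k j assume "k \<in> PiE {1..s} (\<lambda>_. polys n :: 'b mod_ring poly set)" "j \<in> {1..s}"
    hence "k j \<in> polys n" by auto
    thus "chi (\<Sum>i<n. coeff (k j) i * z j i) * wal (k j) (x j) = chi (\<Sum>i<n. coeff (k j) i * (z j i - dig i (x j)))"
      by (simp add: wal_eq right_diff_distrib sum_subtractf flip: chi_add)
  qed
  also have "\<dots> = (\<Prod>j\<in>{1..s}. \<Sum>k\<in>polys n. chi (\<Sum>i<n. coeff k i * (z j i - dig i (x j))))"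
    by (rule prod_sum_PiE[symmetric]) auto
  also have "\<dots> = (\<Prod>j\<in>{1..s}. if \<forall>i<n. z j i - dig i (x j) = 0 then of_nat CARD('b) ^ n else 0)"
    unfolding sum_polys_chi ..
  also have "\<dots> = of_real (\<Prod>j\<in>{1..s}. if \<forall>i<n. dig i (x j) = z j i then real CARD('b) ^ n else 0)"
  proof -
    have "(\<forall>i<n. z j i - dig i (x j) = 0) \<longleftrightarrow> (\<forall>i<n. dig i (x j) = z j i)" for j
      by (metis right_minus_eq)
    thus ?thesis unfolding of_real_prod by (intro prod.cong refl) simp
  qed
  finally show ?thesis .
qed

text \<open>A sequence of counterexamples would converge to v in every coordinate, hence in the
  product topology, and continuity would be violated along it.\<close>

lemma continuous_cube_uniform:
  fixes f :: "(nat \<Rightarrow> real) \<Rightarrow> real" and r :: "nat \<Rightarrow> real"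
  assumes f: "continuous_on (unit_cube s) f" and v: "v \<in> unit_cube s" and r: "r \<longlonglongrightarrow> 0" and e: "0 < e"
  shows "\<exists>N. \<forall>n\<ge>N. \<forall>x\<in>unit_cube s. (\<forall>j\<in>{1..s}. \<bar>x j - v j\<bar> \<le> r n) \<longrightarrow> \<bar>f x - f v\<bar> \<le> e"
proof (rule ccontr)
  assume "\<not> ?thesis"
  hence "\<forall>N. \<exists>n x. n \<ge> N \<and> x \<in> unit_cube s \<and> (\<forall>j\<in>{1..s}. \<bar>x j - v j\<bar> \<le> r n) \<and> \<not> \<bar>f x - f v\<bar> \<le> e"
    by blast
  then obtain n x where nx: "\<And>N. n N \<ge> N" "\<And>N. x N \<in> unit_cube s" "\<And>N j. j \<in> {1..s} \<Longrightarrow> \<bar>x N j - v j\<bar> \<le> r (n N)"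
    "\<And>N. \<not> \<bar>f (x N) - f v\<bar> \<le> e"
    by metis
  have rn: "(\<lambda>N. r (n N)) \<longlonglongrightarrow> 0"
  proof (rule filterlim_compose[OF r])
    show "filterlim n at_top sequentially"
      by (rule filterlim_at_top_mono[OF filterlim_ident]) (use nx(1) in auto)
  qed
  have comp: "(\<lambda>N. x N j) \<longlonglongrightarrow> v j" for j
  proof (cases "j \<in> {1..s}")
    case True
    have "(\<lambda>N. x N j - v j) \<longlonglongrightarrow> 0"
      by (rule Lim_null_comparison[OF _ rn]) (use nx(3)[OF True] in auto)
    thus ?thesis by (rule LIM_zero_cancel)
  next
    case False
    have "x N j = v j" for N using nx(2)[of N] v False by (auto simp: unit_cube_def PiE_def extensional_def)
    thus ?thesis by simp
  qed
  have "limitin (product_topology (\<lambda>_. euclidean) UNIV) x v sequentially"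
    unfolding limitin_componentwise using comp by (auto simp: limitin_canonical_iff)
  hence "x \<longlonglongrightarrow> v" by (simp add: euclidean_product_topology limitin_canonical_iff)
  hence "(\<lambda>N. f (x N)) \<longlonglongrightarrow> f v"
    using f v nx(2) by (intro continuous_on_tendsto_compose[OF f]) auto
  from tendstoD[OF this e] obtain N where "dist (f (x N)) (f v) < e"
    by (auto simp: eventually_sequentially)
  thus False using nx(4)[of N] by (simp add: dist_real_def)
qed

lemma finite_PiE_polys [simp]: "finite I \<Longrightarrow> finite (PiE I (\<lambda>_. polys n :: 'b::prime_card mod_ring poly set))"
  by (intro finite_PiE) auto

lemma zero_restrict_in_PiE_polys: "(\<lambda>j\<in>{1..s::nat}. 0) \<in> PiE {1..s} (\<lambda>_. polys n)"
  by simp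

lemma PiE_eq_zero_iff:
  assumes "k \<in> PiE {1..s::nat} A"
  shows "k = (\<lambda>j\<in>{1..s}. 0) \<longleftrightarrow> (\<forall>j\<in>{1..s}. k j = 0)"
  using assms by (auto simp: fun_eq_iff PiE_def extensional_def)

text \<open>The partial sum is the integral of f against the box kernel \<open>S\<close>, which is
  nonnegative, has mass 1 and lives, up to a null set, within distance b^(-n) of v in each
  coordinate. Absolute convergence of the series is not involved.\<close>

lemma walsh_expansion:
  fixes z :: "nat \<Rightarrow> nat \<Rightarrow> 'b::prime_card mod_ring" and f :: "(nat \<Rightarrow> real) \<Rightarrow> real"
  assumes b3: "3 \<le> CARD('b)" and f: "continuous_on (unit_cube s) f" and e: "0 < e"
  defines "v \<equiv> restrict (\<lambda>j. digit_value (z j)) {1..s}"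
  shows "\<exists>N. \<forall>n\<ge>N. norm ((\<Sum>k\<in>PiE {1..s} (\<lambda>_. polys n). (\<Prod>j\<in>{1..s}. chi (\<Sum>i<n. coeff (k j) i * z j i)) * walsh_coeff s f k)
     - of_real (f v)) \<le> e"
proof -
  let ?b = "real CARD('b)"
  have "digit_value (z j) \<in> {0..1}" for j by (rule digit_value_bounds)
  hence v: "v \<in> unit_cube s" by (simp add: v_def unit_cube_def)
  have b1: "?b > 1" using b3 by simp
  have "(\<lambda>n. (1 / ?b) ^ n) \<longlonglongrightarrow> 0" using b1 by (intro LIMSEQ_power_zero) auto
  hence r: "(\<lambda>n. 1 / ?b ^ n) \<longlonglongrightarrow> 0" by (simp add: power_divide)
  obtain N where N: "\<And>n x. n \<ge> N \<Longrightarrow> x \<in> unit_cube s \<Longrightarrow> (\<And>j. j \<in> {1..s} \<Longrightarrow> \<bar>x j - v j\<bar> \<le> 1 / ?b ^ n) \<Longrightarrow> \<bar>f x - f v\<bar> \<le> e"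
    using continuous_cube_uniform[OF f v r e] by blast
  show ?thesis
  proof (intro exI[of _ N] allI impI)
    fix n assume n: "n \<ge> N"
    define S where "S = (\<lambda>x. \<Prod>j\<in>{1..s}. if \<forall>i<n. dig i (x j) = z j i then ?b ^ n else 0)"
    define c where "c = (\<lambda>k. \<Prod>j\<in>{1..s}. chi (\<Sum>i<n. coeff (k j) i * z j i))"
    let ?A = "PiE {1..s} (\<lambda>_. polys n :: 'b mod_ring poly set)"
    have S0: "0 \<le> S x" for x unfolding S_def by (intro prod_nonneg) auto
    have int_k: "integrable (cube_measure s) (\<lambda>x. of_real (F x) * (\<Prod>j\<in>{1..s}. wal (k j) (x j)))"
      if "continuous_on (unit_cube s) F" for F and k :: "nat \<Rightarrow> 'b mod_ring poly"
      using that by (rule integrable_cube_tensor[where B = "\<lambda>_. 1"]) auto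
    have expand: "(\<lambda>x. of_real (F x) * of_real (S x)) = (\<lambda>x. \<Sum>k\<in>?A. c k * (of_real (F x) * (\<Prod>j\<in>{1..s}. wal (k j) (x j))))" for F :: "_ \<Rightarrow> real"
      unfolding S_def c_def sum_chi_wal[symmetric] by (simp add: sum_distrib_left mult_ac)
    have int: "integrable (cube_measure s) (\<lambda>x. of_real (F x) * (of_real (S x) :: complex))"
      and val: "(\<integral>x. of_real (F x) * (of_real (S x) :: complex) \<partial>cube_measure s) = (\<Sum>k\<in>?A. c k * walsh_coeff s F k)"
      if F: "continuous_on (unit_cube s) F" for F
    proof -
      show "integrable (cube_measure s) (\<lambda>x. of_real (F x) * (of_real (S x) :: complex))"
        unfolding expand by (intro Bochner_Integration.integrable_sum integrable_mult_right int_k[OF F])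
      show "(\<integral>x. of_real (F x) * (of_real (S x) :: complex) \<partial>cube_measure s) = (\<Sum>k\<in>?A. c k * walsh_coeff s F k)"
        unfolding expand walsh_coeff_def
        by (subst Bochner_Integration.integral_sum) (intro integrable_mult_right int_k[OF F], simp)
    qed
    \<comment> \<open>The mass of \<open>S\<close> comes from its Walsh sum, where a constant leaves
      only the zero index; the volume of the box need not be computed.\<close>
    have const: "(\<integral>x. of_real a * (of_real (S x) :: complex) \<partial>cube_measure s) = of_real a" for a
    proof -
      have "(\<integral>x. of_real a * (of_real (S x) :: complex) \<partial>cube_measure s) = (\<Sum>k\<in>?A. c k * walsh_coeff s (\<lambda>_. a) k)"
        by (rule val) simp
      also have "\<dots> = (\<Sum>k\<in>?A. if k = (\<lambda>j\<in>{1..s}. 0) then of_real a else 0)"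
      proof (rule sum.cong[OF refl])
        fix k assume "k \<in> ?A"
        show "c k * walsh_coeff s (\<lambda>_. a) k = (if k = (\<lambda>j\<in>{1..s}. 0) then of_real a else 0)"
          unfolding walsh_coeff_const[OF b3] PiE_eq_zero_iff[OF \<open>k \<in> ?A\<close>] by (auto simp: c_def)
      qed
      also have "\<dots> = of_real a"
        unfolding sum.delta[OF finite_PiE_polys[OF finite_atLeastAtMost]] by (simp only: zero_restrict_in_PiE_polys if_True)
      finally show ?thesis .
    qed
    have ae: "AE x in cube_measure s. \<forall>j\<in>{1..s}. x j \<noteq> 1"
    proof (rule AE_finite_allI)
      fix j assume "j \<in> {1..s}"
      thus "AE x in cube_measure s. x j \<noteq> 1" unfolding cube_measure_eq
        by (intro AE_PiM_component[where P = "\<lambda>y. y \<noteq> 1"] prob_space_lborel01 AE_lborel01_neq_1)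
    qed simp
    have bound: "AE x in cube_measure s. norm (of_real (f x - f v) * (of_real (S x) :: complex)) \<le> e * S x"
      using ae AE_space
    proof eventually_elim
      case (elim x)
      hence x: "x \<in> unit_cube s" by simp
      show ?case
      proof (cases "S x = 0")
        case False
        have dig: "dig i (x j) = z j i" if "j \<in> {1..s}" "i < n" for i j
          using False that by (auto simp: S_def split: if_splits)
        have "\<bar>x j - v j\<bar> \<le> 1 / ?b ^ n" if j: "j \<in> {1..s}" for j
        proof -
          have "0 \<le> x j" "x j < 1" using unit_cubeD[OF x j] elim(1) j by (auto simp: less_le)
          from digit_value_close[OF this dig[OF j]] show ?thesis using j by (simp add: v_def)
        qed
        from N[OF n x this] have "\<bar>f x - f v\<bar> \<le> e" .
        thus ?thesis using S0[of x] unfolding norm_mult norm_of_real by (intro mult_mono) auto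
      qed simp
    qed
    have S_int: "integrable (cube_measure s) S"
      using int[of "\<lambda>_. 1"] by (simp add: complex_of_real_integrable_eq)
    have "of_real (\<integral>x. S x \<partial>cube_measure s) = (1 :: complex)"
      using const[of 1] by (simp add: integral_complex_of_real)
    hence S1: "(\<integral>x. S x \<partial>cube_measure s) = 1" by (simp only: of_real_eq_1_iff)
    have cont: "continuous_on (unit_cube s) (\<lambda>x. f x - f v)" using f by (intro continuous_intros)
    have "(\<Sum>k\<in>?A. c k * walsh_coeff s f k) - of_real (f v) =
      (\<integral>x. of_real (f x) * (of_real (S x) :: complex) \<partial>cube_measure s) - (\<integral>x. of_real (f v) * (of_real (S x) :: complex) \<partial>cube_measure s)"
      by (simp only: val[OF f] const)
    also have "\<dots> = (\<integral>x. of_real (f x) * (of_real (S x) :: complex) - of_real (f v) * of_real (S x) \<partial>cube_measure s)"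
      by (rule Bochner_Integration.integral_diff[symmetric, OF int[OF f] int]) simp
    also have "\<dots> = (\<integral>x. of_real (f x - f v) * (of_real (S x) :: complex) \<partial>cube_measure s)"
      by (simp only: of_real_diff left_diff_distrib)
    also have "norm \<dots> \<le> (\<integral>x. norm (of_real (f x - f v) * (of_real (S x) :: complex)) \<partial>cube_measure s)"
      by (rule integral_norm_bound)
    also have "\<dots> \<le> (\<integral>x. e * S x \<partial>cube_measure s)"
      using bound by (intro integral_mono_AE integrable_norm int[OF cont] integrable_mult_right S_int)
    also have "\<dots> = e" using S1 by simp
    finally show "norm ((\<Sum>k\<in>?A. (\<Prod>j\<in>{1..s}. chi (\<Sum>i<n. coeff (k j) i * z j i)) * walsh_coeff s f k) - of_real (f v)) \<le> e"
      by (simp add: c_def)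
  qed
qed

text \<open>For a point generated by w the phases of the coordinates combine into a single residue,
  that of w (\<Sum>j. k_j g_j) / p. As the point index varies, w runs through all polynomials of
  degree below m.\<close>

lemma sum_points_chi:
  fixes p :: "'b::prime_card mod_ring poly" and g k :: "nat \<Rightarrow> 'b mod_ring poly"
  assumes p: "p \<in> monic_irred_polys m" and m: "1 \<le> m" and k: "k \<in> PiE {1..s} (\<lambda>_. polys n)"
    and nd: "\<not> p dvd (\<Sum>j=1..s. k j * g j)"
  shows "(\<Sum>h<CARD('b) ^ m. \<Prod>j\<in>{1..s}. chi (\<Sum>i<n. coeff (k j) i * laurent_coeff (k_poly m h * g j) p (Suc i))) = 0"
proof -
  let ?G = "\<Sum>j=1..s. k j * g j"
  have "(\<Prod>j\<in>{1..s}. chi (\<Sum>i<n. coeff (k j) i * laurent_coeff (w * g j) p (Suc i))) =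
      chi (coeff ((monom 1 1 * (w * ?G)) div p) 0)" for w
  proof -
    have "(\<Prod>j\<in>{1..s}. chi (\<Sum>i<n. coeff (k j) i * laurent_coeff (w * g j) p (Suc i))) =
       (\<Prod>j\<in>{1..s}. chi (coeff ((monom 1 1 * (k j * (w * g j))) div p) 0))"
      using k by (intro prod.cong refl arg_cong[of _ _ chi] sum_coeff_laurent_coeff) auto
    also have "\<dots> = chi (\<Sum>j\<in>{1..s}. coeff ((monom 1 1 * (k j * (w * g j))) div p) 0)"
      by (rule chi_sum[symmetric])
    also have "(\<Sum>j\<in>{1..s}. coeff ((monom 1 1 * (k j * (w * g j))) div p) 0) = coeff ((\<Sum>j\<in>{1..s}. monom 1 1 * (k j * (w * g j))) div p) 0"
      by (simp add: poly_div_sum_left coeff_sum)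
    also have "(\<Sum>j\<in>{1..s}. monom 1 1 * (k j * (w * g j))) = monom 1 1 * (w * ?G)"
      by (simp add: sum_distrib_left mult_ac)
    finally show ?thesis .
  qed
  hence "(\<Sum>h<CARD('b) ^ m. \<Prod>j\<in>{1..s}. chi (\<Sum>i<n. coeff (k j) i * laurent_coeff (k_poly m h * g j) p (Suc i))) =
     (\<Sum>h<CARD('b) ^ m. chi (coeff ((monom 1 1 * (k_poly m h * ?G)) div p) 0))" by simp
  also have "\<dots> = (\<Sum>w\<in>polys m. chi (coeff ((monom 1 1 * (w * ?G)) div p) 0))"
    by (rule sum.reindex_bij_betw[OF bij_betw_k_poly])
  also have "\<dots> = 0" by (rule sum_chi_residue_eq_0[OF p m nd])
  finally show ?thesis .
qed

text \<open>The nonzero part of the dual net of the polynomial lattice, cut off at n digits per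
  component to make it finite.\<close>

definition dual_vecs :: "nat \<Rightarrow> nat \<Rightarrow> 'b::prime_card mod_ring poly \<Rightarrow> (nat \<Rightarrow> 'b mod_ring poly) \<Rightarrow> (nat \<Rightarrow> 'b mod_ring poly) set" where
  "dual_vecs s n p g = {k \<in> PiE {1..s} (\<lambda>_. polys n). (\<exists>j\<in>{1..s}. k j \<noteq> 0) \<and> p dvd (\<Sum>j=1..s. k j * g j)}"

text \<open>Averaging the expansions over the points keeps the zero index, which is the integral,
  and the dual indices. The bound \<open>E\<close> must hold for every n, since the truncation
  needed for accuracy e depends on f and e.\<close>

lemma quadrature_error_le:
  fixes p :: "'b::prime_card mod_ring poly" and g :: "nat \<Rightarrow> 'b mod_ring poly" and u :: "nat \<Rightarrow> real"
  assumes b3: "3 \<le> CARD('b)" and p: "p \<in> monic_irred_polys m" and m: "1 \<le> m"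
    and f: "in_unit_ball s u f" and u: "\<And>j. j \<in> {1..s} \<Longrightarrow> 0 < u j"
    and E: "\<And>n. (\<Sum>k\<in>dual_vecs s n p g. real CARD('b) powr
        (- muv s (\<lambda>j. - log (real CARD('b)) (C_b CARD('b) / m_b CARD('b) * u j)) k)) \<le> \<epsilon>"
  shows "\<bar>Q_rule s m p g f - I_s s f\<bar> \<le> \<epsilon>"
proof (rule field_le_epsilon)
  fix e :: real assume e: "0 < e"
  let ?N = "CARD('b) ^ m"
  have Npos: "0 < real ?N" by simp
  obtain D where D: "smooth_derivs s f D" using f by (auto simp: in_unit_ball_def)
  have cont: "continuous_on (unit_cube s) f"
  proof (rule continuous_on_eq)
    show "continuous_on (unit_cube s) (D (\<lambda>_. 0))" using D unfolding smooth_derivs_def by blast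
  qed (use D in \<open>simp add: smooth_derivs_def\<close>)
  define z where "z = (\<lambda>h j i. laurent_coeff (k_poly m h * g j) p (Suc i))"
  have point: "pl_point s m p g h = restrict (\<lambda>j. digit_value (z h j)) {1..s}" for h
    by (simp add: pl_point_def nu_inf_def digit_value_def z_def)
  define c where "c = (\<lambda>n h k. \<Prod>j\<in>{1..s}. chi (\<Sum>i<n. coeff (k j) i * z h j i))"
  let ?A = "\<lambda>n. PiE {1..s} (\<lambda>_. polys n :: 'b mod_ring poly set)"
  have "\<forall>h. \<exists>N. \<forall>n\<ge>N. norm ((\<Sum>k\<in>?A n. c n h k * walsh_coeff s f k) - of_real (f (pl_point s m p g h))) \<le> e"
    unfolding c_def point using walsh_expansion[OF b3 cont e] by blast
  then obtain N where N: "\<And>h n. N h \<le> n \<Longrightarrow> norm ((\<Sum>k\<in>?A n. c n h k * walsh_coeff s f k) - of_real (f (pl_point s m p g h))) \<le> e"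
    by metis
  \<comment> \<open>One truncation order that suffices for all b^m points simultaneously.\<close>
  define n where "n = Max (insert 0 (N ` {..<?N}))"
  have n: "N h \<le> n" if "h < ?N" for h unfolding n_def using that by (intro Max_ge) auto
  let ?k0 = "\<lambda>j\<in>{1..s}. 0 :: 'b mod_ring poly"
  let ?T = "\<lambda>k. (\<Sum>h<?N. c n h k) * walsh_coeff s f k"
  have W0: "walsh_coeff s f ?k0 = of_real (I_s s f)"
  proof -
    have "walsh_coeff s f ?k0 = (\<integral>x. of_real (f x) \<partial>cube_measure s)"
      unfolding walsh_coeff_def by (intro Bochner_Integration.integral_cong) auto
    thus ?thesis by (simp add: I_s_def integral_complex_of_real)
  qed
  have T0: "?T ?k0 = of_nat ?N * of_real (I_s s f)"
    unfolding W0 by (simp add: c_def)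
  have sub: "dual_vecs s n p g \<subseteq> ?A n - {?k0}"
    by (auto simp: dual_vecs_def)
  have "(\<Sum>k\<in>?A n. ?T k) = ?T ?k0 + (\<Sum>k\<in>?A n - {?k0}. ?T k)"
    by (rule sum.remove) (simp_all add: zero_restrict_in_PiE_polys)
  also have "(\<Sum>k\<in>?A n - {?k0}. ?T k) = (\<Sum>k\<in>dual_vecs s n p g. ?T k)"
  proof (rule sum.mono_neutral_right)
    show "\<forall>k\<in>?A n - {?k0} - dual_vecs s n p g. ?T k = 0"
    proof
      fix k assume k: "k \<in> ?A n - {?k0} - dual_vecs s n p g"
      hence kA: "k \<in> ?A n" by simp
      have "\<exists>j\<in>{1..s}. k j \<noteq> 0" using k PiE_eq_zero_iff[OF kA] by auto
      with k have "\<not> p dvd (\<Sum>j=1..s. k j * g j)" by (auto simp: dual_vecs_def)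
      from sum_points_chi[OF p m kA this] show "?T k = 0" by (simp add: c_def z_def)
    qed
  qed (use sub in auto)
  finally have split: "(\<Sum>k\<in>?A n. ?T k) - of_nat ?N * of_real (I_s s f) = (\<Sum>k\<in>dual_vecs s n p g. ?T k)"
    by (simp only: T0 add_diff_cancel_left')
  have "norm (\<Sum>k\<in>dual_vecs s n p g. ?T k) \<le> (\<Sum>k\<in>dual_vecs s n p g. norm (?T k))"
    by (rule norm_sum)
  also have "\<dots> \<le> (\<Sum>k\<in>dual_vecs s n p g. real ?N * real CARD('b) powr
        (- muv s (\<lambda>j. - log (real CARD('b)) (C_b CARD('b) / m_b CARD('b) * u j)) k))"
  proof (rule sum_mono)
    fix k
    have "norm (\<Sum>h<?N. c n h k) \<le> (\<Sum>h<?N. norm (c n h k))" by (rule norm_sum)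
    also have "\<dots> = real ?N" by (simp add: c_def prod_norm[symmetric])
    finally show "norm (?T k) \<le> real ?N * real CARD('b) powr
        (- muv s (\<lambda>j. - log (real CARD('b)) (C_b CARD('b) / m_b CARD('b) * u j)) k)"
      unfolding norm_mult using norm_walsh_coeff_le[OF b3 f u, of k] by (intro mult_mono) auto
  qed
  also have "\<dots> \<le> real ?N * \<epsilon>" unfolding sum_distrib_left[symmetric] using E[of n] by (intro mult_left_mono) auto
  finally have 1: "norm ((\<Sum>k\<in>?A n. ?T k) - of_nat ?N * of_real (I_s s f)) \<le> real ?N * \<epsilon>"
    unfolding split .
  have "(\<Sum>k\<in>?A n. ?T k) = (\<Sum>h<?N. \<Sum>k\<in>?A n. c n h k * walsh_coeff s f k)"
    unfolding sum_distrib_right by (rule sum.swap)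
  hence "norm ((\<Sum>k\<in>?A n. ?T k) - (\<Sum>h<?N. of_real (f (pl_point s m p g h)))) =
     norm (\<Sum>h<?N. (\<Sum>k\<in>?A n. c n h k * walsh_coeff s f k) - of_real (f (pl_point s m p g h)))"
    by (simp only: sum_subtractf)
  also have "\<dots> \<le> (\<Sum>h<?N. e)"
    by (intro order.trans[OF norm_sum] sum_mono N n) auto
  finally have 2: "norm ((\<Sum>k\<in>?A n. ?T k) - (\<Sum>h<?N. of_real (f (pl_point s m p g h)))) \<le> real ?N * e"
    by simp
  have "norm ((\<Sum>h<?N. of_real (f (pl_point s m p g h))) - of_nat ?N * of_real (I_s s f) :: complex) \<le> real ?N * \<epsilon> + real ?N * e"
    using norm_triangle_mono[OF 1 2[unfolded norm_minus_commute[of "\<Sum>k\<in>?A n. ?T k"]]] by simp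
  also have "(\<Sum>h<?N. of_real (f (pl_point s m p g h))) - of_nat ?N * of_real (I_s s f) = (of_real ((\<Sum>h<?N. f (pl_point s m p g h)) - real ?N * I_s s f) :: complex)"
    by simp
  finally have "\<bar>(\<Sum>h<?N. f (pl_point s m p g h)) - real ?N * I_s s f\<bar> \<le> real ?N * (\<epsilon> + e)"
    unfolding norm_of_real by (simp add: algebra_simps)
  moreover have "(\<Sum>h<?N. f (pl_point s m p g h)) - real ?N * I_s s f = real ?N * (Q_rule s m p g f - I_s s f)"
    using Npos by (simp add: Q_rule_def field_simps)
  ultimately show "\<bar>Q_rule s m p g f - I_s s f\<bar> \<le> \<epsilon> + e"
    using Npos by (simp add: abs_mult)
qed

section \<open>Probability bounds\<close>

definition nonzero_vecs :: "nat \<Rightarrow> nat \<Rightarrow> (nat \<Rightarrow> 'b::prime_card mod_ring poly) set" where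
  "nonzero_vecs s n = {k \<in> PiE {1..s} (\<lambda>_. polys n). \<exists>j\<in>{1..s}. k j \<noteq> 0}"

lemma finite_nonzero_vecs [simp]: "finite (nonzero_vecs s n)"
  by (rule finite_subset[OF _ finite_PiE_polys[of "{1..s}" n]]) (auto simp: nonzero_vecs_def)

lemma finite_dual_vecs [simp]: "finite (dual_vecs s n p g)"
  by (rule finite_subset[OF _ finite_PiE_polys[of "{1..s}" n]]) (auto simp: dual_vecs_def)

lemma dual_vecs_mono: "n \<le> n' \<Longrightarrow> dual_vecs s n p g \<subseteq> dual_vecs s n' p g"
  using polys_mono[of n n'] by (fastforce simp: dual_vecs_def PiE_def Pi_def)

lemma degree_le_muv:
  assumes a: "\<And>j. j \<in> {1..s} \<Longrightarrow> 0 \<le> a j" and j: "j \<in> {1..s}" "k j \<noteq> 0"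
  shows "real (Suc (degree (k j))) \<le> muv s a k"
proof -
  have "mu (a j) (k j) \<le> muv s a k"
    unfolding muv_def using a j by (intro member_le_sum mu_nonneg) auto
  thus ?thesis using mu_ge_degree[OF j(2) a[OF j(1)]] by simp
qed

text \<open>Exchanging the sums leaves, for each k, the number of pairs to which it is dual. Indices
  are grouped by the integer part i of their weight; a group lies in [i, i+1), which is why
  \<open>cnt\<close> is stated at i + 1, and its factor i is absorbed by \<open>le_exp_powr\<close>.
  The growth function \<open>c\<close> stays abstract to serve both regimes.\<close>

lemma sum_dual_weights_le:
  fixes a :: "nat \<Rightarrow> real" and c :: "real \<Rightarrow> real" and lam tau :: real
  assumes b3: "3 \<le> CARD('b::prime_card)" and m: "1 \<le> m" and a: "\<And>j. j \<in> {1..s} \<Longrightarrow> 0 \<le> a j"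
    and lam: "0 < lam" and tau: "0 < tau"
    and cnt: "\<And>i. 1 \<le> i \<Longrightarrow> real (card {k \<in> PiE {1..s} (\<lambda>_. polys n :: 'b mod_ring poly set). muv s a k \<le> real i + 1}) \<le> exp (c (real i))"
    and summ: "summable (\<lambda>i. exp (c (real (Suc i)) - (real (Suc i) powr lam - real (Suc i) powr tau) * ln (real CARD('b))))"
  defines "PG \<equiv> (monic_irred_polys m :: 'b mod_ring poly set) \<times> PiE {1..s} (\<lambda>_. G_polys m :: 'b mod_ring poly set)"
  shows "(\<Sum>(p, g)\<in>PG. \<Sum>k\<in>dual_vecs s n p g. real CARD('b) powr (- (muv s a k powr lam))) \<le>
    3 * (\<Sum>i. exp (c (real (Suc i)) - (real (Suc i) powr lam - real (Suc i) powr tau) * ln (real CARD('b)))) /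
      ((real CARD('b) ^ m - 1) * (tau * exp 1 * ln (real CARD('b))) powr (1 / tau)) * real (card PG)"
proof -
  let ?b = "real CARD('b)"
  let ?A = "nonzero_vecs s n :: (nat \<Rightarrow> 'b mod_ring poly) set"
  let ?w = "\<lambda>k. ?b powr (- (muv s a k powr lam))"
  define T where "T = (tau * exp 1 * ln ?b) powr (1 / tau)"
  define t where "t = (\<lambda>i. exp (c (real i) - (real i powr lam - real i powr tau) * ln ?b))"
  \<comment> \<open>The integer part of the weight still dominates the integer deg + 1, so it can
    replace that factor in the divisibility bound and be constant on each group.\<close>
  define d where "d = (\<lambda>k :: nat \<Rightarrow> 'b mod_ring poly. nat \<lfloor>muv s a k\<rfloor>)"
  have b1: "?b > 1" using b3 by simp
  have lnb: "ln ?b > 0" using b1 by simp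
  have T: "T > 0" using tau lnb by (simp add: T_def)
  have "1 < ?b ^ m" using b1 m by (intro one_less_power) auto
  hence bm: "?b ^ m - 1 > 0" by simp
  have finPG: "finite PG" unfolding PG_def by (intro finite_cartesian_product finite_PiE) auto
  have d_ge: "Suc (degree (k j)) \<le> d k" if "k \<in> ?A" "j \<in> {1..s}" "k j \<noteq> 0" for k j
  proof -
    have "real (Suc (degree (k j))) \<le> muv s a k"
      using a that by (intro degree_le_muv) auto
    thus ?thesis by (simp add: d_def le_nat_floor)
  qed
  have d1: "1 \<le> d k" and d_le: "real (d k) \<le> muv s a k" "muv s a k < real (d k) + 1" if k: "k \<in> ?A" for k
  proof -
    obtain j where j: "j \<in> {1..s}" "k j \<noteq> 0" using k by (auto simp: nonzero_vecs_def)
    show "1 \<le> d k" using d_ge[OF k j] by simp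
    have "0 \<le> muv s a k" using degree_le_muv[where k = k and j = j and s = s and a = a, OF a j] by (meson of_nat_0_le_iff order.trans)
    thus "real (d k) \<le> muv s a k" "muv s a k < real (d k) + 1" by (simp_all add: d_def)
  qed
  have PGk: "real (card {(p, g) \<in> PG. p dvd (\<Sum>j=1..s. k j * g j)}) \<le> 3 * real (d k) / (?b ^ m - 1) * real (card PG)"
    if k: "k \<in> ?A" for k
  proof -
    obtain j where j: "j \<in> {1..s}" "k j \<noteq> 0" using k by (auto simp: nonzero_vecs_def)
    have "real (card {(p, g) \<in> PG. p dvd (\<Sum>j=1..s. k j * g j)}) \<le> 3 * real (Suc (degree (k j))) / (?b ^ m - 1) * real (card PG)"
      unfolding PG_def by (rule card_dual_le[where k = k and ?j0.0 = j, OF b3 m j])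
    also have "\<dots> \<le> 3 * real (d k) / (?b ^ m - 1) * real (card PG)"
      using d_ge[OF k j] bm by (intro mult_right_mono divide_right_mono mult_left_mono) auto
    finally show ?thesis .
  qed
  have key: "(\<Sum>k\<in>?A. ?w k * real (d k)) \<le> (\<Sum>i. t (Suc i)) / T"
  proof -
    define M where "M = Max (insert 1 (d ` ?A))"
    have dM: "d ` ?A \<subseteq> {1..M}"
    proof
      fix i assume "i \<in> d ` ?A"
      moreover from this have "i \<le> M" unfolding M_def by (intro Max_ge) auto
      ultimately show "i \<in> {1..M}" using d1 by auto
    qed
    have "(\<Sum>k\<in>?A. ?w k * real (d k)) = (\<Sum>i\<in>{1..M}. \<Sum>k\<in>{k \<in> ?A. d k = i}. ?w k * real (d k))"
      by (rule sum.group[symmetric]) (use dM in auto)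
    also have "\<dots> \<le> (\<Sum>i\<in>{1..M}. t i / T)"
    proof (rule sum_mono)
      fix i assume "i \<in> {1..M}"
      hence i: "1 \<le> i" by simp
      have "(\<Sum>k\<in>{k \<in> ?A. d k = i}. ?w k * real (d k)) \<le> (\<Sum>k\<in>{k \<in> ?A. d k = i}. ?b powr (- (real i powr lam)) * real i)"
      proof (rule sum_mono)
        fix k assume k: "k \<in> {k \<in> ?A. d k = i}"
        hence "real i \<le> muv s a k" using d_le(1)[of k] by auto
        hence "real i powr lam \<le> muv s a k powr lam" using lam by (intro powr_mono2) auto
        hence "?w k \<le> ?b powr (- (real i powr lam))" using b1 by simp
        thus "?w k * real (d k) \<le> ?b powr (- (real i powr lam)) * real i" using k by (intro mult_mono) auto
      qed
      also have "\<dots> = real (card {k \<in> ?A. d k = i}) * (?b powr (- (real i powr lam)) * real i)" by simp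
      also have "\<dots> \<le> exp (c (real i)) * (?b powr (- (real i powr lam)) * (?b powr (real i powr tau) / T))"
      proof (intro mult_mono)
        have "card {k \<in> ?A. d k = i} \<le> card {k \<in> PiE {1..s} (\<lambda>_. polys n :: 'b mod_ring poly set). muv s a k \<le> real i + 1}"
        proof (rule card_mono)
          show "finite {k \<in> PiE {1..s} (\<lambda>_. polys n :: 'b mod_ring poly set). muv s a k \<le> real i + 1}"
            by (rule finite_subset[OF _ finite_PiE_polys[of "{1..s}" n]]) auto
          show "{k \<in> ?A. d k = i} \<subseteq> {k \<in> PiE {1..s} (\<lambda>_. polys n). muv s a k \<le> real i + 1}"
          proof
            fix k assume "k \<in> {k \<in> ?A. d k = i}"
            thus "k \<in> {k \<in> PiE {1..s} (\<lambda>_. polys n). muv s a k \<le> real i + 1}"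
              using d_le(2)[of k] by (auto simp: nonzero_vecs_def)
          qed
        qed
        thus "real (card {k \<in> ?A. d k = i}) \<le> exp (c (real i))" using cnt[OF i] by linarith
        show "real i \<le> ?b powr (real i powr tau) / T"
          unfolding T_def using b1 tau i by (intro le_exp_powr) auto
      qed (use T in auto)
      also have "\<dots> = t i / T"
      proof -
        have pw: "?b powr (- (real i powr lam)) = exp (- (real i powr lam) * ln ?b)" "?b powr (real i powr tau) = exp (real i powr tau * ln ?b)"
          using b1 by (simp_all add: powr_def)
        have eq: "exp (c (real i)) * (exp (- (real i powr lam) * ln ?b) * exp (real i powr tau * ln ?b)) = t i"
          unfolding t_def exp_add[symmetric] by (simp add: algebra_simps)
        show ?thesis unfolding pw eq[symmetric] by simp
      qed
      finally show "(\<Sum>k\<in>{k \<in> ?A. d k = i}. ?w k * real (d k)) \<le> t i / T" .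
    qed
    also have "\<dots> = (\<Sum>i<M. t (Suc i)) / T"
      unfolding sum_divide_distrib[symmetric] by (simp add: sum.atLeast1_atMost_eq)
    also have "\<dots> \<le> (\<Sum>i. t (Suc i)) / T"
      using T summ by (intro divide_right_mono sum_le_suminf) (auto simp: t_def)
    finally show ?thesis .
  qed
  have "(\<Sum>(p, g)\<in>PG. \<Sum>k\<in>dual_vecs s n p g. ?w k) = (\<Sum>(p, g)\<in>PG. \<Sum>k\<in>?A. if p dvd (\<Sum>j=1..s. k j * g j) then ?w k else 0)"
  proof (intro sum.cong refl, clarify)
    fix p g
    have "dual_vecs s n p g = {k \<in> ?A. p dvd (\<Sum>j=1..s. k j * g j)}" by (auto simp: dual_vecs_def nonzero_vecs_def)
    thus "(\<Sum>k\<in>dual_vecs s n p g. ?w k) = (\<Sum>k\<in>?A. if p dvd (\<Sum>j=1..s. k j * g j) then ?w k else 0)"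
      by (simp add: sum.inter_filter)
  qed
  also have "\<dots> = (\<Sum>k\<in>?A. \<Sum>(p, g)\<in>PG. if p dvd (\<Sum>j=1..s. k j * g j) then ?w k else 0)"
    unfolding split_def by (rule sum.swap)
  also have "\<dots> = (\<Sum>k\<in>?A. ?w k * real (card {(p, g) \<in> PG. p dvd (\<Sum>j=1..s. k j * g j)}))"
  proof (rule sum.cong[OF refl])
    fix k :: "nat \<Rightarrow> 'b mod_ring poly"
    have "{(p, g) \<in> PG. p dvd (\<Sum>j=1..s. k j * g j)} = {x \<in> PG. fst x dvd (\<Sum>j=1..s. k j * snd x j)}" by auto
    thus "(\<Sum>(p, g)\<in>PG. if p dvd (\<Sum>j=1..s. k j * g j) then ?w k else 0) = ?w k * real (card {(p, g) \<in> PG. p dvd (\<Sum>j=1..s. k j * g j)})"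
      unfolding split_def sum.inter_filter[OF finPG, symmetric] by (simp add: split_def)
  qed
  also have "\<dots> \<le> (\<Sum>k\<in>?A. ?w k * (3 * real (d k) / (?b ^ m - 1) * real (card PG)))"
    by (intro sum_mono mult_left_mono PGk) auto
  also have "\<dots> = 3 / (?b ^ m - 1) * real (card PG) * (\<Sum>k\<in>?A. ?w k * real (d k))"
    by (simp add: sum_distrib_left mult_ac)
  also have "\<dots> \<le> 3 / (?b ^ m - 1) * real (card PG) * ((\<Sum>i. t (Suc i)) / T)"
    using key bm by (intro mult_left_mono) auto
  also have "\<dots> = 3 * (\<Sum>i. t (Suc i)) / ((?b ^ m - 1) * T) * real (card PG)" by simp
  finally show ?thesis unfolding t_def T_def .
qed

lemma finite_PG: "finite ((monic_irred_polys m :: 'b::prime_card mod_ring poly set) \<times> PiE {1..s::nat} (\<lambda>_. G_polys m :: 'b mod_ring poly set))"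
  by (intro finite_cartesian_product finite_PiE) auto

lemma card_PG_pos:
  assumes b3: "3 \<le> CARD('b::prime_card)" and m: "1 \<le> m"
  shows "0 < card ((monic_irred_polys m :: 'b mod_ring poly set) \<times> PiE {1..s::nat} (\<lambda>_. G_polys m :: 'b mod_ring poly set))"
proof -
  have N: "1 < CARD('b) ^ m" using b3 m by (intro one_less_power) auto
  have "card (monic_irred_polys m :: 'b mod_ring poly set) > 0"
    using card_monic_irred_polys_lower[OF m b3] N by (cases "card (monic_irred_polys m :: 'b mod_ring poly set)") auto
  moreover have "card (PiE {1..s} (\<lambda>_. G_polys m :: 'b mod_ring poly set)) > 0"
    using N m by (simp add: card_PiE card_G_polys)
  ultimately show ?thesis by (simp only: card_cartesian_product nat_0_less_mult_iff)
qed

lemma e_wor_le_phi_inv: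
  fixes u :: "nat \<Rightarrow> real" and p :: "'b::prime_card mod_ring poly"
  defines "a \<equiv> (\<lambda>j. - log (real CARD('b)) (C_b CARD('b) / m_b CARD('b) * u j))"
  assumes b3: "3 \<le> CARD('b)" and p: "p \<in> monic_irred_polys m" and m: "1 \<le> m"
    and u: "\<And>j. j \<in> {1..s} \<Longrightarrow> 0 < u j" and a: "\<And>j. j \<in> {1..s} \<Longrightarrow> 0 \<le> a j"
    and lam: "0 < lam" "lam \<le> 1"
    and Z: "\<And>n. (\<Sum>k\<in>dual_vecs s n p g. real CARD('b) powr (- (muv s a k powr lam))) \<le> Y"
  shows "e_wor s u m p g \<le> ereal (phi_inv CARD('b) lam Y)"
  unfolding e_wor_def
proof (rule SUP_least)
  let ?b = "CARD('b)"
  have b2: "2 \<le> ?b" using b3 by simp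
  fix f assume "f \<in> {f. in_unit_ball s u f}"
  hence f: "in_unit_ball s u f" by simp
  have E: "(\<Sum>k\<in>dual_vecs s n p g. real ?b powr (- muv s a k)) \<le> phi_inv ?b lam Y" for n
  proof (rule le_phi_inv[OF b2 lam(1)])
    show "0 \<le> (\<Sum>k\<in>dual_vecs s n p g. real ?b powr (- muv s a k))" by (intro sum_nonneg) auto
    have "phi ?b lam (\<Sum>k\<in>dual_vecs s n p g. real ?b powr (- muv s a k)) \<le> (\<Sum>k\<in>dual_vecs s n p g. phi ?b lam (real ?b powr (- muv s a k)))"
      by (rule phi_sum_le[OF b2 lam]) auto
    also have "\<dots> = (\<Sum>k\<in>dual_vecs s n p g. real ?b powr (- (muv s a k powr lam)))"
    proof (rule sum.cong[OF refl])
      fix k assume "k \<in> dual_vecs s n p g"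
      then obtain j where j: "j \<in> {1..s}" "k j \<noteq> 0" by (auto simp: dual_vecs_def)
      \<comment> \<open>Weight at least 1 places each term on the branch x \<le> 1/b of
        \<open>phi\<close>, where b^(-x) becomes b^(-x^lam).\<close>
      have "1 \<le> muv s a k" using degree_le_muv[where k = k and j = j and s = s and a = a, OF a j] by simp
      hence "real ?b powr (- muv s a k) \<le> real ?b powr (- 1)" using b2 by (intro powr_mono) auto
      also have "\<dots> = 1 / real ?b" using b2 by (simp add: powr_minus inverse_eq_divide)
      finally have "real ?b powr (- muv s a k) \<le> 1 / real ?b" .
      thus "phi ?b lam (real ?b powr (- muv s a k)) = real ?b powr (- (muv s a k powr lam))"
        using b2 by (simp add: phi_small)
    qed
    also have "\<dots> \<le> Y" by (rule Z)
    finally show "phi ?b lam (\<Sum>k\<in>dual_vecs s n p g. real ?b powr (- muv s a k)) \<le> Y" .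
  qed
  have "\<bar>Q_rule s m p g f - I_s s f\<bar> \<le> phi_inv ?b lam Y"
    by (rule quadrature_error_le[OF b3 p m f]) (erule u, rule E[unfolded a_def])
  thus "ereal \<bar>Q_rule s m p g f - I_s s f\<bar> \<le> ereal (phi_inv ?b lam Y)" by simp
qed

text \<open>Markov's inequality by counting: X bounds the mean of \<open>Z n\<close> for every n. A
  bad outcome exceeds X/\<delta> at an n of its own; as outcomes are finitely many and
  \<open>Z\<close> grows with n, one n serves for all of them.\<close>

lemma prob_err_le_phi_inv:
  fixes u :: "nat \<Rightarrow> real" and c :: "real \<Rightarrow> real" and lam tau \<delta> :: real
  defines "a \<equiv> (\<lambda>j. - log (real CARD('b::prime_card)) (C_b CARD('b) / m_b CARD('b) * u j))"
  assumes b3: "3 \<le> CARD('b)" and m: "1 \<le> m"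
    and u: "\<And>j. j \<in> {1..s} \<Longrightarrow> 0 < u j" and a: "\<And>j. j \<in> {1..s} \<Longrightarrow> 0 \<le> a j"
    and lam: "0 < lam" "lam \<le> 1" and tau: "0 < tau" and \<delta>: "0 < \<delta>"
    and cnt: "\<And>i n. 1 \<le> i \<Longrightarrow> real (card {k \<in> PiE {1..s} (\<lambda>_. polys n :: 'b mod_ring poly set). muv s a k \<le> real i + 1}) \<le> exp (c (real i))"
    and summ: "summable (\<lambda>i. exp (c (real (Suc i)) - (real (Suc i) powr lam - real (Suc i) powr tau) * ln (real CARD('b))))"
  shows "1 - \<delta> \<le> prob_err_le TYPE('b) s u m (phi_inv CARD('b) lam
    (3 * (\<Sum>i. exp (c (real (Suc i)) - (real (Suc i) powr lam - real (Suc i) powr tau) * ln (real CARD('b)))) /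
      ((real CARD('b) ^ m - 1) * \<delta> * (tau * exp 1 * ln (real CARD('b))) powr (1 / tau))))"
proof -
  let ?b = "real CARD('b)"
  define PG where "PG = (monic_irred_polys m :: 'b mod_ring poly set) \<times> PiE {1..s} (\<lambda>_. G_polys m :: 'b mod_ring poly set)"
  define C where "C = (\<Sum>i. exp (c (real (Suc i)) - (real (Suc i) powr lam - real (Suc i) powr tau) * ln ?b))"
  define X where "X = 3 * C / ((?b ^ m - 1) * (tau * exp 1 * ln ?b) powr (1 / tau))"
  define Z where "Z = (\<lambda>n (x :: 'b mod_ring poly \<times> (nat \<Rightarrow> 'b mod_ring poly)). \<Sum>k\<in>dual_vecs s n (fst x) (snd x). ?b powr (- (muv s a k powr lam)))"
  have b1: "?b > 1" using b3 by simp
  have lnb: "ln ?b > 0" using b1 by simp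
  have "1 < ?b ^ m" using b1 m by (intro one_less_power) auto
  hence bm: "?b ^ m - 1 > 0" by simp
  have C: "C > 0" unfolding C_def by (intro suminf_pos summ) auto
  have X: "X > 0" using C bm tau lnb by (simp add: X_def)
  have finPG: "finite PG" unfolding PG_def by (rule finite_PG)
  have PG0: "0 < card PG" unfolding PG_def by (rule card_PG_pos[OF b3 m])
  have Zsum: "(\<Sum>x\<in>PG. Z n x) \<le> X * real (card PG)" for n
    using sum_dual_weights_le[OF b3 m a lam(1) tau cnt summ, of n]
    by (simp add: Z_def X_def C_def PG_def split_def)
  have Z_mono: "Z n x \<le> Z n' x" if "n \<le> n'" for n n' x
    unfolding Z_def using dual_vecs_mono[OF that] by (intro sum_mono2) auto
  have Z0: "0 \<le> Z n x" for n x unfolding Z_def by (intro sum_nonneg) auto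
  define bad where "bad = {x \<in> PG. \<exists>n. X / \<delta> < Z n x}"
  have finbad: "finite bad" using finPG by (simp add: bad_def)
  have "\<forall>x\<in>bad. \<exists>n. X / \<delta> < Z n x" by (simp add: bad_def)
  from bchoice[OF this] obtain N where N: "\<forall>x\<in>bad. X / \<delta> < Z (N x) x" ..
  define n where "n = Max (insert 0 (N ` bad))"
  have Zn: "X / \<delta> \<le> Z n x" if "x \<in> bad" for x
  proof -
    have "N x \<le> n" unfolding n_def using finbad that by (intro Max_ge) auto
    from Z_mono[OF this, of x] N that show ?thesis by force
  qed
  have "real (card bad) * (X / \<delta>) \<le> (\<Sum>x\<in>bad. Z n x)"
    using sum_mono[of bad "\<lambda>_. X / \<delta>" "Z n", OF Zn] by simp
  also have "\<dots> \<le> (\<Sum>x\<in>PG. Z n x)"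
    by (intro sum_mono2 finPG) (auto simp: bad_def Z0)
  also have "\<dots> \<le> X * real (card PG)" by (rule Zsum)
  finally have bad_le: "real (card bad) \<le> \<delta> * real (card PG)"
    using X \<delta> by (simp add: field_simps)
  let ?eps = "phi_inv CARD('b) lam (X / \<delta>)"
  let ?R = "{(p, g). p \<in> monic_irred_polys m \<and> g \<in> PiE {1..s} (\<lambda>_. G_polys m :: 'b mod_ring poly set) \<and> e_wor s u m p g \<le> ereal ?eps}"
  have sub: "PG - bad \<subseteq> ?R"
  proof (clarify)
    fix p g assume pg: "(p, g) \<in> PG" "(p, g) \<notin> bad"
    hence p: "p \<in> monic_irred_polys m" and g: "g \<in> PiE {1..s} (\<lambda>_. G_polys m)" by (auto simp: PG_def)
    have Zle: "(\<Sum>k\<in>dual_vecs s n p g. ?b powr (- (muv s a k powr lam))) \<le> X / \<delta>" for n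
    proof -
      have "\<not> X / \<delta> < Z n (p, g)" using pg by (auto simp: bad_def)
      thus ?thesis by (simp add: Z_def)
    qed
    have "e_wor s u m p g \<le> ereal ?eps"
      by (rule e_wor_le_phi_inv[OF b3 p m])
         (erule u, erule a[unfolded a_def], rule lam, rule lam, rule Zle[unfolded a_def])
    with p g show "p \<in> monic_irred_polys m \<and> g \<in> PiE {1..s} (\<lambda>_. G_polys m) \<and> e_wor s u m p g \<le> ereal ?eps" by simp
  qed
  have finR: "finite ?R" by (rule finite_subset[OF _ finPG]) (auto simp: PG_def)
  have "(1 - \<delta>) * real (card PG) \<le> real (card PG) - real (card bad)" using bad_le by (simp add: algebra_simps)
  also have "\<dots> = real (card (PG - bad))"
    using card_Diff_subset[OF finbad, of PG] card_mono[OF finPG, of bad] by (simp add: bad_def of_nat_diff)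
  also have "\<dots> \<le> real (card ?R)" using card_mono[OF finR sub] by simp
  finally have "1 - \<delta> \<le> real (card ?R) / real (card PG)" using PG0 by (simp add: pos_le_divide_eq)
  moreover have "X / \<delta> = 3 * C / ((?b ^ m - 1) * \<delta> * (tau * exp 1 * ln ?b) powr (1 / tau))"
    by (simp add: X_def mult_ac)
  ultimately show ?thesis by (simp add: prob_err_le_def PG_def C_def)
qed

text \<open>There are only finitely many outcomes, so the smallest of the nested events over \<open>S\<close> is attained.\<close>

lemma prob_err_le_Inf:
  fixes S :: "real set"
  assumes S: "S \<noteq> {}" "bdd_below S" and prob: "\<And>\<epsilon>. \<epsilon> \<in> S \<Longrightarrow> r \<le> prob_err_le TYPE('b::prime_card) s u m \<epsilon>"
  shows "r \<le> prob_err_le TYPE('b) s u m (Inf S)"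
proof -
  define R where "R = (\<lambda>\<epsilon>. {(p :: 'b mod_ring poly, g). p \<in> monic_irred_polys m \<and>
                   g \<in> PiE {1..s} (\<lambda>_. G_polys m) \<and> e_wor s u m p g \<le> ereal \<epsilon>})"
  have finR: "finite (R \<epsilon>)" for \<epsilon>
    by (rule finite_subset[OF _ finite_PG[of m s]]) (auto simp: R_def)
  have R_mono: "R \<epsilon> \<subseteq> R \<epsilon>'" if "\<epsilon> \<le> \<epsilon>'" for \<epsilon> \<epsilon>'
    using that by (auto simp: R_def intro: order.trans)
  obtain e0 where e0: "e0 \<in> S" "\<And>\<epsilon>. \<epsilon> \<in> S \<Longrightarrow> card (R e0) \<le> card (R \<epsilon>)"
    using ex_has_least_nat[of "\<lambda>\<epsilon>. \<epsilon> \<in> S" _ "\<lambda>\<epsilon>. card (R \<epsilon>)"] S(1) by blast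
  have sub: "R e0 \<subseteq> R \<epsilon>" if "\<epsilon> \<in> S" for \<epsilon>
  proof (cases "e0 \<le> \<epsilon>")
    case False
    hence "R \<epsilon> \<subseteq> R e0" by (intro R_mono) simp
    with card_seteq[OF finR this e0(2)[OF that]] show ?thesis by simp
  qed (rule R_mono)
  have "R e0 \<subseteq> R (Inf S)"
  proof (clarify)
    fix p g assume pg: "(p, g) \<in> R e0"
    have le: "e_wor s u m p g \<le> ereal \<epsilon>" if "\<epsilon> \<in> S" for \<epsilon> using sub[OF that] pg by (auto simp: R_def)
    have "e_wor s u m p g \<le> ereal (Inf S)"
    proof (cases "e_wor s u m p g")
      case (real x)
      have "x \<le> Inf S" using le real by (intro cInf_greatest S(1)) auto
      thus ?thesis using real by simp
    next
      case PInf
      thus ?thesis using le[OF e0(1)] by simp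
    qed simp
    thus "(p, g) \<in> R (Inf S)" using pg by (auto simp: R_def)
  qed
  hence "card (R e0) \<le> card (R (Inf S))" by (intro card_mono finR)
  hence "prob_err_le TYPE('b) s u m e0 \<le> prob_err_le TYPE('b) s u m (Inf S)"
    unfolding prob_err_le_def R_def by (intro divide_right_mono) auto
  with prob[OF e0(1)] show ?thesis by linarith
qed

section \<open>Counting indices of bounded weight in the two regimes\<close>

lemma card_muv_le_const:
  fixes a :: "nat \<Rightarrow> real"
  assumes b2: "2 \<le> CARD('b::prime_card)" and s: "1 \<le> s" and a: "\<And>j. j \<in> {1..s} \<Longrightarrow> 0 \<le> a j" and M: "0 < M"
  shows "real (card {k \<in> PiE {1..s} (\<lambda>_. polys n :: 'b mod_ring poly set). muv s a k \<le> M}) \<le>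
    exp (2 * sqrt (real s * (real CARD('b) - 1) * M))"
proof -
  let ?b = "real CARD('b)"
  define A where "A = real s * (?b - 1)"
  have A: "A > 0" using s b2 by (simp add: A_def)
  \<comment> \<open>The minimiser of t M + A/t, with minimum 2 sqrt(A M); the exponentials with a_j
    are bounded by 1.\<close>
  define t where "t = sqrt (A / M)"
  have t: "t > 0" using A M by (simp add: t_def)
  have "(\<Sum>j=1..s. exp (- t * a j)) \<le> (\<Sum>j=1..s. 1)"
    using t a by (intro sum_mono) (auto simp: mult_nonneg_nonneg)
  hence "(?b - 1) / t * (\<Sum>j=1..s. exp (- t * a j)) \<le> (?b - 1) / t * real s"
    using t b2 by (intro mult_left_mono) auto
  also have "\<dots> = A / t" by (simp add: A_def)
  finally have "t * M + (?b - 1) / t * (\<Sum>j=1..s. exp (- t * a j)) \<le> t * M + A / t" by simp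
  also have "\<dots> = 2 * sqrt (A * M)"
  proof -
    have "t * M = sqrt (A * M)" using A M by (simp add: t_def real_sqrt_divide real_sqrt_mult real_div_sqrt field_simps)
    moreover have "A / t = sqrt (A * M)" using A M by (simp add: t_def real_sqrt_divide real_sqrt_mult field_simps)
    ultimately show ?thesis by simp
  qed
  finally have "exp (t * M + (?b - 1) / t * (\<Sum>j=1..s. exp (- t * a j))) \<le> exp (2 * sqrt (A * M))" by simp
  with card_muv_le[OF t, of s n a M, where 'a = "'b mod_ring"]
  have "real (card {k \<in> PiE {1..s} (\<lambda>_. polys n :: 'b mod_ring poly set). muv s a k \<le> M}) \<le> exp (2 * sqrt (A * M))"
    unfolding CARD_mod_ring by (rule order.trans)
  thus ?thesis unfolding A_def .
qed

lemma card_muv_le_growing: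
  fixes a :: "nat \<Rightarrow> real"
  assumes b2: "2 \<le> CARD('b::prime_card)" and a0: "0 < a0" and q: "0 < q" and M: "1 \<le> M"
    and a: "\<And>j. j \<in> {1..s} \<Longrightarrow> a0 * (real j - 1) powr q \<le> a j"
  shows "real (card {k \<in> PiE {1..s} (\<lambda>_. polys n :: 'b mod_ring poly set). muv s a k \<le> M}) \<le>
    exp (A_const CARD('b) a0 q * M powr ((q + 1) / (2 * q + 1)))"
proof -
  let ?b = "real CARD('b)"
  \<comment> \<open>The sum over j will be of order t^(-1/q), so this choice balances t M against
    t^(-1-1/q); both then equal M^((q+1)/(2q+1)).\<close>
  define t where "t = M powr (- (q / (2 * q + 1)))"
  define r where "r = (q + 1) / (2 * q + 1)"
  define G where "G = Gamma (1 / q) / (q * a0 powr (1 / q))"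
  have t: "t > 0" using M by (simp add: t_def)
  have t1: "t \<le> 1" unfolding t_def using powr_mono[of "- (q / (2 * q + 1))" 0 M] M q by simp
  have G: "G \<ge> 0" unfolding G_def using q a0 by (intro divide_nonneg_nonneg less_imp_le[OF Gamma_real_pos]) auto
  have sum_le: "(\<Sum>j=1..s. exp (- t * a j)) \<le> 1 + G * t powr (- (1 / q))"
  proof -
    have "(\<Sum>j=1..s. exp (- t * a j)) \<le> (\<Sum>j=1..s. exp (- (t * a0 * (real j - 1) powr q)))"
    proof (rule sum_mono)
      fix j assume "j \<in> {1..s}"
      from mult_left_mono[OF a[OF this], of t] t show "exp (- t * a j) \<le> exp (- (t * a0 * (real j - 1) powr q))"
        by (simp add: mult_ac)
    qed
    also have "\<dots> = (\<Sum>j<s. exp (- (t * a0 * real j powr q)))"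
      by (simp add: sum.atLeast1_atMost_eq)
    \<comment> \<open>The shifted index 0, the first coordinate, contributes exp 0 = 1 and is kept
      apart, because the Gamma bound starts at 1.\<close>
    also have "\<dots> \<le> (\<Sum>j\<in>insert 0 {1..s}. exp (- (t * a0 * real j powr q)))"
      by (intro sum_mono2) auto
    also have "\<dots> = 1 + (\<Sum>j=1..s. exp (- (t * a0 * real j powr q)))"
      by simp
    also have "(\<Sum>j=1..s. exp (- (t * a0 * real j powr q))) \<le> Gamma (1 / q) / (q * (t * a0) powr (1 / q))"
      using t a0 q by (intro sum_exp_powr_le_Gamma) auto
    also have "\<dots> = G * t powr (- (1 / q))"
      using t a0 by (simp add: G_def powr_mult powr_minus field_simps)
    finally show ?thesis by simp
  qed
  have tM: "t * M = M powr r"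
  proof -
    have "t * M = M powr (- (q / (2 * q + 1)) + 1)" using M by (simp only: powr_add t_def) simp
    also have "- (q / (2 * q + 1)) + 1 = r" using q by (simp add: r_def field_simps)
    finally show ?thesis .
  qed
  have "1 / t * (1 + G * t powr (- (1 / q))) \<le> (1 + G) * M powr r"
  proof -
    \<comment> \<open>As t \<le> 1, the separate 1 is absorbed into t^(-1/q); this yields the factor
      1 + Gamma(1/q)/(q a^(1/q)) of \<open>A_const\<close>.\<close>
    have "t powr 0 \<le> t powr (- (1 / q))" using t t1 q by (intro powr_mono') auto
    hence "1 + G * t powr (- (1 / q)) \<le> (1 + G) * t powr (- (1 / q))" using t by (simp add: algebra_simps)
    hence "1 / t * (1 + G * t powr (- (1 / q))) \<le> 1 / t * ((1 + G) * t powr (- (1 / q)))" using t by (intro mult_left_mono) auto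
    also have "\<dots> = (1 + G) * t powr (- 1 + - (1 / q))" using t by (simp only: powr_add) (simp add: powr_minus field_simps)
    also have "t powr (- 1 + - (1 / q)) = M powr r"
    proof -
      have "- (q / (2 * q + 1)) * (- 1 + - (1 / q)) = r" using q by (simp add: r_def field_simps)
      thus ?thesis by (simp add: t_def powr_powr)
    qed
    finally show ?thesis .
  qed
  hence "(?b - 1) * (1 / t * (1 + G * t powr (- (1 / q)))) \<le> (?b - 1) * ((1 + G) * M powr r)"
    using b2 by (intro mult_left_mono) auto
  moreover have "(?b - 1) / t * (\<Sum>j=1..s. exp (- t * a j)) \<le> (?b - 1) / t * (1 + G * t powr (- (1 / q)))"
    using sum_le t b2 by (intro mult_left_mono) auto
  ultimately have "t * M + (?b - 1) / t * (\<Sum>j=1..s. exp (- t * a j)) \<le> M powr r + (?b - 1) * ((1 + G) * M powr r)"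
    unfolding tM by simp
  also have "\<dots> = A_const CARD('b) a0 q * M powr r" by (simp add: A_const_def G_def algebra_simps)
  finally have "exp (t * M + (?b - 1) / t * (\<Sum>j=1..s. exp (- t * a j))) \<le> exp (A_const CARD('b) a0 q * M powr r)" by simp
  with card_muv_le[OF t, of s n a M, where 'a = "'b mod_ring"]
  have "real (card {k \<in> PiE {1..s} (\<lambda>_. polys n :: 'b mod_ring poly set). muv s a k \<le> M}) \<le> exp (A_const CARD('b) a0 q * M powr r)"
    unfolding CARD_mod_ring by (rule order.trans)
  thus ?thesis unfolding r_def .
qed

text \<open>Common frame of both parts: the logarithm of the number of indices of weight at most x +
  1 is bounded by A (x+1)^r, with r = 1/2 or (q+1)/(2q+1), and r is the lower limit for
  \<open>lam\<close>.\<close>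

lemma prob_err_le_Inf_phi_inv:
  fixes u :: "nat \<Rightarrow> real" and c :: "real \<Rightarrow> real" and A r \<delta> :: real
  defines "a \<equiv> (\<lambda>j. - log (real CARD('b::prime_card)) (C_b CARD('b) / m_b CARD('b) * u j))"
  assumes b3: "3 \<le> CARD('b)" and m: "1 \<le> m"
    and u: "\<And>j. j \<in> {1..s} \<Longrightarrow> 0 < u j" and a: "\<And>j. j \<in> {1..s} \<Longrightarrow> 0 \<le> a j"
    and \<delta>: "0 < \<delta>" and r: "0 < r" "r < 1" and A: "0 < A"
    and c: "\<And>x. 0 \<le> x \<Longrightarrow> c x = A * (x + 1) powr r"
    and cnt: "\<And>i n. 1 \<le> i \<Longrightarrow> real (card {k \<in> PiE {1..s} (\<lambda>_. polys n :: 'b mod_ring poly set). muv s a k \<le> real i + 1}) \<le> exp (c (real i))"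
    and C: "\<And>lam tau. C lam tau = (\<Sum>i. exp (c (real (Suc i)) - (real (Suc i) powr lam - real (Suc i) powr tau) * ln (real CARD('b))))"
  shows "1 - \<delta> \<le> prob_err_le TYPE('b) s u m
         (Inf {phi_inv CARD('b) lam (3 * C lam tau /
                 ((real CARD('b) ^ m - 1) * \<delta> * (tau * exp 1 * ln (real CARD('b))) powr (1 / tau))) |
               lam tau. r < lam \<and> lam < 1 \<and> 0 < tau \<and> tau < min lam (1 / ln (real CARD('b)))})"
proof (rule prob_err_le_Inf)
  let ?b = "real CARD('b)"
  let ?Y = "\<lambda>lam tau. 3 * C lam tau / ((?b ^ m - 1) * \<delta> * (tau * exp 1 * ln ?b) powr (1 / tau))"
  let ?S = "{phi_inv CARD('b) lam (?Y lam tau) | lam tau. r < lam \<and> lam < 1 \<and> 0 < tau \<and> tau < min lam (1 / ln ?b)}"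
  have b1: "?b > 1" using b3 by simp
  have lnb: "ln ?b > 0" using b1 by simp
  have "1 < ?b ^ m" using b1 m by (intro one_less_power) auto
  hence bm: "?b ^ m - 1 > 0" by simp
  have summ: "summable (\<lambda>i. exp (c (real (Suc i)) - (real (Suc i) powr lam - real (Suc i) powr tau) * ln ?b))"
    if "r < lam" "lam < 1" "0 < tau" "tau < lam" for lam tau
    using summable_exp_powr_diff[OF r(1) that(1,3,4,2) lnb A] by (simp add: c)
  \<comment> \<open>An admissible pair is lam0 with tau = w/2. A nonempty set bounded below is
    needed for the real infimum to be meaningful.\<close>
  define lam0 where "lam0 = (r + 1) / 2"
  define w where "w = min lam0 (1 / ln ?b)"
  have "r < lam0" "lam0 < 1" using r by (simp_all add: lam0_def)
  moreover have "0 < w" using r lnb by (simp add: w_def lam0_def)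
  hence "0 < w / 2" "w / 2 < min lam0 (1 / ln ?b)" unfolding w_def[symmetric] by simp_all
  ultimately show "?S \<noteq> {}" by blast
  show "bdd_below ?S"
  proof (rule bdd_belowI[of _ 0])
    fix x assume "x \<in> ?S"
    then obtain lam tau where x: "x = phi_inv CARD('b) lam (?Y lam tau)"
      and lt: "r < lam" "lam < 1" "0 < tau" "tau < min lam (1 / ln ?b)" by blast
    have "0 \<le> C lam tau" unfolding C by (intro suminf_nonneg summ) (use lt in auto)
    hence "0 \<le> ?Y lam tau" using bm \<delta> by (intro divide_nonneg_nonneg mult_nonneg_nonneg) auto
    thus "0 \<le> x" unfolding x using b3 r lt by (intro phi_inv_nonneg) auto
  qed
  fix x assume "x \<in> ?S"
  then obtain lam tau where x: "x = phi_inv CARD('b) lam (?Y lam tau)"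
    and lt: "r < lam" "lam < 1" "0 < tau" "tau < min lam (1 / ln ?b)" by blast
  show "1 - \<delta> \<le> prob_err_le TYPE('b) s u m x"
    unfolding x C
  proof (rule prob_err_le_phi_inv[OF b3 m])
    show "0 < u j" if "j \<in> {1..s}" for j using u that .
    show "0 \<le> - log ?b (C_b CARD('b) / m_b CARD('b) * u j)" if "j \<in> {1..s}" for j using a[OF that] unfolding a_def .
    show "real (card {k \<in> PiE {1..s} (\<lambda>_. polys n :: 'b mod_ring poly set).
        muv s (\<lambda>j. - log ?b (C_b CARD('b) / m_b CARD('b) * u j)) k \<le> real i + 1}) \<le> exp (c (real i))" if "1 \<le> i" for i n
      using cnt[OF that] unfolding a_def .
    show "summable (\<lambda>i. exp (c (real (Suc i)) - (real (Suc i) powr lam - real (Suc i) powr tau) * ln ?b))"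
      by (rule summ) (use lt in auto)
  qed (use lt r \<delta> in auto)
qed

theorem theorem3p18:
  fixes u :: "nat \<Rightarrow> real" and s m :: nat and \<delta> :: real
  defines "b \<equiv> CARD('b)"
  defines "aa \<equiv> (\<lambda>j. - log (real b) (C_b b / m_b b * u j))"
  assumes b3: "b \<ge> 3"
    and m_pos: "m \<ge> 1" and s_pos: "s \<ge> 1"
    and u1: "u 1 \<le> m_b b / C_b b"
    and u_mono: "\<And>j. j \<ge> 1 \<Longrightarrow> u (Suc j) \<le> u j"
    and u_pos: "\<And>j. j \<ge> 1 \<Longrightarrow> u j > 0"
    and \<delta>: "0 < \<delta>" "\<delta> < 1"
  shows
    "((\<exists>a\<ge>0. \<forall>j\<ge>1. aa j = a) \<longrightarrow>
       prob_err_le TYPE('b::prime_card) s u m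
         (Inf {phi_inv b lam (3 * C_const1 b s lam tau /
                 ((real b ^ m - 1) * \<delta> * (tau * exp 1 * ln (real b)) powr (1 / tau))) |
               lam tau. 1/2 < lam \<and> lam < 1 \<and> 0 < tau \<and> tau < min lam (1 / ln (real b))})
         \<ge> 1 - \<delta>) \<and>
     (\<forall>a q. a > 0 \<longrightarrow> q > 0 \<longrightarrow> (\<forall>j\<ge>1. aa j \<ge> a * (real j - 1) powr q) \<longrightarrow>
       prob_err_le TYPE('b::prime_card) s u m
         (Inf {phi_inv b lam (3 * C_const2 b a q lam tau /
                 ((real b ^ m - 1) * \<delta> * (tau * exp 1 * ln (real b)) powr (1 / tau))) |
               lam tau. (q + 1) / (2 * q + 1) < lam \<and> lam < 1 \<and> 0 < tau \<and>
                        tau < min lam (1 / ln (real b))})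
         \<ge> 1 - \<delta>)"
proof -
  let ?c = "C_b b / m_b b"
  have b3': "3 \<le> CARD('b)" and b2: "2 \<le> CARD('b)" using b3 by (simp_all add: b_def)
  have M: "0 \<le> M_b b" using norm_chi_minus_1_le_M_b[of "0 :: 'b mod_ring"] by (simp add: b_def)
  have m: "0 < m_b b" using b3 by (intro m_b_pos) auto
  have C: "0 < C_b b" using M_b_plus_m_b_le_C_b(2)[OF b3 M] .
  have u_le: "u j \<le> u 1" if "j \<ge> 1" for j
    using that by (induction j rule: dec_induct) (use u_mono in \<open>force+\<close>)
  have aa0: "0 \<le> aa j" if "j \<in> {1..s}" for j
  proof -
    have j: "j \<ge> 1" using that by simp
    have "u j \<le> m_b b / C_b b" using u_le[OF j] u1 by linarith
    hence "?c * u j \<le> ?c * (m_b b / C_b b)" using C m by (intro mult_left_mono) auto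
    hence "?c * u j \<le> 1" using C m by simp
    moreover have "0 < ?c * u j" using C m u_pos[OF j] by simp
    ultimately show ?thesis using b3 unfolding aa_def by (simp add: log_le_zero_cancel_iff)
  qed
  have u: "0 < u j" if "j \<in> {1..s}" for j using u_pos that by simp
  have sqrt_powr: "2 * sqrt (real s * (real b - 1) * (x + 1)) = 2 * sqrt (real s * (real b - 1)) * (x + 1) powr (1 / 2)"
    if "0 \<le> x" for x using that by (simp add: real_sqrt_mult powr_half_sqrt)
  have part1: "prob_err_le TYPE('b) s u m
         (Inf {phi_inv b lam (3 * C_const1 b s lam tau /
                 ((real b ^ m - 1) * \<delta> * (tau * exp 1 * ln (real b)) powr (1 / tau))) |
               lam tau. 1/2 < lam \<and> lam < 1 \<and> 0 < tau \<and> tau < min lam (1 / ln (real b))}) \<ge> 1 - \<delta>"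
    unfolding b_def
  proof (rule prob_err_le_Inf_phi_inv[where c = "\<lambda>x. 2 * sqrt (real s * (real CARD('b) - 1) * (x + 1))" and
        A = "2 * sqrt (real s * (real CARD('b) - 1))"])
    show "0 \<le> - log (real CARD('b)) (C_b CARD('b) / m_b CARD('b) * u j)" if "j \<in> {1..s}" for j
      using aa0[OF that] unfolding aa_def b_def .
    show "real (card {k \<in> PiE {1..s} (\<lambda>_. polys n :: 'b mod_ring poly set).
        muv s (\<lambda>j. - log (real CARD('b)) (C_b CARD('b) / m_b CARD('b) * u j)) k \<le> real i + 1})
        \<le> exp (2 * sqrt (real s * (real CARD('b) - 1) * (real i + 1)))" for i n
      by (rule card_muv_le_const[OF b2 s_pos]) (use aa0 in \<open>auto simp: aa_def b_def\<close>)
    show "C_const1 CARD('b) s lam tau = (\<Sum>i. exp (2 * sqrt (real s * (real CARD('b) - 1) * (real (Suc i) + 1)) -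
        (real (Suc i) powr lam - real (Suc i) powr tau) * ln (real CARD('b))))" for lam tau
      by (simp only: C_const1_def Let_def)
  qed (use b3' m_pos s_pos u \<delta> sqrt_powr in \<open>auto simp: b_def\<close>)
  have part2: "prob_err_le TYPE('b) s u m
         (Inf {phi_inv b lam (3 * C_const2 b a q lam tau /
                 ((real b ^ m - 1) * \<delta> * (tau * exp 1 * ln (real b)) powr (1 / tau))) |
               lam tau. (q + 1) / (2 * q + 1) < lam \<and> lam < 1 \<and> 0 < tau \<and>
                        tau < min lam (1 / ln (real b))}) \<ge> 1 - \<delta>"
    if a: "a > 0" and q: "q > 0" and aa: "\<forall>j\<ge>1. aa j \<ge> a * (real j - 1) powr q" for a q
    unfolding b_def
  proof (rule prob_err_le_Inf_phi_inv[where c = "\<lambda>x. A_const CARD('b) a q * (x + 1) powr ((q + 1) / (2 * q + 1))" and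
        A = "A_const CARD('b) a q"])
    show "0 \<le> - log (real CARD('b)) (C_b CARD('b) / m_b CARD('b) * u j)" if "j \<in> {1..s}" for j
      using aa0[OF that] unfolding aa_def b_def .
    show "real (card {k \<in> PiE {1..s} (\<lambda>_. polys n :: 'b mod_ring poly set).
        muv s (\<lambda>j. - log (real CARD('b)) (C_b CARD('b) / m_b CARD('b) * u j)) k \<le> real i + 1})
        \<le> exp (A_const CARD('b) a q * (real i + 1) powr ((q + 1) / (2 * q + 1)))" for i n
      by (rule card_muv_le_growing[OF b2 a q]) (use aa in \<open>auto simp: aa_def b_def\<close>)
    show "C_const2 CARD('b) a q lam tau = (\<Sum>i. exp (A_const CARD('b) a q * (real (Suc i) + 1) powr ((q + 1) / (2 * q + 1)) -
        (real (Suc i) powr lam - real (Suc i) powr tau) * ln (real CARD('b))))" for lam tau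
      by (simp only: C_const2_def Let_def)
    have "0 \<le> Gamma (1 / q) / (q * a powr (1 / q))"
      using q a by (intro divide_nonneg_nonneg less_imp_le[OF Gamma_real_pos]) auto
    hence "0 \<le> (real CARD('b) - 1) * (1 + Gamma (1 / q) / (q * a powr (1 / q)))"
      using b2 by (intro mult_nonneg_nonneg) auto
    thus "0 < A_const CARD('b) a q" by (simp add: A_const_def)
  qed (use b3' m_pos s_pos u \<delta> q in \<open>auto simp: field_simps\<close>)
  show ?thesis using part1 part2 by blast
qed

end
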